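(* Let $0<p,q<\infty$ and let $\mu$ be a $(p,q)$-Carleson measure on the unit disk $\mathbb D$ supported on an infinite subset of $\mathbb D$. The following are equivalent: (i) The range of the embedding operator $j_{p,q}(\mu):H^p\hookrightarrow L^q(\mu)$ is closed in $L^q(\mu)$; (ii) $p=q$ and $\mu$ has the form $\sum_n a_n\delta_{z_n}$, where $\{z_n\}$ is an interpolating sequence in $\mathbb D$ and the positive numbers $a_n$ satisfy $a_n\asymp 1-|z_n|$.
   Context: $\mathbb D=\{z\in\mathbb C:|z|<1\}$, $\mathbb T=\partial\mathbb D$, and $m$ is normalized arc length measure on $\mathbb T$. For $0<p<\infty$, the Hardy space $H^p$ is the set of holomorphic $f$ on $\mathbb D$ with $\|f\|_{H^p}=\sup_{0<r<1}\left(\int_{\mathbb T}|f(r\zeta)|^p\,dm(\zeta)\right)^{1/p}<\infty$ (a quasinorm when $p<1$); $H^\infty$ is the space of bounded holomorphic functions on $\mathbb D$. For a positive Borel measure $\mu$ on $\mathbb D$ and $0<q<\infty$, $L^q(\mu)=L^q(\mathbb D,\mu)$ is the usual (quasi-)normed space of (classes of) Borel measurable functions $f:\mathbb D\to\mathbb C$ with $\|f\|_{L^q(\mu)}=\left(\int_{\mathbb D}|f|^q\,d\mu\right)^{1/q}<\infty$. A $(p,q)$-Carleson measure is a positive Borel measure $\mu$ on $\mathbb D$ such that $H^p\subset L^q(\mu)$, i.e. every $f\in H^p$ satisfies $\int_{\mathbb D}|f|^q\,d\mu<\infty$. For such $\mu$, $j_{p,q}(\mu):H^p\to L^q(\mu)$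 is the (automatically continuous) linear operator sending $f\in H^p$ to its restriction to the support of $\mu$, i.e. to $f$ viewed as an element of $L^q(\mu)$. "Supported on an infinite subset" means that the case where $\mu$ is supported on (i.e. concentrated on) a finite set of points of $\mathbb D$ is excluded. $\delta_z$ is the unit point mass at $z$. An interpolating (or $H^\infty$-interpolating) sequence is an infinite sequence $\{z_n\}$ of pairwise distinct points in $\mathbb D$ such that $\{\,\{f(z_n)\}:f\in H^\infty\}=\ell^\infty$. The relation $a_n\asymp 1-|z_n|$ means $0<\inf_n\frac{a_n}{1-|z_n|}\le\sup_n\frac{a_n}{1-|z_n|}<\infty$. *)

theory Defs
  imports "HOL-Complex_Analysis.Complex_Analysis" "HOL-Probability.Probability"
begin

abbreviation unit_disk :: "complex set" where
  "unit_disk \<equiv> ball 0 1"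

abbreviation disk_borel :: "complex measure" where
  "disk_borel \<equiv> restrict_space borel unit_disk"

abbreviation circle_borel :: "complex measure" where
  "circle_borel \<equiv> restrict_space borel (sphere 0 1)"

definition arc_measure :: "complex measure" where
  "arc_measure = distr (uniform_measure lborel {0..<2*pi}) circle_borel cis"

text \<open>Functions on the disk are total functions of type \<^typ>\<open>complex \<Rightarrow> complex\<close> whose
  values outside \<^term>\<open>unit_disk\<close> are irrelevant; this is why \<^const>\<open>arc_measure\<close> lives on the
  circle itself, as on the whole plane the integrand below need not be measurable. For holomorphic
  \<open>f\<close> it is continuous on the circle, hence integrable (see \<open>integrable_circle_mean\<close>). The
  supremum is taken in \<^typ>\<open>ennreal\<close> so that it may be infinite.\<close>

definition hardy_norm :: "real \<Rightarrow> (complex \<Rightarrow> complex) \<Rightarrow> ennreal" where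
  "hardy_norm p f =
     (SUP r\<in>{0<..<1::real}.
        ennreal ((LINT \<zeta>|arc_measure. norm (f (of_real r * \<zeta>)) powr p) powr (1 / p)))"

lemma prob_space_arc_measure: "prob_space arc_measure"
proof -
  have "prob_space (uniform_measure lborel {0..<2*pi})"
    by (rule prob_space_uniform_measure) (simp_all add: emeasure_lborel_Ico)
  moreover have "cis \<in> measurable (uniform_measure lborel {0..<2*pi}) circle_borel"
  proof (rule measurable_restrict_space2)
    have "cis \<in> borel_measurable borel"
      by (intro borel_measurable_continuous_onI continuous_on_cis continuous_on_id)
    moreover have "sets (uniform_measure lborel {0..<2*pi}) = sets (borel :: real measure)"
      by simp
    ultimately show "cis \<in> borel_measurable (uniform_measure lborel {0..<2*pi})"
      using measurable_cong_sets by blast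
  qed auto
  ultimately show ?thesis
    unfolding arc_measure_def by (rule prob_space.prob_space_distr)
qed

lemma integrable_circle_mean:
  assumes f: "f holomorphic_on unit_disk" and r: "r \<in> {0<..<1}" and p: "0 < p"
  shows "integrable arc_measure (\<lambda>\<zeta>. norm (f (of_real r * \<zeta>)) powr p)"
proof -
  interpret prob_space arc_measure by (rule prob_space_arc_measure)
  let ?h = "\<lambda>\<zeta>::complex. norm (f (of_real r * \<zeta>)) powr p"
  have sub: "of_real r * \<zeta> \<in> unit_disk" if "\<zeta> \<in> sphere 0 1" for \<zeta> :: complex
    using r that by (simp add: norm_mult)
  have "continuous_on (sphere 0 1) (\<lambda>\<zeta>. f (of_real r * \<zeta>))"
  proof (rule continuous_on_compose2[OF holomorphic_on_imp_continuous_on[OF f]])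
    show "continuous_on (sphere 0 1) (\<lambda>\<zeta>. of_real r * \<zeta> :: complex)"
      by (intro continuous_intros)
    show "(\<lambda>\<zeta>. of_real r * \<zeta>) ` sphere 0 1 \<subseteq> unit_disk"
      using sub by blast
  qed
  then have cont: "continuous_on (sphere 0 1) ?h"
    by (intro continuous_on_powr' continuous_on_norm continuous_on_const) (use p in auto)
  then have "compact (?h ` sphere 0 1)"
    by (intro compact_continuous_image compact_sphere)
  then have "bounded (?h ` sphere 0 1)"
    by (rule compact_imp_bounded)
  then obtain B where B: "\<And>\<zeta>. \<zeta> \<in> sphere 0 1 \<Longrightarrow> norm (?h \<zeta>) \<le> B"
    unfolding bounded_iff by blast
  have meas: "?h \<in> borel_measurable arc_measure"
    using borel_measurable_continuous_on_restrict[OF cont]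
    by (simp add: arc_measure_def)
  have "space arc_measure = sphere 0 1"
    by (simp add: arc_measure_def space_restrict_space)
  with B have "AE \<zeta> in arc_measure. norm (?h \<zeta>) \<le> B"
    by (intro AE_I2) auto
  then show ?thesis
    by (rule integrable_const_bound) (rule meas)
qed

definition hardy_space :: "real \<Rightarrow> (complex \<Rightarrow> complex) set" where
  "hardy_space p = {f. f holomorphic_on unit_disk \<and> hardy_norm p f < \<infinity>}"

definition hardy_infinity :: "(complex \<Rightarrow> complex) set" where
  "hardy_infinity = {f. f holomorphic_on unit_disk \<and> bounded (f ` unit_disk)}"

definition Lq_fun :: "real \<Rightarrow> complex measure \<Rightarrow> (complex \<Rightarrow> complex) set" where
  "Lq_fun q \<mu> = {f \<in> borel_measurable \<mu>. integrable \<mu> (\<lambda>z. norm (f z) powr q)}"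

definition Lq_norm :: "real \<Rightarrow> complex measure \<Rightarrow> (complex \<Rightarrow> complex) \<Rightarrow> real" where
  "Lq_norm q \<mu> f = (LINT z|\<mu>. norm (f z) powr q) powr (1 / q)"

definition Lq_rel ::
  "real \<Rightarrow> complex measure \<Rightarrow> ((complex \<Rightarrow> complex) \<times> (complex \<Rightarrow> complex)) set" where
  "Lq_rel q \<mu> = {(f, g). f \<in> Lq_fun q \<mu> \<and> g \<in> Lq_fun q \<mu> \<and> (AE z in \<mu>. f z = g z)}"

definition Lq_class ::
  "real \<Rightarrow> complex measure \<Rightarrow> (complex \<Rightarrow> complex) \<Rightarrow> (complex \<Rightarrow> complex) set" where
  "Lq_class q \<mu> f = Lq_rel q \<mu> `` {f}"

definition Lq_space :: "real \<Rightarrow> complex measure \<Rightarrow> (complex \<Rightarrow> complex) set set" where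
  "Lq_space q \<mu> = Lq_fun q \<mu> // Lq_rel q \<mu>"

text \<open>The topology of the (quasi-)norm on the space of classes. It is written down directly,
  rather than as a metric topology, since for \<open>q < 1\<close> the (quasi-)norm violates the triangle
  inequality.\<close>

definition Lq_open :: "real \<Rightarrow> complex measure \<Rightarrow> (complex \<Rightarrow> complex) set set \<Rightarrow> bool" where
  "Lq_open q \<mu> U \<longleftrightarrow> U \<subseteq> Lq_space q \<mu> \<and>
     (\<forall>f\<in>Lq_fun q \<mu>. Lq_class q \<mu> f \<in> U \<longrightarrow>
        (\<exists>\<epsilon>>0. \<forall>g\<in>Lq_fun q \<mu>. Lq_norm q \<mu> (\<lambda>z. g z - f z) < \<epsilon> \<longrightarrow> Lq_class q \<mu> g \<in> U))"

definition Lq_topology :: "real \<Rightarrow> complex measure \<Rightarrow> (complex \<Rightarrow> complex) set topology" where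
  "Lq_topology q \<mu> = topology (Lq_open q \<mu>)"

lemma istopology_Lq_open: "istopology (Lq_open q \<mu>)"
  unfolding istopology_def
proof (intro conjI allI impI)
  fix S T assume S: "Lq_open q \<mu> S" and T: "Lq_open q \<mu> T"
  show "Lq_open q \<mu> (S \<inter> T)"
    unfolding Lq_open_def
  proof (intro conjI ballI impI)
    show "S \<inter> T \<subseteq> Lq_space q \<mu>"
      using S by (auto simp: Lq_open_def)
  next
    fix f assume f: "f \<in> Lq_fun q \<mu>" "Lq_class q \<mu> f \<in> S \<inter> T"
    obtain d where "d > 0" and d: "\<And>g. g \<in> Lq_fun q \<mu> \<Longrightarrow>
        Lq_norm q \<mu> (\<lambda>z. g z - f z) < d \<Longrightarrow> Lq_class q \<mu> g \<in> S"
      using S f unfolding Lq_open_def by blast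
    obtain e where "e > 0" and e: "\<And>g. g \<in> Lq_fun q \<mu> \<Longrightarrow>
        Lq_norm q \<mu> (\<lambda>z. g z - f z) < e \<Longrightarrow> Lq_class q \<mu> g \<in> T"
      using T f unfolding Lq_open_def by blast
    show "\<exists>\<epsilon>>0. \<forall>g\<in>Lq_fun q \<mu>.
        Lq_norm q \<mu> (\<lambda>z. g z - f z) < \<epsilon> \<longrightarrow> Lq_class q \<mu> g \<in> S \<inter> T"
      using \<open>d > 0\<close> \<open>e > 0\<close> d e by (intro exI[of _ "min d e"]) auto
  qed
next
  fix K assume K: "\<forall>S\<in>K. Lq_open q \<mu> S"
  show "Lq_open q \<mu> (\<Union>K)"
    unfolding Lq_open_def
  proof (intro conjI ballI impI)
    show "\<Union>K \<subseteq> Lq_space q \<mu>"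
      using K by (auto simp: Lq_open_def)
  next
    fix f assume f: "f \<in> Lq_fun q \<mu>" "Lq_class q \<mu> f \<in> \<Union>K"
    then obtain S where S: "S \<in> K" "Lq_class q \<mu> f \<in> S" by blast
    with K have "Lq_open q \<mu> S" by blast
    with f S obtain d where "d > 0" "\<forall>g\<in>Lq_fun q \<mu>.
        Lq_norm q \<mu> (\<lambda>z. g z - f z) < d \<longrightarrow> Lq_class q \<mu> g \<in> S"
      unfolding Lq_open_def by blast
    with S show "\<exists>\<epsilon>>0. \<forall>g\<in>Lq_fun q \<mu>.
        Lq_norm q \<mu> (\<lambda>z. g z - f z) < \<epsilon> \<longrightarrow> Lq_class q \<mu> g \<in> \<Union>K"
      by blast
  qed
qed

lemma openin_Lq_topology: "openin (Lq_topology q \<mu>) U \<longleftrightarrow> Lq_open q \<mu> U"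
  by (simp add: Lq_topology_def topology_inverse' istopology_Lq_open)

lemma topspace_Lq_topology: "topspace (Lq_topology q \<mu>) = Lq_space q \<mu>"
proof -
  have "Lq_open q \<mu> (Lq_space q \<mu>)"
    unfolding Lq_open_def Lq_space_def Lq_class_def
    by (auto intro!: quotientI exI[of _ 1])
  then show ?thesis
    by (auto simp: topspace_def openin_Lq_topology Lq_open_def)
qed

definition borel_measure_on_disk :: "complex measure \<Rightarrow> bool" where
  "borel_measure_on_disk \<mu> \<longleftrightarrow> sets \<mu> = sets disk_borel"

definition carleson_measure :: "real \<Rightarrow> real \<Rightarrow> complex measure \<Rightarrow> bool" where
  "carleson_measure p q \<mu> \<longleftrightarrow> borel_measure_on_disk \<mu> \<and> hardy_space p \<subseteq> Lq_fun q \<mu>"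

text \<open>The embedding operator; its domain is \<^term>\<open>hardy_space p\<close>.\<close>

definition carleson_embedding ::
  "real \<Rightarrow> complex measure \<Rightarrow> (complex \<Rightarrow> complex) \<Rightarrow> (complex \<Rightarrow> complex) set" where
  "carleson_embedding q \<mu> f = Lq_class q \<mu> f"

definition concentrated_on :: "complex measure \<Rightarrow> complex set \<Rightarrow> bool" where
  "concentrated_on \<mu> A \<longleftrightarrow> A \<in> sets \<mu> \<and> emeasure \<mu> (space \<mu> - A) = 0"

definition infinitely_supported :: "complex measure \<Rightarrow> bool" where
  "infinitely_supported \<mu> \<longleftrightarrow> \<not> (\<exists>F\<subseteq>unit_disk. finite F \<and> concentrated_on \<mu> F)"

definition interpolating_sequence :: "(nat \<Rightarrow> complex) \<Rightarrow> bool" where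
  "interpolating_sequence z \<longleftrightarrow> inj z \<and> range z \<subseteq> unit_disk \<and>
     {(\<lambda>n. f (z n)) | f. f \<in> hardy_infinity} = {w :: nat \<Rightarrow> complex. bounded (range w)}"

definition comparable_to_boundary_distance :: "(nat \<Rightarrow> real) \<Rightarrow> (nat \<Rightarrow> complex) \<Rightarrow> bool" where
  "comparable_to_boundary_distance a z \<longleftrightarrow>
     0 < (INF n. ereal (a n / (1 - norm (z n)))) \<and>
     (SUP n. ereal (a n / (1 - norm (z n)))) < \<infinity>"

text \<open>The measure \<open>\<Sum>\<^sub>n a\<^sub>n \<delta>\<^bsub>z\<^sub>n\<^esub>\<close>; the unit point mass at \<open>x\<close> is
  \<^term>\<open>return disk_borel x\<close>.\<close>

definition is_point_mass_sum :: "complex measure \<Rightarrow> (nat \<Rightarrow> real) \<Rightarrow> (nat \<Rightarrow> complex) \<Rightarrow> bool" where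
  "is_point_mass_sum \<mu> a z \<longleftrightarrow> sets \<mu> = sets disk_borel \<and>
     (\<forall>A\<in>sets disk_borel.
        emeasure \<mu> A = (\<Sum>n. ennreal (a n) * emeasure (return disk_borel (z n)) A))"

end

theory Submission
  imports Defs
begin

text \<open>Suppose that the range is closed. A Baire category argument (the open mapping principle for
  quasi-norms) shows that every \<open>h\<close> in the Hardy space agrees almost everywhere with some \<open>G\<close> in the
  Hardy space whose norm is controlled by that of \<open>h\<close> in \<open>L\<^sup>q(\<mu>)\<close>. Testing this on the monomials, one
  sees that the embedding is not injective; hence \<open>\<mu>\<close> lives on the zeros of a nonzero function, and
  \<open>\<mu>\<close> is a sum of point masses \<open>a\<^sub>n\<close> at points \<open>z\<^sub>n\<close>. Dividing that function by powers of \<open>z - z\<^sub>n\<close> and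
  using the principle again, one gets \<open>g\<^sub>n\<close> with \<open>g\<^sub>n(z\<^sub>m) = \<delta>\<^bsub>nm\<^esub>\<close> and norm at most a constant times
  the \<open>q\<close>-th root of \<open>a\<^sub>n\<close>. Point evaluations and powers of the Szego kernel then show that the
  \<open>p/q\<close>-th power of \<open>a\<^sub>n\<close> is comparable to \<open>w\<^sub>n = 1 - |z\<^sub>n|\<^sup>2\<close>, and division of \<open>g\<^sub>n\<close> by finite Blaschke
  products shows that the sequence is uniformly separated.

  For a uniformly separated sequence, Jones' explicit functions interpolate every bounded sequence by a
  bounded function and every \<open>c\<close> with \<open>\<Sum>|c\<^sub>n|\<^sup>p w\<^sub>n < \<infinity>\<close> by a function in the Hardy space. The latter
  is incompatible with \<open>q < p\<close>. If \<open>p < q\<close>, it gives functions of modulus \<open>w\<^sub>n\<close> to the power \<open>- 1/p\<close>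
  on \<open>N\<close> points of a sparse subsequence and zero on the others; their lifts have \<open>p\<close>-th power norm at
  least of order \<open>N\<close> by a Carleson type inequality, but at most of order \<open>N\<close> to the power \<open>p/q\<close>.

  Conversely, an interpolating sequence is uniformly separated, and interpolation in the Hardy space
  shows that the embedding is onto.\<close>


section \<open>Integration on the circle and the Szego kernel\<close>


text \<open>For exponents below 1 there is no triangle inequality and no duality. Norms therefore
  enter only through their powers on circles of radius \<open>r < 1\<close>, and two soft tools
  carry the functional analysis: a Baire lemma for quasi-metrics, and normal families, whose
  pointwise limits stay in the same Hardy ball. Together they replace the open mapping and closed
  graph theorems. Since the embedding fails to be injective, closed range controls some preimage of
  a class, never a given one. Hence every estimate is phrased for a lift \<open>G\<close> with
  prescribed values at the points \<open>z n\<close>. The exponent \<open>p / q\<close> in these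
  estimates comes from homogeneity: the Hardy mass scales with power \<open>p\<close>, the mass in
  \<open>L^q\<close> with power \<open>q\<close>. Point evaluation and sampling bounds have a common
  source, a Hilbert space inequality for Szego kernels, which zero-free majorants carry from
  exponent 2 to every \<open>p\<close>. Jones' functions suit all exponents at once: a uniform
  pointwise bound on the sum of their moduli survives multiplication by localised kernels.\<close>

interpretation arc: prob_space arc_measure by (rule prob_space_arc_measure)

lemma space_arc_measure [simp]: "space arc_measure = sphere 0 1"
  by (simp add: arc_measure_def space_restrict_space)

lemma measurable_arc_continuous:
  fixes f :: "complex \<Rightarrow> 'a::topological_space"
  assumes "continuous_on (sphere 0 1) f"
  shows "f \<in> borel_measurable arc_measure"
  using borel_measurable_continuous_on_restrict[OF assms] by (simp add: arc_measure_def)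

lemma integrable_arc_continuous:
  fixes f :: "complex \<Rightarrow> 'a::{banach, second_countable_topology}"
  assumes "continuous_on (sphere 0 1) f"
  shows "integrable arc_measure f"
proof -
  have "bounded (f ` sphere 0 1)"
    by (intro compact_imp_bounded compact_continuous_image assms compact_sphere)
  then obtain B where "\<And>x. x \<in> sphere 0 1 \<Longrightarrow> norm (f x) \<le> B"
    unfolding bounded_iff by blast
  then have "AE x in arc_measure. norm (f x) \<le> B"
    by (intro AE_I2) auto
  then show ?thesis
    by (rule arc.integrable_const_bound) (rule measurable_arc_continuous[OF assms])
qed

text \<open>Bridge from \<open>arc_measure\<close> to the gauge integral in which contour integrals
  are expressed.\<close>

lemma integral_arc_measure:
  fixes f :: "complex \<Rightarrow> complex"
  assumes "continuous_on (sphere 0 1) f"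
  shows "(LINT x|arc_measure. f x) = (1 / (2 * pi)) *\<^sub>R integral {0..2*pi} (\<lambda>t. f (cis t))"
proof -
  let ?U = "uniform_measure lborel {0..<2*pi}"
  have cis: "cis \<in> measurable ?U circle_borel"
  proof (rule measurable_restrict_space2)
    have "cis \<in> borel_measurable borel"
      by (intro borel_measurable_continuous_onI continuous_on_cis continuous_on_id)
    then show "cis \<in> borel_measurable ?U"
      by (subst measurable_cong_sets[of _ borel]) auto
  qed auto
  have cont: "continuous_on UNIV (\<lambda>t. f (cis t))"
    by (rule continuous_on_compose2[OF assms]) (auto intro!: continuous_intros)
  then have meas: "(\<lambda>t. f (cis t)) \<in> borel_measurable borel"
    by (rule borel_measurable_continuous_onI)
  have U: "?U = density lborel (\<lambda>t. ennreal (indicator {0..<2*pi} t / (2 * pi)))"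
    unfolding uniform_measure_def
    by (intro arg_cong2[where f=density] refl ext)
       (auto simp: emeasure_lborel_Ico divide_ennreal split: split_indicator simp flip: ennreal_1)
  have "set_integrable lborel {0..2*pi} (\<lambda>t. f (cis t))"
    unfolding set_integrable_def
    by (rule borel_integrable_compact) (auto intro: continuous_on_subset[OF cont])
  then have int: "set_integrable lborel {0..<2*pi} (\<lambda>t. f (cis t))"
    by (rule set_integrable_subset) auto
  have "(LINT x|arc_measure. f x) = (LINT t|?U. f (cis t))"
    unfolding arc_measure_def
    by (rule integral_distr[OF cis borel_measurable_continuous_on_restrict[OF assms]])
  also have "\<dots> = (LINT t|lborel. (indicator {0..<2*pi} t / (2 * pi)) *\<^sub>R f (cis t))"
    unfolding U by (rule integral_density) (use meas in auto)
  also have "\<dots> = (LINT t|lborel. (1 / (2 * pi)) *\<^sub>R (indicator {0..<2*pi} t *\<^sub>R f (cis t)))"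
    by (intro Bochner_Integration.integral_cong) auto
  also have "\<dots> = (1 / (2 * pi)) *\<^sub>R (LINT t:{0..<2*pi}|lborel. f (cis t))"
    unfolding set_lebesgue_integral_def by (rule integral_scaleR_right)
  also have "(LINT t:{0..<2*pi}|lborel. f (cis t)) = integral {0..<2*pi} (\<lambda>t. f (cis t))"
    by (rule set_borel_integral_eq_integral(2)[OF int])
  also have "\<dots> = integral {0..2*pi} (\<lambda>t. f (cis t))"
    by (rule integral_subset_negligible) (auto intro: negligible_subset[of "{2*pi}"])
  finally show ?thesis .
qed

text \<open>On the circle \<open>x * cnj x = 1\<close>, so the conjugated factor equals
  \<open>x / (x - a)\<close> and the integral is Cauchy's formula. Thus
  \<open>1 / (1 - cnj a * x)\<close>, the Szego kernel, reproduces values in the inner product of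
  \<open>H^2\<close>.\<close>

lemma Cauchy_integral_arc_measure:
  assumes cont: "continuous_on (cball 0 1) F" and hol: "F holomorphic_on unit_disk"
    and a: "norm a < 1"
  shows "(LINT x|arc_measure. F x * cnj (1 / (1 - cnj a * x))) = F a"
proof -
  have ne: "1 - cnj a * x \<noteq> 0" if "norm x = 1" for x
  proof
    assume "1 - cnj a * x = 0"
    then have "norm (cnj a * x) = 1" by simp
    with that a show False by (simp add: norm_mult)
  qed
  have contk: "continuous_on (sphere 0 1) (\<lambda>x. F x * cnj (1 / (1 - cnj a * x)))"
    by (intro continuous_intros continuous_on_subset[OF cont]) (use ne in auto)
  have "((\<lambda>u. F u / (u - a)) has_contour_integral (2 * of_real pi * \<i> * F a)) (circlepath 0 1)"
    by (rule Cauchy_integral_circlepath[OF cont hol]) (use a in auto)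
  then have "((\<lambda>t. F (cis t) / (cis t - a) * \<i> * cis t) has_integral (2 * of_real pi * \<i> * F a)) {0..2*pi}"
    unfolding circlepath_def
    by (subst (asm) has_contour_integral_part_circlepath_iff) (auto simp: mult_ac)
  then have "((\<lambda>t. (- \<i> / (2 * pi)) * (F (cis t) / (cis t - a) * \<i> * cis t))
      has_integral (- \<i> / (2 * pi)) * (2 * of_real pi * \<i> * F a)) {0..2*pi}"
    by (rule has_integral_mult_right)
  moreover have "(- \<i> / (2 * pi)) * (2 * of_real pi * \<i> * F a) = F a"
    by (simp add: field_simps)
  moreover have "(- \<i> / (2 * pi)) * (F (cis t) / (cis t - a) * \<i> * cis t)
      = (1 / (2 * pi)) *\<^sub>R (F (cis t) * cnj (1 / (1 - cnj a * cis t)))" for t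
  proof -
    have 1: "cis t - a \<noteq> 0" using a by auto
    have 2: "1 - a * cnj (cis t) \<noteq> 0"
      using ne[of "cis t"] by (metis complex_cnj_cnj complex_cnj_diff complex_cnj_mult complex_cnj_one complex_cnj_zero norm_cis)
    have 3: "cis t * cnj (cis t) = 1" by (simp add: cis_cnj cis_mult)
    have "cis t / (cis t - a) = 1 / (1 - a * cnj (cis t))"
      using 1 2 3 by (simp add: divide_simps) (simp add: algebra_simps)
    moreover have "(- \<i> / (2 * pi)) * (F (cis t) / (cis t - a) * \<i> * cis t)
        = 1 / (2 * pi) * (F (cis t) * (cis t / (cis t - a)))"
      using 1 by (simp add: field_simps)
    ultimately show ?thesis
      by (simp add: scaleR_conv_of_real)
  qed
  ultimately have "((\<lambda>t. (1 / (2 * pi)) *\<^sub>R (F (cis t) * cnj (1 / (1 - cnj a * cis t)))) has_integral F a) {0..2*pi}"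
    by simp
  then have "integral {0..2*pi} (\<lambda>t. (1 / (2 * pi)) *\<^sub>R (F (cis t) * cnj (1 / (1 - cnj a * cis t)))) = F a"
    by (rule integral_unique)
  then show ?thesis
    by (simp only: integral_arc_measure[OF contk] integral_cmul)
qed

lemma norm_one_minus_cnj_mult_commute: "norm (1 - cnj a * b) = norm (1 - cnj b * a)"
proof -
  have "norm (1 - cnj a * b) = norm (cnj (1 - cnj a * b))" by (simp only: complex_mod_cnj)
  then show ?thesis by (simp add: mult.commute)
qed

lemma one_minus_cnj_mult_nonzero:
  assumes "norm a < 1" "norm b \<le> 1"
  shows "1 - cnj a * b \<noteq> 0"
proof
  assume "1 - cnj a * b = 0"
  then have "norm a * norm b = 1" by (metis complex_mod_cnj eq_iff_diff_eq_0 norm_mult norm_one)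
  moreover have "norm a * norm b \<le> norm a * 1" using assms by (intro mult_left_mono) auto
  ultimately show False using assms by simp
qed

text \<open>The Schur test: the arithmetic-geometric mean inequality splits each product into two
  squares, and symmetry turns both halves into row sums.\<close>

lemma Schur_symmetric_bound:
  fixes A :: "'i \<Rightarrow> 'i \<Rightarrow> real"
  assumes sym: "\<And>i j. A i j = A j i" and nonneg: "\<And>i j. i \<in> I \<Longrightarrow> j \<in> I \<Longrightarrow> 0 \<le> A i j"
    and rows: "\<And>i. i \<in> I \<Longrightarrow> (\<Sum>j\<in>I. A i j) \<le> C"
  shows "(\<Sum>i\<in>I. \<Sum>j\<in>I. x i * x j * A i j) \<le> C * (\<Sum>i\<in>I. (x i)\<^sup>2)"
proof -
  have "(\<Sum>i\<in>I. \<Sum>j\<in>I. x i * x j * A i j) \<le> (\<Sum>i\<in>I. \<Sum>j\<in>I. (x i)\<^sup>2 * A i j / 2 + (x j)\<^sup>2 * A i j / 2)"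
  proof (intro sum_mono)
    fix i j assume ij: "i \<in> I" "j \<in> I"
    have "x i * x j \<le> ((x i)\<^sup>2 + (x j)\<^sup>2) / 2"
      using sum_squares_bound[of "x i" "x j"] by simp
    then have "x i * x j * A i j \<le> ((x i)\<^sup>2 + (x j)\<^sup>2) / 2 * A i j"
      by (rule mult_right_mono[OF _ nonneg[OF ij]])
    then show "x i * x j * A i j \<le> (x i)\<^sup>2 * A i j / 2 + (x j)\<^sup>2 * A i j / 2"
      by (simp add: algebra_simps add_divide_distrib)
  qed
  also have "\<dots> = (\<Sum>i\<in>I. \<Sum>j\<in>I. (x i)\<^sup>2 * A i j / 2) + (\<Sum>i\<in>I. \<Sum>j\<in>I. (x j)\<^sup>2 * A i j / 2)"
    by (simp add: sum.distrib)
  also have "(\<Sum>i\<in>I. \<Sum>j\<in>I. (x j)\<^sup>2 * A i j / 2) = (\<Sum>i\<in>I. \<Sum>j\<in>I. (x i)\<^sup>2 * A i j / 2)"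
    by (subst sum.swap) (simp add: sym)
  also have "(\<Sum>i\<in>I. \<Sum>j\<in>I. (x i)\<^sup>2 * A i j / 2) + (\<Sum>i\<in>I. \<Sum>j\<in>I. (x i)\<^sup>2 * A i j / 2)
      = (\<Sum>i\<in>I. (x i)\<^sup>2 * (\<Sum>j\<in>I. A i j))"
    by (simp add: sum_distrib_left flip: sum.distrib) (simp add: mult.commute)
  also have "\<dots> \<le> (\<Sum>i\<in>I. (x i)\<^sup>2 * C)"
    by (intro sum_mono mult_left_mono rows) auto
  finally show ?thesis by (simp add: sum_distrib_left mult.commute)
qed

text \<open>A Bessel inequality for normalised Szego kernels. With \<open>G\<close> the combination
  of kernels weighted by \<open>w i * F (z i)\<close>, the reproducing property gives
  \<open><F, G> = S\<close>, and the Schur test on the Gram matrix gives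
  \<open><G, G> <= C * S\<close>. Expanding the square norm of \<open>F - G / C\<close> yields the
  claim.\<close>

lemma szego_sampling_bound:
  fixes z :: "'i \<Rightarrow> complex"
  defines "w \<equiv> \<lambda>i. 1 - (norm (z i))\<^sup>2"
  assumes fin: "finite I" and z: "\<And>i. i \<in> I \<Longrightarrow> norm (z i) < 1" and C: "0 < C"
    and rows: "\<And>i. i \<in> I \<Longrightarrow> (\<Sum>j\<in>I. sqrt (w i * w j) / norm (1 - cnj (z i) * z j)) \<le> C"
    and cont: "continuous_on (cball 0 1) F" and hol: "F holomorphic_on unit_disk"
  shows "(\<Sum>i\<in>I. w i * (norm (F (z i)))\<^sup>2) \<le> C * (LINT x|arc_measure. (norm (F x))\<^sup>2)"
proof -
  define k where "k = (\<lambda>i x. 1 / (1 - cnj (z i) * x))"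
  define G where "G = (\<lambda>x. \<Sum>i\<in>I. (w i * F (z i)) * k i x)"
  define S where "S = (\<Sum>i\<in>I. w i * (norm (F (z i)))\<^sup>2)"
  define ip where "ip = (\<lambda>u v. LINT x|arc_measure. u x * cnj (v x))"
  have wpos: "0 < w i" if "i \<in> I" for i
    using z[OF that] by (simp add: w_def power_less_one_iff abs_square_less_1)
  have ne: "1 - cnj (z i) * x \<noteq> 0" if "i \<in> I" "norm x \<le> 1" for i x
    using z that by (intro one_minus_cnj_mult_nonzero) auto
  have contk: "continuous_on (cball 0 1) (k i)" if "i \<in> I" for i
    unfolding k_def by (intro continuous_intros) (use ne[OF that] in auto)
  have contG: "continuous_on (cball 0 1) G"
    unfolding G_def by (intro continuous_intros contk)
  have holk: "k i holomorphic_on unit_disk" if "i \<in> I" for i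
    unfolding k_def by (intro holomorphic_intros) (use ne[OF that] in auto)
  have holG: "G holomorphic_on unit_disk"
    unfolding G_def by (intro holomorphic_intros holk)
  have sub: "sphere 0 1 \<subseteq> cball (0::complex) 1" by auto
  have int: "integrable arc_measure (\<lambda>x. u x * cnj (v x))"
    if "continuous_on (cball 0 1) u" "continuous_on (cball 0 1) v" for u v :: "complex \<Rightarrow> complex"
    by (intro integrable_arc_continuous continuous_intros continuous_on_subset[OF that(1)]
        continuous_on_subset[OF that(2)] sub)
  have ipk: "ip u (k i) = u (z i)" if "i \<in> I" "continuous_on (cball 0 1) u" "u holomorphic_on unit_disk" for u i
    using Cauchy_integral_arc_measure[OF that(2,3) z[OF that(1)]] by (simp add: ip_def k_def)
  have ipG: "ip u G = (\<Sum>i\<in>I. w i * cnj (F (z i)) * u (z i))"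
    if u: "continuous_on (cball 0 1) u" "u holomorphic_on unit_disk" for u
  proof -
    have "ip u G = (LINT x|arc_measure. (\<Sum>i\<in>I. (w i * cnj (F (z i))) * (u x * cnj (k i x))))"
      unfolding ip_def G_def by (simp add: sum_distrib_left mult_ac)
    also have "\<dots> = (\<Sum>i\<in>I. (w i * cnj (F (z i))) * ip u (k i))"
      unfolding ip_def
      by (subst Bochner_Integration.integral_sum) (auto intro!: int u contk)
    finally show ?thesis by (simp add: ipk[OF _ u])
  qed
  have FG: "ip F G = of_real S"
    unfolding ipG[OF cont hol] S_def of_real_sum of_real_mult complex_norm_square
    by (simp only: mult_ac)
  have GF: "ip G F = of_real S"
  proof -
    have "ip G F = cnj (ip F G)"
      unfolding ip_def Bochner_Integration.integral_cnj[symmetric] by (simp add: mult.commute)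
    then show ?thesis by (simp add: FG)
  qed
  define T where "T = ip G G"
  have T: "norm T \<le> C * S"
  proof -
    define A where "A = (\<lambda>i j. sqrt (w i * w j) / norm (1 - cnj (z i) * z j))"
    define x where "x = (\<lambda>i. sqrt (w i) * norm (F (z i)))"
    have "T = (\<Sum>i\<in>I. \<Sum>j\<in>I. (w i * cnj (F (z i))) * ((w j * F (z j)) * k j (z i)))"
      unfolding T_def ipG[OF contG holG] by (simp add: G_def sum_distrib_left)
    also have "norm \<dots> \<le> (\<Sum>i\<in>I. \<Sum>j\<in>I. norm ((w i * cnj (F (z i))) * ((w j * F (z j)) * k j (z i))))"
      by (intro order_trans[OF norm_sum] sum_mono) simp
    also have "\<dots> = (\<Sum>i\<in>I. \<Sum>j\<in>I. x i * x j * A i j)"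
    proof (intro sum.cong refl)
      fix i j assume ij: "i \<in> I" "j \<in> I"
      have "0 < w i * w j" using wpos[OF ij(1)] wpos[OF ij(2)] by simp
      then have sq: "w i * w j = sqrt (w i) * sqrt (w j) * sqrt (w i * w j)"
        by (simp flip: real_sqrt_mult)
      have "norm ((w i * cnj (F (z i))) * ((w j * F (z j)) * k j (z i)))
          = (w i * w j) * (norm (F (z i)) * norm (F (z j)) / norm (1 - cnj (z i) * z j))"
        using wpos[OF ij(1)] wpos[OF ij(2)] norm_one_minus_cnj_mult_commute[of "z i" "z j"]
        by (simp add: norm_mult norm_divide k_def)
      also have "\<dots> = x i * x j * A i j"
        by (subst sq) (simp add: x_def A_def mult_ac)
      finally show "norm ((w i * cnj (F (z i))) * ((w j * F (z j)) * k j (z i))) = x i * x j * A i j" .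
    qed
    also have "\<dots> \<le> C * (\<Sum>i\<in>I. (x i)\<^sup>2)"
    proof (rule Schur_symmetric_bound)
      show "A i j = A j i" for i j
        by (simp add: A_def mult.commute[of "w i"] norm_one_minus_cnj_mult_commute[of "z i"])
      show "0 \<le> A i j" if "i \<in> I" "j \<in> I" for i j
        using wpos[OF that(1)] wpos[OF that(2)] by (simp add: A_def)
      show "(\<Sum>j\<in>I. A i j) \<le> C" if "i \<in> I" for i
        using rows[OF that] by (simp add: A_def)
    qed
    also have "(\<Sum>i\<in>I. (x i)\<^sup>2) = S"
      unfolding S_def x_def using wpos by (intro sum.cong) (auto simp: power_mult_distrib less_imp_le)
    finally show ?thesis .
  qed
  \<comment> \<open>The factor \<open>1 / C\<close> minimises
    \<open>- 2 * t * S + t^2 * C * S\<close> over \<open>t\<close>.\<close>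
  define H where "H = (\<lambda>x. F x - G x / C)"
  have "ip H H = (LINT x|arc_measure. F x * cnj (F x) - (F x * cnj (G x)) / C
        - (G x * cnj (F x)) / C + (G x * cnj (G x)) / C\<^sup>2)"
    unfolding ip_def H_def
    by (intro Bochner_Integration.integral_cong refl)
       (use C in \<open>simp add: field_simps power2_eq_square\<close>)
  also have "\<dots> = ip F F - ip F G / C - ip G F / C + T / C\<^sup>2"
    unfolding T_def ip_def
    by (simp add: int cont contG)
  finally have "ip H H = ip F F - 2 * of_real S / C + T / C\<^sup>2"
    by (simp add: FG GF)
  moreover have "ip u u = of_real (LINT x|arc_measure. (norm (u x))\<^sup>2)" for u
    unfolding ip_def complex_norm_square[symmetric] by (rule integral_complex_of_real)
  ultimately have "complex_of_real (LINT x|arc_measure. (norm (H x))\<^sup>2)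
     = of_real (LINT x|arc_measure. (norm (F x))\<^sup>2) - 2 * of_real S / C + T / C\<^sup>2"
    by simp
  then have "Re (complex_of_real (LINT x|arc_measure. (norm (H x))\<^sup>2))
     = Re (of_real (LINT x|arc_measure. (norm (F x))\<^sup>2) - 2 * of_real S / C + T / of_real (C\<^sup>2))"
    by simp
  then have "(LINT x|arc_measure. (norm (H x))\<^sup>2)
     = (LINT x|arc_measure. (norm (F x))\<^sup>2) - 2 * S / C + Re T / C\<^sup>2"
    by (simp only: minus_complex.simps plus_complex.simps Re_complex_of_real Re_divide_of_real)
       (simp flip: of_real_mult)
  moreover have "0 \<le> (LINT x|arc_measure. (norm (H x))\<^sup>2)" by simp
  moreover have "Re T / C\<^sup>2 \<le> C * S / C\<^sup>2"
    using T complex_Re_le_cmod[of T] by (intro divide_right_mono) auto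
  moreover have "C * S / C\<^sup>2 = S / C" using C by (simp add: power2_eq_square)
  moreover have "2 * S / C = S / C + S / C" by simp
  ultimately have "S / C \<le> (LINT x|arc_measure. (norm (F x))\<^sup>2)" by linarith
  then show ?thesis using C by (simp add: S_def field_simps)
qed


section \<open>Zero-free majorants and point bounds in Hardy spaces\<close>

lemma holomorphic_factor_order:
  assumes f: "f holomorphic_on S" "open S" "connected S" "a \<in> S" "\<exists>w\<in>S. f w \<noteq> 0"
  obtains n g where "g holomorphic_on S" "g a \<noteq> 0" "\<And>z. z \<in> S \<Longrightarrow> f z = (z - a) ^ n * g z"
proof -
  define n where "n = nat (zorder f a)"
  obtain r where r: "r > 0" "cball a r \<subseteq> S" "zor_poly f a holomorphic_on cball a r"
    and eq: "\<And>w. w \<in> cball a r \<Longrightarrow> f w = zor_poly f a w * (w - a) ^ n \<and> zor_poly f a w \<noteq> 0"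
    using zorder_exist_zero[OF f] unfolding n_def by blast
  define g where "g = (\<lambda>z. if z \<in> ball a r then zor_poly f a z else f z / (z - a) ^ n)"
  have g2: "g z = f z / (z - a) ^ n" if "z \<noteq> a" for z
    using that eq[of z] by (auto simp: g_def)
  have "g holomorphic_on ball a r"
    by (rule holomorphic_transform[OF holomorphic_on_subset[OF r(3)]]) (auto simp: g_def)
  moreover have "g holomorphic_on (S - {a})"
  proof (rule holomorphic_transform)
    show "(\<lambda>z. f z / (z - a) ^ n) holomorphic_on (S - {a})"
      by (intro holomorphic_intros holomorphic_on_subset[OF f(1)]) auto
  qed (use g2 in auto)
  ultimately have "g holomorphic_on (ball a r \<union> (S - {a}))"
    using f(2) by (intro holomorphic_on_Un) auto
  moreover have "S \<subseteq> ball a r \<union> (S - {a})" using r(1) by auto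
  ultimately have "g holomorphic_on S" by (rule holomorphic_on_subset)
  moreover have "g a \<noteq> 0" using r(1) eq[of a] by (simp add: g_def)
  moreover have "f z = (z - a) ^ n * g z" if "z \<in> S" for z
  proof (cases "z = a")
    case True then show ?thesis using r(1) eq[of a] by (simp add: g_def)
  qed (simp add: g2)
  ultimately show ?thesis by (rule that)
qed

lemma norm_one_minus_cnj_mult_diff:
  "(norm (1 - cnj a * z))\<^sup>2 - (norm (z - a))\<^sup>2 = (1 - (norm a)\<^sup>2) * (1 - (norm z)\<^sup>2)"
  unfolding cmod_power2 by (simp add: power2_eq_square algebra_simps)

lemma norm_moebius_le:
  assumes "norm a < 1" "norm z \<le> 1"
  shows "norm (z - a) \<le> norm (1 - cnj a * z)"
proof -
  have "0 \<le> (1 - (norm a)\<^sup>2) * (1 - (norm z)\<^sup>2)"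
    using assms by (intro mult_nonneg_nonneg) (auto simp: power_le_one)
  then have "(norm (z - a))\<^sup>2 \<le> (norm (1 - cnj a * z))\<^sup>2"
    using norm_one_minus_cnj_mult_diff[of a z] by linarith
  then show ?thesis by (rule power2_le_imp_le) simp
qed

lemma norm_moebius_sphere:
  assumes "norm z = 1"
  shows "norm (z - a) = norm (1 - cnj a * z)"
proof -
  have "(norm (1 - cnj a * z))\<^sup>2 = (norm (z - a))\<^sup>2"
    using norm_one_minus_cnj_mult_diff[of a z] assms by simp
  then show ?thesis by simp
qed

text \<open>Each zero \<open>a\<close> in the open disk is removed by replacing
  \<open>(z - a) ^ n\<close> with \<open>(1 - cnj a * z) ^ n\<close>, which has the same modulus on
  the circle and a larger one inside. The new factor is entire, so holomorphy on the bigger ball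
  survives; the induction runs over the number of zeros in the disk, finite because the closed disk
  is compact in that ball.\<close>

lemma zero_free_majorant:
  assumes "f holomorphic_on ball 0 R" "1 < R" "\<exists>w\<in>ball 0 R. f w \<noteq> 0"
  obtains h where "h holomorphic_on ball 0 R" "\<And>z. norm z < 1 \<Longrightarrow> h z \<noteq> 0"
    "\<And>z. norm z = 1 \<Longrightarrow> norm (h z) = norm (f z)"
    "\<And>z. norm z < 1 \<Longrightarrow> norm (f z) \<le> norm (h z)"
proof -
  have fin: "finite {z \<in> unit_disk. f z = 0}"
    if "f holomorphic_on ball 0 R" "\<exists>w\<in>ball 0 R. f w \<noteq> 0" for f :: "complex \<Rightarrow> complex"
  proof (cases "f constant_on ball 0 R")
    case True
    then obtain c where "\<And>z. z \<in> ball 0 R \<Longrightarrow> f z = c" by (auto simp: constant_on_def)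
    then have "{z \<in> unit_disk. f z = 0} = {}" using that \<open>1 < R\<close> by force
    then show ?thesis by (simp only: finite.emptyI)
  next
    case False
    have "finite {z \<in> cball 0 1. f z = 0}"
      by (rule holomorphic_compact_finite_zeros[OF that(1) _ _ _ _ False]) (use \<open>1 < R\<close> in auto)
    then show ?thesis by (rule rev_finite_subset) auto
  qed
  have "\<exists>h. h holomorphic_on ball 0 R \<and> (\<forall>z. norm z < 1 \<longrightarrow> h z \<noteq> 0) \<and>
    (\<forall>z. norm z = 1 \<longrightarrow> norm (h z) = norm (f z)) \<and> (\<forall>z. norm z < 1 \<longrightarrow> norm (f z) \<le> norm (h z))"
    using assms
  proof (induction "card {z \<in> unit_disk. f z = 0}" arbitrary: f rule: less_induct)
    case less
    show ?case
    proof (cases "{z \<in> unit_disk. f z = 0} = {}")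
      case True
      then show ?thesis using less.prems by (intro exI[of _ f]) auto
    next
      case False
      then obtain a where a: "norm a < 1" "f a = 0" by auto
      obtain n g where g: "g holomorphic_on ball 0 R" "g a \<noteq> 0"
        and fg: "\<And>z. z \<in> ball 0 R \<Longrightarrow> f z = (z - a) ^ n * g z"
      proof (rule holomorphic_factor_order[OF less.prems(1), of a])
        show "a \<in> ball 0 R" using a less.prems(2) by simp
      qed (use less.prems(3) in auto)
      define f' where "f' = (\<lambda>z. (1 - cnj a * z) ^ n * g z)"
      have hol': "f' holomorphic_on ball 0 R"
        unfolding f'_def by (intro holomorphic_intros g)
      have nz: "1 - cnj a * z \<noteq> 0" if "norm z \<le> 1" for z
        using a(1) that by (rule one_minus_cnj_mult_nonzero)
      have nz': "\<exists>w\<in>ball 0 R. f' w \<noteq> 0"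
        using a g(2) nz[of a] less.prems(2) by (intro bexI[of _ a]) (auto simp: f'_def)
      have "{z \<in> unit_disk. f' z = 0} \<subset> {z \<in> unit_disk. f z = 0}"
      proof
        show "{z \<in> unit_disk. f' z = 0} \<subseteq> {z \<in> unit_disk. f z = 0}"
          using nz fg less.prems(2) by (auto simp: f'_def)
        have "a \<in> {z \<in> unit_disk. f z = 0} - {z \<in> unit_disk. f' z = 0}"
          using a g(2) nz[of a] by (auto simp: f'_def)
        then show "{z \<in> unit_disk. f' z = 0} \<noteq> {z \<in> unit_disk. f z = 0}" by blast
      qed
      then have "card {z \<in> unit_disk. f' z = 0} < card {z \<in> unit_disk. f z = 0}"
        by (intro psubset_card_mono fin less.prems)
      from less.hyps[OF this hol' less.prems(2) nz'] obtain h where h: "h holomorphic_on ball 0 R"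
        "\<And>z. norm z < 1 \<Longrightarrow> h z \<noteq> 0" "\<And>z. norm z = 1 \<Longrightarrow> norm (h z) = norm (f' z)"
        "\<And>z. norm z < 1 \<Longrightarrow> norm (f' z) \<le> norm (h z)" by blast
      have eq: "norm (f' z) = norm (f z)" if "norm z = 1" for z
        using norm_moebius_sphere[OF that, of a] fg[of z] less.prems(2) that
        by (simp add: f'_def norm_mult norm_power)
      have le: "norm (f z) \<le> norm (f' z)" if "norm z < 1" for z
        using norm_moebius_le[OF a(1), of z] fg[of z] less.prems(2) that
        by (auto simp: f'_def norm_mult norm_power intro!: mult_right_mono power_mono)
      show ?thesis
        using h(1,2,3) eq order_trans[OF le h(4)] by (intro exI[of _ h]) auto
    qed
  qed
  then show ?thesis using that by blast
qed

section \<open>Hardy means, sampling and point evaluation\<close>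

definition hardy_mean :: "real \<Rightarrow> real \<Rightarrow> (complex \<Rightarrow> complex) \<Rightarrow> real" where
  "hardy_mean p r f = (LINT x|arc_measure. norm (f (of_real r * x)) powr p)"

text \<open>\<open>K\<close> bounds the \<open>p\<close>-th power of the norm; likewise \<open>hardy_mass\<close> and \<open>Lq_mass\<close> below are the
  \<open>p\<close>-th and \<open>q\<close>-th powers of the norms. These powers satisfy the same quasi-triangle inequality
  for all exponents, whether below or above 1.\<close>

definition hardy_ball :: "real \<Rightarrow> real \<Rightarrow> (complex \<Rightarrow> complex) \<Rightarrow> bool" where
  "hardy_ball p K f \<longleftrightarrow> f holomorphic_on unit_disk \<and> (\<forall>r\<in>{0<..<1}. hardy_mean p r f \<le> K)"

text \<open>The reciprocal of the squared \<open>H^2\<close> norm of the Szego kernel at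
  \<open>a\<close>; within a factor 2 of the distance to the circle.\<close>

definition disk_weight :: "complex \<Rightarrow> real" where
  "disk_weight a = 1 - (norm a)\<^sup>2"

lemma disk_weight_pos: "norm a < 1 \<Longrightarrow> 0 < disk_weight a"
  by (simp add: disk_weight_def abs_square_less_1)

text \<open>Row sums of the moduli of the Gram matrix of the normalised Szego kernels at the points
  \<open>z j\<close>.\<close>

definition szego_row :: "'i set \<Rightarrow> ('i \<Rightarrow> complex) \<Rightarrow> 'i \<Rightarrow> real" where
  "szego_row I z i = (\<Sum>j\<in>I. sqrt (disk_weight (z i) * disk_weight (z j)) / norm (1 - cnj (z i) * z j))"

lemma continuous_norm_powr:
  fixes f :: "'a::topological_space \<Rightarrow> complex"
  assumes "continuous_on S f" "0 < p"
  shows "continuous_on S (\<lambda>x. norm (f x) powr p)"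
  using assms by (intro continuous_on_powr' continuous_intros) auto

text \<open>Replacing \<open>f\<close> by a zero-free majorant \<open>h\<close> with the same modulus on the circle reduces
  to the case \<open>p = 2\<close>, applied to \<open>h powr (p/2)\<close>.\<close>

lemma sampling_bound_closed_disk:
  fixes z :: "'i \<Rightarrow> complex"
  assumes p: "0 < p" and fin: "finite I" and z: "\<And>i. i \<in> I \<Longrightarrow> norm (z i) < 1" and C: "0 < C"
    and rows: "\<And>i. i \<in> I \<Longrightarrow> szego_row I z i \<le> C"
    and hol: "f holomorphic_on ball 0 R" and R: "1 < R"
  shows "(\<Sum>i\<in>I. disk_weight (z i) * norm (f (z i)) powr p) \<le> C * (LINT x|arc_measure. norm (f x) powr p)"
proof (cases "\<exists>w\<in>ball 0 R. f w \<noteq> 0")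
  case False
  then have "f (z i) = 0" if "i \<in> I" for i using z[OF that] R by auto
  then show ?thesis using p C by simp
next
  case True
  obtain h where h: "h holomorphic_on ball 0 R" and nz: "\<And>z. norm z < 1 \<Longrightarrow> h z \<noteq> 0"
    and eq: "\<And>z. norm z = 1 \<Longrightarrow> norm (h z) = norm (f z)"
    and le: "\<And>z. norm z < 1 \<Longrightarrow> norm (f z) \<le> norm (h z)"
    using zero_free_majorant[OF hol R True] by metis
  have conth: "continuous_on (cball 0 1) h"
    by (rule holomorphic_on_imp_continuous_on[OF holomorphic_on_subset[OF h]]) (use R in auto)
  obtain L where L: "L holomorphic_on unit_disk" "\<And>z. z \<in> unit_disk \<Longrightarrow> h z = exp (L z)"
  proof (rule contractible_imp_holomorphic_log[of h unit_disk])
    show "h holomorphic_on unit_disk" by (rule holomorphic_on_subset[OF h]) (use R in auto)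
  qed (use nz convex_imp_contractible[of "unit_disk"] in auto)
  \<comment> \<open>\<open>h\<close> may still vanish on the circle, so the logarithm
    \<open>L\<close> exists only on the open disk. The inequality is proved for the dilates by
    \<open>s n\<close>, whose powers \<open>p / 2\<close> are continuous up to the circle, and then
    \<open>n\<close> tends to infinity.\<close>
  define s where "s = (\<lambda>n::nat. 1 - 1 / real (n + 2))"
  have s: "0 < s n" "s n < 1" for n by (auto simp: s_def field_simps)
  have slim: "s \<longlonglongrightarrow> 1" unfolding s_def by real_asymp
  have inb: "of_real (s n) * x \<in> unit_disk" if "norm x \<le> 1" for n and x :: complex
  proof -
    have "s n * norm x \<le> s n * 1" using s[of n] that by (intro mult_left_mono) auto
    then have "s n * norm x < 1" using s(2)[of n] by linarith
    then show ?thesis using s[of n] by (simp add: norm_mult)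
  qed
  have step: "(\<Sum>i\<in>I. disk_weight (z i) * norm (h (of_real (s n) * z i)) powr p)
      \<le> C * (LINT x|arc_measure. norm (h (of_real (s n) * x)) powr p)" for n
  proof -
    define F where "F = (\<lambda>x. exp (of_real (p / 2) * L (of_real (s n) * x)))"
    have holF: "F holomorphic_on unit_disk"
      unfolding F_def
      by (intro holomorphic_intros holomorphic_on_compose_gen[OF _ L(1), unfolded o_def]) (use inb in auto)
    have contF: "continuous_on (cball 0 1) F"
      unfolding F_def
      by (intro continuous_intros continuous_on_compose2[OF holomorphic_on_imp_continuous_on[OF L(1)]])
        (use inb in auto)
    have normF: "(norm (F x))\<^sup>2 = norm (h (of_real (s n) * x)) powr p" if "norm x \<le> 1" for x
    proof -
      have "(norm (F x))\<^sup>2 = exp (2 * (p / 2 * Re (L (of_real (s n) * x))))"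
        by (subst exp_double) (simp add: F_def)
      also have "\<dots> = exp (Re (L (of_real (s n) * x))) powr p"
        by (simp add: powr_def)
      finally show ?thesis using L(2)[OF inb[OF that]] by simp
    qed
    have "(\<Sum>i\<in>I. disk_weight (z i) * (norm (F (z i)))\<^sup>2) \<le> C * (LINT x|arc_measure. (norm (F x))\<^sup>2)"
      unfolding disk_weight_def
      by (rule szego_sampling_bound[OF fin z C _ contF holF])
         (use rows in \<open>auto simp: szego_row_def disk_weight_def\<close>)
    moreover have "(\<Sum>i\<in>I. disk_weight (z i) * (norm (F (z i)))\<^sup>2)
        = (\<Sum>i\<in>I. disk_weight (z i) * norm (h (of_real (s n) * z i)) powr p)"
      using z by (intro sum.cong refl) (simp add: normF less_imp_le)
    moreover have "(LINT x|arc_measure. (norm (F x))\<^sup>2) = (LINT x|arc_measure. norm (h (of_real (s n) * x)) powr p)"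
      by (intro Bochner_Integration.integral_cong refl) (simp add: normF)
    ultimately show ?thesis by simp
  qed
  have hlim: "(\<lambda>n. norm (h (of_real (s n) * x)) powr p) \<longlonglongrightarrow> norm (h x) powr p" if "norm x \<le> 1" for x
  proof -
    have "(\<lambda>n. complex_of_real (s n) * x) \<longlonglongrightarrow> of_real 1 * x"
      by (intro tendsto_intros slim)
    then have "(\<lambda>n. norm (h (of_real (s n) * x)) powr p) \<longlonglongrightarrow> norm (h (of_real 1 * x)) powr p"
      by (intro continuous_on_tendsto_compose[OF continuous_norm_powr[OF conth p]])
         (use inb that in \<open>auto simp: less_imp_le\<close>)
    then show ?thesis by simp
  qed
  have "bounded ((\<lambda>x. norm (h x) powr p) ` cball 0 1)"
    by (intro compact_imp_bounded compact_continuous_image continuous_norm_powr conth p compact_cball)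
  then obtain B where "\<forall>x\<in>(\<lambda>x. norm (h x) powr p) ` cball 0 1. norm x \<le> B"
    unfolding bounded_iff by blast
  then have B: "norm (norm (h x) powr p) \<le> B" if "norm x \<le> 1" for x
    using that by simp
  have "(\<lambda>n. LINT x|arc_measure. norm (h (of_real (s n) * x)) powr p) \<longlonglongrightarrow> (LINT x|arc_measure. norm (h x) powr p)"
  proof (rule integral_dominated_convergence[where w="\<lambda>_. B"])
    show "(\<lambda>x. norm (h (of_real (s n) * x)) powr p) \<in> borel_measurable arc_measure" for n
      by (intro measurable_arc_continuous continuous_norm_powr p continuous_on_compose2[OF conth])
         (use inb in \<open>auto intro!: continuous_intros simp: less_imp_le\<close>)
    show "(\<lambda>x. norm (h x) powr p) \<in> borel_measurable arc_measure"
      by (intro measurable_arc_continuous continuous_norm_powr p continuous_on_subset[OF conth]) auto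
    show "AE x in arc_measure. (\<lambda>n. norm (h (of_real (s n) * x)) powr p) \<longlonglongrightarrow> norm (h x) powr p"
      by (intro AE_I2 hlim) auto
    show "AE x in arc_measure. norm (norm (h (of_real (s n) * x)) powr p) \<le> B" for n
      by (intro AE_I2 B) (use inb[of _ n] in \<open>auto simp: less_imp_le\<close>)
  qed auto
  then have "(\<Sum>i\<in>I. disk_weight (z i) * norm (h (z i)) powr p) \<le> C * (LINT x|arc_measure. norm (h x) powr p)"
  proof (intro LIMSEQ_le[OF tendsto_sum tendsto_mult_left])
    show "(\<lambda>n. disk_weight (z i) * norm (h (of_real (s n) * z i)) powr p) \<longlonglongrightarrow> disk_weight (z i) * norm (h (z i)) powr p"
      if "i \<in> I" for i
      by (intro tendsto_intros hlim) (use z[OF that] in auto)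
  qed (use step in auto)
  moreover have "(LINT x|arc_measure. norm (h x) powr p) = (LINT x|arc_measure. norm (f x) powr p)"
    by (intro Bochner_Integration.integral_cong refl) (simp add: eq)
  moreover have "(\<Sum>i\<in>I. disk_weight (z i) * norm (f (z i)) powr p) \<le> (\<Sum>i\<in>I. disk_weight (z i) * norm (h (z i)) powr p)"
    using z p disk_weight_pos le
    by (intro sum_mono mult_left_mono powr_mono2) (auto simp: less_imp_le)
  ultimately show ?thesis by simp
qed

lemma sampling_bound_hardy_mean:
  fixes z :: "'i \<Rightarrow> complex"
  assumes p: "0 < p" and fin: "finite I" and z: "\<And>i. i \<in> I \<Longrightarrow> norm (z i) < 1" and C: "0 < C"
    and rows: "\<And>i. i \<in> I \<Longrightarrow> szego_row I z i \<le> C"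
    and hol: "f holomorphic_on unit_disk" and r: "0 < r" "r < 1"
  shows "(\<Sum>i\<in>I. disk_weight (z i) * norm (f (of_real r * z i)) powr p) \<le> C * hardy_mean p r f"
proof -
  have "(\<lambda>x. f (of_real r * x)) holomorphic_on ball 0 (1 / r)"
    by (intro holomorphic_on_compose_gen[OF _ hol, unfolded o_def] holomorphic_intros)
       (use r in \<open>auto simp: norm_mult field_simps\<close>)
  from sampling_bound_closed_disk[OF p fin z C rows this] r show ?thesis
    by (simp add: hardy_mean_def)
qed

text \<open>The sampling bound for one point: the Gram matrix is the number 1.\<close>

lemma point_bound_hardy_mean:
  assumes p: "0 < p" and a: "norm a < 1" and hol: "f holomorphic_on unit_disk" and r: "0 < r" "r < 1"
  shows "disk_weight a * norm (f (of_real r * a)) powr p \<le> hardy_mean p r f"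
proof -
  have "szego_row {()} (\<lambda>_. a) i \<le> 1" for i
  proof -
    have "1 - cnj a * a = of_real (disk_weight a)"
      by (simp add: disk_weight_def complex_norm_square mult.commute del: of_real_power)
    then have "norm (1 - cnj a * a) = disk_weight a"
      using disk_weight_pos[OF a] by (simp only: norm_of_real)
    then show ?thesis using disk_weight_pos[OF a] by (simp add: szego_row_def)
  qed
  then show ?thesis
    using sampling_bound_hardy_mean[OF p, of "{()}" "\<lambda>_. a" 1 f r] a hol r by simp
qed

lemma hardy_ballD:
  assumes "hardy_ball p K f"
  shows "f holomorphic_on unit_disk" "\<And>r. 0 < r \<Longrightarrow> r < 1 \<Longrightarrow> hardy_mean p r f \<le> K"
  using assms by (auto simp: hardy_ball_def)

lemma dilation_limit:
  assumes hol: "f holomorphic_on unit_disk" and a: "norm a < 1" and p: "0 < p"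
  shows "((\<lambda>r. norm (f (of_real r * a)) powr p) \<longlongrightarrow> norm (f a) powr p) (at_left 1)"
proof -
  have "continuous_on unit_disk (\<lambda>x. norm (f x) powr p)"
    by (intro continuous_norm_powr holomorphic_on_imp_continuous_on hol p)
  moreover have "((\<lambda>r. of_real r * a) \<longlongrightarrow> of_real 1 * a) (at_left 1)"
    by (intro tendsto_intros)
  moreover have "\<forall>\<^sub>F r in at_left 1. of_real r * a \<in> unit_disk"
  proof (rule eventually_at_leftI[of 0])
    fix r :: real assume "r \<in> {0<..<1}"
    then show "of_real r * a \<in> unit_disk" using a mult_mono[of r 1 "norm a" "norm a"]
      by (simp add: norm_mult)
  qed simp
  ultimately show ?thesis
    using a by (intro continuous_on_tendsto_compose[where f="\<lambda>x. norm (f x) powr p" and s=unit_disk]) auto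
qed

lemma sampling_bound_hardy_ball:
  fixes z :: "'i \<Rightarrow> complex"
  assumes p: "0 < p" and fin: "finite I" and z: "\<And>i. i \<in> I \<Longrightarrow> norm (z i) < 1" and C: "0 < C"
    and rows: "\<And>i. i \<in> I \<Longrightarrow> szego_row I z i \<le> C"
    and f: "hardy_ball p K f"
  shows "(\<Sum>i\<in>I. disk_weight (z i) * norm (f (z i)) powr p) \<le> C * K"
proof (rule tendsto_le[OF _ tendsto_const])
  show "((\<lambda>r. \<Sum>i\<in>I. disk_weight (z i) * norm (f (of_real r * z i)) powr p)
      \<longlongrightarrow> (\<Sum>i\<in>I. disk_weight (z i) * norm (f (z i)) powr p)) (at_left 1)"
    by (intro tendsto_intros dilation_limit hardy_ballD(1)[OF f] z p)
  show "\<forall>\<^sub>F r in at_left 1. (\<Sum>i\<in>I. disk_weight (z i) * norm (f (of_real r * z i)) powr p) \<le> C * K"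
  proof (rule eventually_at_leftI[of 0])
    fix r :: real assume r: "r \<in> {0<..<1}"
    then have "(\<Sum>i\<in>I. disk_weight (z i) * norm (f (of_real r * z i)) powr p) \<le> C * hardy_mean p r f"
      by (intro sampling_bound_hardy_mean p fin z C rows hardy_ballD(1)[OF f]) auto
    also have "\<dots> \<le> C * K" using hardy_ballD(2)[OF f] r C by (intro mult_left_mono) auto
    finally show "(\<Sum>i\<in>I. disk_weight (z i) * norm (f (of_real r * z i)) powr p) \<le> C * K" .
  qed simp
qed simp

text \<open>A bound on the means for radii close to 1 suffices, which is all that is available for
  quotients by Blaschke products.\<close>

lemma point_bound_at_left:
  assumes p: "0 < p" and a: "norm a < 1" and hol: "f holomorphic_on unit_disk"
    and K: "\<forall>\<^sub>F r in at_left 1. hardy_mean p r f \<le> K"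
  shows "disk_weight a * norm (f a) powr p \<le> K"
proof (rule tendsto_le[OF _ tendsto_const])
  show "((\<lambda>r. disk_weight a * norm (f (of_real r * a)) powr p)
      \<longlongrightarrow> disk_weight a * norm (f a) powr p) (at_left 1)"
    by (intro tendsto_intros dilation_limit hol a p)
  have "\<forall>\<^sub>F r::real in at_left 1. 0 < r \<and> r < 1"
    by (rule eventually_at_leftI[of 0]) auto
  with K show "\<forall>\<^sub>F r in at_left 1. disk_weight a * norm (f (of_real r * a)) powr p \<le> K"
    by eventually_elim (use point_bound_hardy_mean[OF p a hol] order_trans in blast)
qed simp

lemma point_bound_hardy_ball:
  assumes p: "0 < p" and a: "norm a < 1" and f: "hardy_ball p K f"
  shows "disk_weight a * norm (f a) powr p \<le> K"
  by (rule point_bound_at_left[OF p a hardy_ballD(1)[OF f]])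
     (auto intro!: eventually_at_leftI[of 0] hardy_ballD(2)[OF f])


section \<open>Algebra of Hardy balls and normal families\<close>

lemma hardy_mean_nonneg: "0 \<le> hardy_mean p r f"
  by (simp add: hardy_mean_def)

lemma hardy_ball_nonneg: "hardy_ball p K f \<Longrightarrow> 0 \<le> K"
  using hardy_ballD(2)[of p K f "1/2"] hardy_mean_nonneg[of p "1/2" f] by linarith

lemma hardy_ball_mono: "hardy_ball p K f \<Longrightarrow> K \<le> L \<Longrightarrow> hardy_ball p L f"
  unfolding hardy_ball_def by (meson order_trans)

lemma hardy_space_iff:
  assumes p: "0 < p"
  shows "f \<in> hardy_space p \<longleftrightarrow> (\<exists>K. hardy_ball p K f)"
proof
  assume f: "f \<in> hardy_space p"
  then obtain B where B: "0 \<le> B" "hardy_norm p f = ennreal B"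
    by (auto simp: hardy_space_def less_top_ennreal)
  have "hardy_mean p r f \<le> B powr p" if "r \<in> {0<..<1}" for r
  proof -
    have "ennreal (hardy_mean p r f powr (1 / p)) \<le> ennreal B"
      unfolding B(2)[symmetric] hardy_norm_def hardy_mean_def using that by (rule SUP_upper)
    then have "hardy_mean p r f powr (1 / p) \<le> B" using B(1) by simp
    then have "(hardy_mean p r f powr (1 / p)) powr p \<le> B powr p"
      using p by (intro powr_mono2) auto
    then show ?thesis using p hardy_mean_nonneg[of p r f] by (simp add: powr_powr)
  qed
  with f show "\<exists>K. hardy_ball p K f"
    by (intro exI[of _ "B powr p"]) (auto simp: hardy_ball_def hardy_space_def)
next
  assume "\<exists>K. hardy_ball p K f"
  then obtain K where K: "hardy_ball p K f" by blast
  have "hardy_norm p f \<le> ennreal (K powr (1 / p))"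
    unfolding hardy_norm_def
  proof (rule SUP_least)
    fix r :: real assume "r \<in> {0<..<1}"
    then have "hardy_mean p r f \<le> K" using hardy_ballD(2)[OF K] by auto
    then show "ennreal ((LINT u|arc_measure. norm (f (of_real r * u)) powr p) powr (1 / p)) \<le> ennreal (K powr (1 / p))"
      using p hardy_mean_nonneg[of p r f] unfolding hardy_mean_def
      by (intro ennreal_leI powr_mono2) auto
  qed
  then show "f \<in> hardy_space p"
    using hardy_ballD(1)[OF K] by (auto simp: hardy_space_def intro: le_less_trans)
qed

lemma hardy_mean_dominated:
  assumes p: "0 < p" and hol: "f holomorphic_on unit_disk" "g holomorphic_on unit_disk"
    and r: "0 < r" "r < 1" and B: "0 \<le> B" and le: "\<And>z. norm z = r \<Longrightarrow> norm (g z) \<le> B * norm (f z)"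
  shows "hardy_mean p r g \<le> B powr p * hardy_mean p r f"
proof -
  have "hardy_mean p r g \<le> (LINT u|arc_measure. B powr p * norm (f (of_real r * u)) powr p)"
    unfolding hardy_mean_def
  proof (rule integral_mono)
    show "integrable arc_measure (\<lambda>u. norm (g (of_real r * u)) powr p)"
      using integrable_circle_mean[OF hol(2) _ p] r by auto
    show "integrable arc_measure (\<lambda>u. B powr p * norm (f (of_real r * u)) powr p)"
      using integrable_circle_mean[OF hol(1) _ p] r by auto
    fix u assume "u \<in> space arc_measure"
    then have "norm (g (of_real r * u)) \<le> B * norm (f (of_real r * u))"
      using r by (intro le) (simp add: norm_mult)
    then have "norm (g (of_real r * u)) powr p \<le> (B * norm (f (of_real r * u))) powr p"
      using p by (intro powr_mono2) auto
    then show "norm (g (of_real r * u)) powr p \<le> B powr p * norm (f (of_real r * u)) powr p"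
      using B by (simp add: powr_mult)
  qed
  then show ?thesis by (simp add: hardy_mean_def)
qed

lemma hardy_ball_dominated:
  assumes p: "0 < p" and f: "hardy_ball p K f" and g: "g holomorphic_on unit_disk" and B: "0 \<le> B"
    and le: "\<And>z. norm z < 1 \<Longrightarrow> norm (g z) \<le> B * norm (f z)"
  shows "hardy_ball p (B powr p * K) g"
  unfolding hardy_ball_def
proof (intro conjI g ballI)
  fix r :: real assume r: "r \<in> {0<..<1}"
  then have "hardy_mean p r g \<le> B powr p * hardy_mean p r f"
    using le by (intro hardy_mean_dominated p hardy_ballD(1)[OF f] g B) auto
  also have "\<dots> \<le> B powr p * K"
    using hardy_ballD(2)[OF f] r by (intro mult_left_mono) auto
  finally show "hardy_mean p r g \<le> B powr p * K" .
qed

lemma hardy_mean_one: "hardy_mean p r (\<lambda>_. 1) = 1"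
  by (simp add: hardy_mean_def arc.prob_space[simplified])

lemma hardy_ball_bounded:
  assumes p: "0 < p" and g: "g holomorphic_on unit_disk" and le: "\<And>z. norm z < 1 \<Longrightarrow> norm (g z) \<le> B"
  shows "hardy_ball p (B powr p) g"
proof -
  have "0 \<le> B" using le[of 0] norm_ge_zero[of "g 0"] by (simp del: norm_ge_zero)
  moreover have "hardy_ball p 1 (\<lambda>_. 1)"
    by (simp add: hardy_ball_def hardy_mean_one)
  ultimately show ?thesis
    using hardy_ball_dominated[OF p _ g, of 1 "\<lambda>_. 1" B] le by simp
qed

lemma hardy_ball_cmult:
  assumes p: "0 < p" and f: "hardy_ball p K f"
  shows "hardy_ball p (norm c powr p * K) (\<lambda>z. c * f z)"
  by (rule hardy_ball_dominated[OF p f]) (auto intro!: holomorphic_intros hardy_ballD(1)[OF f] simp: norm_mult)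

lemma powr_add_le:
  fixes x y :: real
  assumes "0 < p" "0 \<le> x" "0 \<le> y"
  shows "(x + y) powr p \<le> 2 powr p * (x powr p + y powr p)"
proof -
  have "(x + y) powr p \<le> (2 * max x y) powr p"
    using assms by (intro powr_mono2) auto
  also have "\<dots> = 2 powr p * max x y powr p" using assms by (simp add: powr_mult)
  also have "max x y powr p \<le> x powr p + y powr p" by (auto simp: max_def)
  finally show ?thesis by simp
qed

lemma norm_add_powr_le:
  fixes x y :: complex
  assumes "0 < p"
  shows "norm (x + y) powr p \<le> 2 powr p * (norm x powr p + norm y powr p)"
proof -
  have "norm (x + y) powr p \<le> (norm x + norm y) powr p"
    using assms by (intro powr_mono2 norm_triangle_ineq) auto
  also have "\<dots> \<le> 2 powr p * (norm x powr p + norm y powr p)"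
    using assms by (intro powr_add_le) auto
  finally show ?thesis .
qed

lemma hardy_ball_add:
  assumes p: "0 < p" and f: "hardy_ball p K f" and g: "hardy_ball p L g"
  shows "hardy_ball p (2 powr p * (K + L)) (\<lambda>z. f z + g z)"
  unfolding hardy_ball_def
proof (intro conjI ballI)
  show hol: "(\<lambda>z. f z + g z) holomorphic_on unit_disk"
    by (intro holomorphic_intros hardy_ballD(1)[OF f] hardy_ballD(1)[OF g])
  fix r :: real assume r: "r \<in> {0<..<1}"
  note int = integrable_circle_mean[OF hardy_ballD(1)[OF f] r p] integrable_circle_mean[OF hardy_ballD(1)[OF g] r p]
  have "hardy_mean p r (\<lambda>z. f z + g z)
     \<le> (LINT u|arc_measure. 2 powr p * (norm (f (of_real r * u)) powr p + norm (g (of_real r * u)) powr p))"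
    unfolding hardy_mean_def
    by (intro integral_mono integrable_circle_mean[OF hol r p] norm_add_powr_le p)
       (use int in auto)
  also have "\<dots> = 2 powr p * (hardy_mean p r f + hardy_mean p r g)"
    unfolding hardy_mean_def using int by simp
  also have "\<dots> \<le> 2 powr p * (K + L)"
    using hardy_ballD(2)[OF f] hardy_ballD(2)[OF g] r by (intro mult_left_mono add_mono) auto
  finally show "hardy_mean p r (\<lambda>z. f z + g z) \<le> 2 powr p * (K + L)" .
qed

lemma hardy_ball_diff:
  assumes p: "0 < p" and f: "hardy_ball p K f" and g: "hardy_ball p L g"
  shows "hardy_ball p (2 powr p * (K + L)) (\<lambda>z. f z - g z)"
  using hardy_ball_add[OF p f hardy_ball_cmult[OF p g, of "-1"]] by simp

lemma hardy_ball_cong: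
  assumes f: "hardy_ball p K f" and p: "0 < p" and eq: "\<And>z. norm z < 1 \<Longrightarrow> f z = g z"
  shows "hardy_ball p K g"
proof -
  have "g holomorphic_on unit_disk"
    by (rule holomorphic_transform[OF hardy_ballD(1)[OF f]]) (use eq in auto)
  then show ?thesis
    using hardy_ball_dominated[OF p f, of g 1] eq by auto
qed

text \<open>Point evaluations bound the family on compact sets, so Montel's theorem applies; on each
  circle of radius \<open>r < 1\<close> dominated convergence passes the bound \<open>K\<close> to
  the limit. This is the compactness used for all \<open>p\<close>, in place of weak
  compactness.\<close>

lemma hardy_ball_Montel:
  assumes p: "0 < p" and f: "\<And>k::nat. hardy_ball p K (f k)"
  obtains g s where "strict_mono (s :: nat \<Rightarrow> nat)" "hardy_ball p K g"
    "\<And>z. norm z < 1 \<Longrightarrow> (\<lambda>k. f (s k) z) \<longlonglongrightarrow> g z"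
proof -
  have bd: "\<exists>B. \<forall>h\<in>range f. \<forall>z\<in>S. norm (h z) \<le> B" if S: "compact S" "S \<subseteq> unit_disk" for S
  proof (cases "S = {}")
    case False
    obtain z0 where z0: "z0 \<in> S" "\<And>z. z \<in> S \<Longrightarrow> norm z \<le> norm z0"
      using continuous_attains_sup[OF S(1) False, of norm] by (auto intro: continuous_intros)
    define w where "w = disk_weight z0"
    have "norm z0 < 1" using z0(1) S(2) by auto
    then have w: "0 < w" by (simp add: w_def disk_weight_pos)
    have "norm (f k z) \<le> (K / w) powr (1 / p)" if "z \<in> S" for k z
    proof -
      have z: "norm z < 1" using that S by auto
      have "w \<le> disk_weight z" using z0(2)[OF that] by (auto simp: w_def disk_weight_def intro: power_mono)
      then have "w * norm (f k z) powr p \<le> disk_weight z * norm (f k z) powr p"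
        by (rule mult_right_mono) simp
      also have "\<dots> \<le> K" by (rule point_bound_hardy_ball[OF p z f])
      finally have "norm (f k z) powr p \<le> K / w" using w by (simp add: field_simps)
      then have "(norm (f k z) powr p) powr (1 / p) \<le> (K / w) powr (1 / p)"
        using p by (intro powr_mono2) auto
      then show ?thesis using p by (simp add: powr_powr)
    qed
    then show ?thesis by blast
  qed auto
  obtain g s where g: "g holomorphic_on unit_disk" and s: "strict_mono (s :: nat \<Rightarrow> nat)"
    and lim: "\<And>z. z \<in> unit_disk \<Longrightarrow> (\<lambda>k. f (s k) z) \<longlonglongrightarrow> g z"
  proof (rule Montel[of unit_disk "range f" f, OF _ _ bd])
    show "h holomorphic_on unit_disk" if "h \<in> range f" for h
      using that hardy_ballD(1)[OF f] by auto
  qed auto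
  have "hardy_mean p r g \<le> K" if r: "r \<in> {0<..<1}" for r
  proof (rule LIMSEQ_le_const2)
    have sph: "of_real r * u \<in> unit_disk" if "norm u = 1" for u :: complex
      using that r by (simp add: norm_mult)
    have "compact ((\<lambda>u. of_real r * u) ` sphere 0 (1::real)::complex set)"
      by (intro compact_continuous_image continuous_intros compact_sphere)
    from bd[OF this] obtain B where B: "norm (f k (of_real r * u)) \<le> B" if "norm u = 1" for k u
      using sph by fastforce
    have "(\<lambda>k. hardy_mean p r (f (s k))) \<longlonglongrightarrow> hardy_mean p r g"
      unfolding hardy_mean_def
    proof (rule integral_dominated_convergence[where w="\<lambda>_. B powr p"])
      show "(\<lambda>u. norm (g (of_real r * u)) powr p) \<in> borel_measurable arc_measure"
        using integrable_circle_mean[OF g r p] by (rule borel_measurable_integrable)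
      show "(\<lambda>u. norm (f (s k) (of_real r * u)) powr p) \<in> borel_measurable arc_measure" for k
        using integrable_circle_mean[OF hardy_ballD(1)[OF f] r p] by (rule borel_measurable_integrable)
      show "AE u in arc_measure. (\<lambda>k. norm (f (s k) (of_real r * u)) powr p) \<longlonglongrightarrow> norm (g (of_real r * u)) powr p"
        by (intro AE_I2 tendsto_powr' tendsto_norm lim sph tendsto_const) (use p in auto)
      show "AE u in arc_measure. norm (norm (f (s k) (of_real r * u)) powr p) \<le> B powr p" for k
        using B p by (intro AE_I2) (auto intro: powr_mono2)
    qed auto
    then show "(\<lambda>k. hardy_mean p r (f (s k))) \<longlonglongrightarrow> hardy_mean p r g" .
    show "\<exists>N. \<forall>n\<ge>N. hardy_mean p r (f (s n)) \<le> K"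
      using hardy_ballD(2)[OF f] r by auto
  qed
  then have "hardy_ball p K g" using g by (simp add: hardy_ball_def)
  then show ?thesis using s lim that by auto
qed

section \<open>Finite Blaschke products with simple zeros\<close>

definition blaschke :: "complex set \<Rightarrow> complex \<Rightarrow> complex" where
  "blaschke A z = (\<Prod>a\<in>A. (z - a) / (1 - cnj a * z))"

lemma blaschke_continuous:
  assumes "A \<subseteq> unit_disk"
  shows "continuous_on (cball 0 1) (blaschke A)"
  unfolding blaschke_def
  by (intro continuous_intros ballI one_minus_cnj_mult_nonzero) (use assms in auto)

lemma blaschke_holomorphic:
  assumes "A \<subseteq> unit_disk"
  shows "blaschke A holomorphic_on unit_disk"
  unfolding blaschke_def
  by (intro holomorphic_intros one_minus_cnj_mult_nonzero) (use assms in auto)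

lemma norm_blaschke_sphere:
  assumes "A \<subseteq> unit_disk" "norm z = 1"
  shows "norm (blaschke A z) = 1"
proof -
  have "norm ((z - a) / (1 - cnj a * z)) = 1" if "a \<in> A" for a
    using norm_moebius_sphere[OF assms(2), of a] one_minus_cnj_mult_nonzero[of a z] assms that
    by (auto simp: norm_divide)
  then show ?thesis unfolding blaschke_def prod_norm[symmetric] by simp
qed

lemma norm_blaschke_le_1:
  assumes "A \<subseteq> unit_disk" "norm z \<le> 1"
  shows "norm (blaschke A z) \<le> 1"
proof -
  have "norm ((z - a) / (1 - cnj a * z)) \<le> 1" if "a \<in> A" for a
    using norm_moebius_le[of a z] one_minus_cnj_mult_nonzero[of a z] assms that
    by (auto simp: norm_divide divide_simps)
  then show ?thesis unfolding blaschke_def prod_norm[symmetric] by (intro prod_le_1) auto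
qed

lemma blaschke_near_boundary:
  assumes A: "A \<subseteq> unit_disk" and e: "0 < e"
  shows "\<forall>\<^sub>F r in at_left 1. \<forall>z. norm z = r \<longrightarrow> 1 - e \<le> norm (blaschke A z)"
proof -
  have "uniformly_continuous_on (cball 0 1) (blaschke A)"
    by (intro compact_uniformly_continuous blaschke_continuous A compact_cball)
  then obtain d where d: "0 < d"
    "\<And>x y. x \<in> cball 0 1 \<Longrightarrow> y \<in> cball 0 1 \<Longrightarrow> dist y x < d \<Longrightarrow> dist (blaschke A y) (blaschke A x) < e"
    unfolding uniformly_continuous_on_def using e by metis
  show ?thesis
  proof (rule eventually_at_leftI[of "max 0 (1 - d)"])
    fix r :: real assume r: "r \<in> {max 0 (1 - d)<..<1}"
    show "\<forall>z. norm z = r \<longrightarrow> 1 - e \<le> norm (blaschke A z)"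
    proof (intro allI impI)
      fix z :: complex assume z: "norm z = r"
      define u where "u = z / of_real r"
      have u: "norm u = 1" using z r by (simp add: u_def norm_divide)
      have "z = of_real r * u" using r by (simp add: u_def)
      then have "z - u = of_real (r - 1) * u" by (simp add: algebra_simps)
      then have "dist z u = 1 - r" using u r by (simp add: dist_norm norm_mult del: of_real_diff)
      then have "dist (blaschke A z) (blaschke A u) < e"
        using r z u d(1) by (intro d(2)) auto
      moreover have "norm (blaschke A u) \<le> norm (blaschke A z) + dist (blaschke A z) (blaschke A u)"
        by (metis dist_norm norm_minus_commute norm_triangle_sub)
      ultimately show "1 - e \<le> norm (blaschke A z)"
        using norm_blaschke_sphere[OF A u] by linarith
    qed
  qed (use d in auto)
qed

text \<open>Division by a finite Blaschke product does not increase the Hardy norm: on circles close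
  to the boundary its modulus is at least \<open>1 - e\<close>, so the means of \<open>h\<close> are
  there at most \<open>(1 / (1 - e)) powr p * K\<close>; finally \<open>e\<close> tends to
  0.\<close>

lemma point_bound_blaschke_quotient:
  assumes p: "0 < p" and f: "hardy_ball p K f" and A: "A \<subseteq> unit_disk"
    and h: "h holomorphic_on unit_disk" and fh: "\<And>z. norm z < 1 \<Longrightarrow> f z = blaschke A z * h z"
    and a: "norm a < 1"
  shows "disk_weight a * norm (h a) powr p \<le> K"
proof -
  have K: "0 \<le> K" by (rule hardy_ball_nonneg[OF f])
  have *: "disk_weight a * norm (h a) powr p \<le> (1 / (1 - e)) powr p * K" if e: "0 < e" "e < 1" for e
  proof (rule point_bound_at_left[OF p a h])
    have "\<forall>\<^sub>F r::real in at_left 1. 0 < r \<and> r < 1"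
      by (rule eventually_at_leftI[of 0]) auto
    with blaschke_near_boundary[OF A e(1)]
    show "\<forall>\<^sub>F r in at_left 1. hardy_mean p r h \<le> (1 / (1 - e)) powr p * K"
    proof eventually_elim
      case (elim r)
      have "hardy_mean p r h \<le> (1 / (1 - e)) powr p * hardy_mean p r f"
      proof (rule hardy_mean_dominated[OF p hardy_ballD(1)[OF f] h])
        fix z :: complex assume z: "norm z = r"
        have "(1 - e) * norm (h z) \<le> norm (f z)"
          using fh[of z] elim z by (auto simp: norm_mult intro!: mult_right_mono)
        then show "norm (h z) \<le> 1 / (1 - e) * norm (f z)"
          using e by (simp add: field_simps)
      qed (use elim e in auto)
      also have "\<dots> \<le> (1 / (1 - e)) powr p * K"
        using hardy_ballD(2)[OF f] elim by (intro mult_left_mono) auto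
      finally show ?case .
    qed
  qed
  have "((\<lambda>e. (1 / (1 - e)) powr p * K) \<longlongrightarrow> (1 / (1 - 0)) powr p * K) (at_right 0)"
    by (intro tendsto_intros) auto
  then have "((\<lambda>e. (1 / (1 - e)) powr p * K) \<longlongrightarrow> K) (at_right 0)" by simp
  moreover have "\<forall>\<^sub>F e::real in at_right 0. 0 < e \<and> e < 1"
    by (rule eventually_at_rightI[of 0 1]) auto
  then have "\<forall>\<^sub>F e in at_right 0. disk_weight a * norm (h a) powr p \<le> (1 / (1 - e)) powr p * K"
    by eventually_elim (use * in auto)
  ultimately show ?thesis by (intro tendsto_lowerbound) auto
qed

text \<open>Zeros are divided out one at a time. The factors already split off do not vanish at the
  new point, so the current quotient does, and its simple zero can be removed.\<close>

lemma blaschke_factorization: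
  assumes "finite A" "A \<subseteq> unit_disk" "f holomorphic_on unit_disk" "\<And>a. a \<in> A \<Longrightarrow> f a = 0"
  obtains h where "h holomorphic_on unit_disk" "\<And>z. norm z < 1 \<Longrightarrow> f z = blaschke A z * h z"
proof -
  have "\<exists>h. h holomorphic_on unit_disk \<and> (\<forall>z. norm z < 1 \<longrightarrow> f z = blaschke A z * h z)"
    using assms
  proof (induction A)
    case empty
    then show ?case by (intro exI[of _ f]) (auto simp: blaschke_def)
  next
    case (insert a A)
    then obtain h where h: "h holomorphic_on unit_disk" "\<And>z. norm z < 1 \<Longrightarrow> f z = blaschke A z * h z" by auto
    have a: "norm a < 1" using insert by auto
    have "f a = 0" using insert by auto
    moreover have "(a - x) / (1 - cnj x * a) \<noteq> 0" if "x \<in> A" for x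
      using one_minus_cnj_mult_nonzero[of x a] insert.prems(1) insert.hyps(2) that a by auto
    then have "blaschke A a \<noteq> 0"
      using insert.hyps(1) by (simp only: blaschke_def prod_zero_iff) blast
    ultimately have ha: "h a = 0" using h(2)[OF a] by simp
    define g where "g = (\<lambda>z. if z = a then deriv h a else h z / (z - a) - h a / (z - a))"
    have hg: "g holomorphic_on unit_disk"
      unfolding g_def by (rule pole_theorem[OF h(1)]) (use a in auto)
    have eq: "h z = (z - a) * g z" for z using ha by (simp add: g_def)
    have "f z = blaschke (insert a A) z * ((1 - cnj a * z) * g z)" if z: "norm z < 1" for z
      using h(2)[OF z] eq[of z] insert one_minus_cnj_mult_nonzero[OF a less_imp_le[OF z]]
      by (simp add: blaschke_def)
    then show ?case
      by (intro exI[of _ "\<lambda>z. (1 - cnj a * z) * g z"]) (auto intro!: holomorphic_intros hg)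
  qed
  then show ?thesis using that by blast
qed

text \<open>Turns a norm bound for a function that is 1 at \<open>a\<close> and 0 on
  \<open>A\<close> into separation of \<open>a\<close> from \<open>A\<close>: write \<open>f\<close>
  as Blaschke product times \<open>h\<close>; then \<open>h a\<close> has modulus at most
  \<open>C powr (1 / p)\<close>, while its product with the Blaschke product at \<open>a\<close> is
  1.\<close>

lemma blaschke_lower_bound:
  assumes p: "0 < p" and f: "hardy_ball p (C * disk_weight a) f" and a: "norm a < 1"
    and A: "finite A" "A \<subseteq> unit_disk" and fa: "f a = 1" and f0: "\<And>x. x \<in> A \<Longrightarrow> f x = 0"
  shows "1 \<le> C powr (1 / p) * norm (blaschke A a)"
proof -
  obtain h where h: "h holomorphic_on unit_disk" "\<And>z. norm z < 1 \<Longrightarrow> f z = blaschke A z * h z"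
    using blaschke_factorization[OF A hardy_ballD(1)[OF f] f0] by blast
  have "disk_weight a * norm (h a) powr p \<le> C * disk_weight a"
    by (rule point_bound_blaschke_quotient[OF p f A(2) h a])
  then have "norm (h a) powr p \<le> C" using disk_weight_pos[OF a] by (simp add: mult.commute)
  then have "(norm (h a) powr p) powr (1 / p) \<le> C powr (1 / p)" using p by (intro powr_mono2) auto
  then have "norm (h a) \<le> C powr (1 / p)" using p by (simp add: powr_powr)
  then have "norm (h a) * norm (blaschke A a) \<le> C powr (1 / p) * norm (blaschke A a)"
    by (rule mult_right_mono) simp
  moreover have "norm (h a) * norm (blaschke A a) = 1"
    using h(2)[OF a] fa by (metis mult.commute norm_mult norm_one)
  ultimately show ?thesis by simp
qed

text \<open>The \<open>k\<close>-th power of the Szego kernel at \<open>a\<close>, normalised to be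
  1 there. A large \<open>k\<close> makes its \<open>p\<close>-th power integrable with mass of the
  order of \<open>disk_weight a\<close>, also for small \<open>p\<close>.\<close>

definition bump :: "nat \<Rightarrow> complex \<Rightarrow> complex \<Rightarrow> complex" where
  "bump k a z = (of_real (disk_weight a) / (1 - cnj a * z)) ^ k"

lemma one_minus_cnj_mult_self: "1 - cnj a * a = of_real (disk_weight a)"
  by (simp add: disk_weight_def complex_norm_square mult.commute del: of_real_power)

lemma bump_self: "norm a < 1 \<Longrightarrow> bump k a a = 1"
  using disk_weight_pos[of a] by (simp add: bump_def one_minus_cnj_mult_self)

lemma bump_holomorphic: "norm a < 1 \<Longrightarrow> bump k a holomorphic_on unit_disk"
  unfolding bump_def by (intro holomorphic_intros one_minus_cnj_mult_nonzero) auto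

text \<open>The reproducing property applied to the kernel itself.\<close>

lemma integral_szego_kernel_sq:
  assumes b: "norm b < 1"
  shows "(LINT u|arc_measure. (norm (1 / (1 - cnj b * u)))\<^sup>2) = 1 / disk_weight b"
proof -
  have ne: "1 - cnj b * z \<noteq> 0" if "norm z \<le> 1" for z
    using b that by (rule one_minus_cnj_mult_nonzero)
  have "(LINT u|arc_measure. (1 / (1 - cnj b * u)) * cnj (1 / (1 - cnj b * u))) = 1 / (1 - cnj b * b)"
    by (rule Cauchy_integral_arc_measure[OF _ _ b])
       (use ne in \<open>auto intro!: continuous_intros holomorphic_intros\<close>)
  then have "complex_of_real (LINT u|arc_measure. (norm (1 / (1 - cnj b * u)))\<^sup>2) = 1 / (1 - cnj b * b)"
    by (simp only: complex_norm_square[symmetric] integral_complex_of_real)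
  also have "\<dots> = of_real (1 / disk_weight b)"
    by (simp add: one_minus_cnj_mult_self)
  finally show ?thesis by (simp only: of_real_eq_iff)
qed

text \<open>On the circle of radius \<open>r\<close> the modulus is \<open>x ^ k\<close> with
  \<open>x = w / norm (1 - cnj b * u)\<close>, where the dilation has moved from the variable to the
  point, \<open>b = r * a\<close>. As \<open>x <= 2\<close> and \<open>k * p >= 2\<close>, all but
  two of the \<open>k * p\<close> factors are bounded by 2, and the remaining square integrates to
  \<open>w^2 / disk_weight b <= w\<close>.\<close>

lemma hardy_ball_bump:
  assumes p: "0 < p" and a: "norm a < 1" and k: "2 \<le> real k * p"
  shows "hardy_ball p (2 powr (real k * p - 2) * disk_weight a) (bump k a)"
  unfolding hardy_ball_def
proof (intro conjI bump_holomorphic a ballI)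
  fix r :: real assume r: "r \<in> {0<..<1}"
  define w where "w = disk_weight a"
  define b where "b = of_real r * a"
  have w: "0 < w" using a by (simp add: w_def disk_weight_pos)
  have b: "norm b < 1" "norm b \<le> norm a" using a r mult_mono[of r 1 "norm a" "norm a"]
    by (auto simp: b_def norm_mult)
  have wb: "w \<le> disk_weight b" using b by (simp add: w_def disk_weight_def power_mono)
  have pt: "norm (bump k a (of_real r * u)) powr p \<le> 2 powr (real k * p - 2) * w\<^sup>2 * (norm (1 / (1 - cnj b * u)))\<^sup>2"
    if z: "norm u = 1" for u
  proof -
    define x where "x = w / norm (1 - cnj b * u)"
    have "norm (cnj b * u) \<le> norm a" using z b(2) by (simp add: norm_mult)
    then have n: "1 - norm a \<le> norm (1 - cnj b * u)"
      using norm_triangle_ineq2[of 1 "cnj b * u"] by simp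
    have x0: "0 \<le> x" using w by (simp add: x_def)
    have "w \<le> 2 * (1 - norm a)"
      using zero_le_power2[of "1 - norm a"]
      by (simp add: w_def disk_weight_def power2_eq_square algebra_simps)
    also have "\<dots> \<le> 2 * norm (1 - cnj b * u)" using n by simp
    finally have x2: "x \<le> 2" using n a by (simp add: x_def divide_le_eq)
    have "norm (bump k a (of_real r * u)) = x ^ k"
      using w by (simp add: bump_def x_def b_def w_def norm_power norm_divide mult_ac)
    moreover have "0 < k" using k p by (cases k) auto
    ultimately have "norm (bump k a (of_real r * u)) powr p = x powr (real k * p)"
      using x0 p k by (cases "x = 0") (auto simp: powr_realpow[symmetric] powr_powr zero_power)
    also have "\<dots> = x powr (real k * p - 2) * x powr 2"
      by (simp flip: powr_add)
    also have "\<dots> \<le> 2 powr (real k * p - 2) * x powr 2"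
      using x0 x2 k by (intro mult_right_mono powr_mono2) auto
    also have "x powr 2 = x\<^sup>2" using x0 by simp
    also have "x\<^sup>2 = w\<^sup>2 * (norm (1 / (1 - cnj b * u)))\<^sup>2"
      by (simp add: x_def norm_divide power_divide)
    finally show ?thesis by (simp add: mult_ac)
  qed
  have ne: "1 - cnj b * z \<noteq> 0" if "norm z = 1" for z
    using b(1) that by (intro one_minus_cnj_mult_nonzero) auto
  have "hardy_mean p r (bump k a)
      \<le> (LINT u|arc_measure. 2 powr (real k * p - 2) * w\<^sup>2 * (norm (1 / (1 - cnj b * u)))\<^sup>2)"
    unfolding hardy_mean_def
    by (intro integral_mono integrable_circle_mean[OF bump_holomorphic[OF a] r p]
          integrable_arc_continuous continuous_intros)
       (use pt ne in auto)
  also have "\<dots> = 2 powr (real k * p - 2) * (w\<^sup>2 * (1 / disk_weight b))"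
    unfolding integral_szego_kernel_sq[OF b(1), symmetric] by simp
  also have "\<dots> \<le> 2 powr (real k * p - 2) * w"
    using w wb by (intro mult_left_mono) (auto simp: divide_simps power2_eq_square)
  finally show "hardy_mean p r (bump k a) \<le> 2 powr (real k * p - 2) * disk_weight a"
    by (simp add: w_def)
qed


section \<open>Jones' interpolation\<close>

text \<open>A discrete form of the integral of \<open>exp (- t)\<close>: by
  \<open>x <= exp x - 1\<close>, the term \<open>x * exp (- (x + s))\<close> is at most the drop
  from \<open>exp (- s)\<close> to \<open>exp (- (x + s))\<close>, and these drops
  telescope.\<close>

lemma sum_exp_telescope:
  fixes x :: "'i \<Rightarrow> real" and \<rho> :: "'i \<Rightarrow> real"
  assumes "finite J" "\<And>j. j \<in> J \<Longrightarrow> 0 \<le> x j"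
  shows "(\<Sum>j\<in>J. x j * exp (- (\<Sum>m\<in>{m\<in>J. \<rho> j \<le> \<rho> m}. x m))) \<le> 1 - exp (- (\<Sum>j\<in>J. x j))"
  using assms
\<comment> \<open>Ranking by \<open>- \<rho>\<close> inserts an index \<open>k\<close> with the
  least \<open>\<rho>\<close>, so its exponent is the sum over everything, while for the earlier
  indices the exponential can only shrink. The rule does not exclude
  \<open>k \<in> S\<close>.\<close>
proof (induction J rule: finite_ranking_induct[where f="\<lambda>i. - \<rho> i"])
  case empty
  then show ?case by simp
next
  case (insert k S)
  show ?case
  proof (cases "k \<in> S")
    case True
    then have "insert k S = S" by auto
    then show ?thesis using insert by simp
  next
    case False
    have S: "(\<Sum>j\<in>S. x j * exp (- (\<Sum>m\<in>{m\<in>insert k S. \<rho> j \<le> \<rho> m}. x m)))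
        \<le> (\<Sum>j\<in>S. x j * exp (- (\<Sum>m\<in>{m\<in>S. \<rho> j \<le> \<rho> m}. x m)))"
      using insert.prems insert.hyps(1)
      by (intro sum_mono mult_left_mono) (auto intro!: sum_mono2)
    have "{m\<in>insert k S. \<rho> k \<le> \<rho> m} = insert k S" using insert.hyps(2) by auto
    then have k: "(\<Sum>m\<in>{m\<in>insert k S. \<rho> k \<le> \<rho> m}. x m) = x k + sum x S"
      using False insert.hyps(1) by simp
    have "x k * exp (- (x k + sum x S)) \<le> (exp (x k) - 1) * exp (- (x k + sum x S))"
    proof (rule mult_right_mono)
      show "x k \<le> exp (x k) - 1" using exp_ge_add_one_self[of "x k"] by linarith
    qed simp
    also have "\<dots> = exp (- sum x S) - exp (- (x k + sum x S))"
      by (simp add: algebra_simps flip: exp_add)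
    finally have "x k * exp (- (x k + sum x S)) \<le> exp (- sum x S) - exp (- (x k + sum x S))" .
    moreover have "(\<Sum>j\<in>S. x j * exp (- (\<Sum>m\<in>{m\<in>S. \<rho> j \<le> \<rho> m}. x m))) \<le> 1 - exp (- sum x S)"
      using insert.IH insert.prems by auto
    moreover have "(\<Sum>j\<in>insert k S. x j * exp (- (\<Sum>m\<in>{m\<in>insert k S. \<rho> j \<le> \<rho> m}. x m)))
        = x k * exp (- (x k + sum x S))
          + (\<Sum>j\<in>S. x j * exp (- (\<Sum>m\<in>{m\<in>insert k S. \<rho> j \<le> \<rho> m}. x m)))"
      unfolding k[symmetric] by (rule sum.insert[OF insert.hyps(1) False])
    ultimately show ?thesis
      unfolding sum.insert[OF insert.hyps(1) False, of x] using S by linarith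
  qed
qed

lemma Re_cayley: "Re ((1 + u) / (1 - u)) = (1 - (norm u)\<^sup>2) / (norm (1 - u))\<^sup>2"
  by (simp add: Re_divide cmod_power2) (simp add: power2_eq_square algebra_simps)

text \<open>The inequality \<open>1 - t <= - ln t\<close> at \<open>t = (b m)^2\<close> converts a
  lower bound for a product into an upper bound for a sum.\<close>

lemma sum_one_minus_moebius_sq_le:
  fixes b :: "'i \<Rightarrow> real"
  assumes fin: "finite J" and b: "\<And>m. m \<in> J \<Longrightarrow> 0 < b m" and d: "0 < d" "d \<le> prod b J"
  shows "(\<Sum>m\<in>J. 1 - (b m)\<^sup>2) \<le> - 2 * ln d"
proof -
  have "(\<Sum>m\<in>J. 1 - (b m)\<^sup>2) \<le> (\<Sum>m\<in>J. - 2 * ln (b m))"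
  proof (rule sum_mono)
    fix m assume "m \<in> J"
    then have "0 < b m" by (rule b)
    then show "1 - (b m)\<^sup>2 \<le> - 2 * ln (b m)"
      using ln_le_minus_one[of "(b m)\<^sup>2"] by (simp add: ln_realpow)
  qed
  also have "\<dots> = - 2 * ln (prod b J)"
  proof -
    have "ln (prod b J) = (\<Sum>m\<in>J. ln (b m))" by (intro ln_prod) (use fin b in \<open>force+\<close>)
    then show ?thesis by (simp add: sum_distrib_left sum_negf)
  qed
  also have "\<dots> \<le> - 2 * ln d" using d by simp
  finally show ?thesis .
qed

text \<open>P. Jones' functions: the exponential factor makes the sum over \<open>j\<close> of their moduli bounded, as in
  \<open>sum_exp_telescope\<close>.\<close>

abbreviation farther :: "'i set \<Rightarrow> ('i \<Rightarrow> complex) \<Rightarrow> 'i \<Rightarrow> 'i set" where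
  "farther J z j \<equiv> {m\<in>J. norm (z j) \<le> norm (z m)}"

text \<open>The Cayley transforms are holomorphic and have positive real parts on the disk, of
  Poisson kernel type. So the modulus of the exponential of minus this sum is \<open>exp\<close> of
  minus a sum of nonnegative terms.\<close>

definition jones_exponent :: "'i set \<Rightarrow> ('i \<Rightarrow> complex) \<Rightarrow> 'i \<Rightarrow> complex \<Rightarrow> complex" where
  "jones_exponent J z j v = (\<Sum>m\<in>farther J z j.
     of_real (disk_weight (z m)) * ((1 + cnj (z m) * v) / (1 - cnj (z m) * v)))"

text \<open>The Blaschke quotient vanishes at the other points, and all factors are normalised to be
  1 at \<open>z j\<close>. The bump is squared because its modulus is then dominated by the summand
  with index \<open>j\<close> of the real part of the exponent.\<close>

definition jones :: "'i set \<Rightarrow> ('i \<Rightarrow> complex) \<Rightarrow> 'i \<Rightarrow> complex \<Rightarrow> complex" where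
  "jones J z j v = blaschke (z ` (J - {j})) v / blaschke (z ` (J - {j})) (z j) * bump 2 (z j) v
     * exp (jones_exponent J z j (z j) - jones_exponent J z j v)"

lemma jones_holomorphic:
  assumes z: "\<And>j. j \<in> J \<Longrightarrow> norm (z j) < 1" and j: "j \<in> J"
    and ne: "blaschke (z ` (J - {j})) (z j) \<noteq> 0"
  shows "jones J z j holomorphic_on unit_disk"
  unfolding jones_def jones_exponent_def
  by (intro holomorphic_intros blaschke_holomorphic bump_holomorphic one_minus_cnj_mult_nonzero)
     (use z j ne in auto)

lemma blaschke_eq_0: "finite A \<Longrightarrow> a \<in> A \<Longrightarrow> blaschke A a = 0"
  by (auto simp: blaschke_def intro!: prod_zero bexI[of _ a])

lemma jones_interpolates:
  assumes fin: "finite J" and z: "\<And>j. j \<in> J \<Longrightarrow> norm (z j) < 1" and i: "i \<in> J" and j: "j \<in> J"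
    and ne: "blaschke (z ` (J - {j})) (z j) \<noteq> 0"
  shows "jones J z j (z i) = (if i = j then 1 else 0)"
proof (cases "i = j")
  case True
  then show ?thesis using ne z[OF j] by (simp add: jones_def bump_self)
next
  case False
  then have "blaschke (z ` (J - {j})) (z i) = 0" using fin i by (intro blaschke_eq_0) auto
  then show ?thesis using False by (simp add: jones_def)
qed

lemma Re_jones_exponent:
  "Re (jones_exponent J z j v) = (\<Sum>m\<in>farther J z j.
     disk_weight (z m) * ((1 - (norm (z m))\<^sup>2 * (norm v)\<^sup>2) / (norm (1 - cnj (z m) * v))\<^sup>2))"
  unfolding jones_exponent_def Re_sum
  by (intro sum.cong refl) (simp only: Re_complex_of_real Im_complex_of_real times_complex.simps(1) Re_cayley
      mult_zero_left diff_zero norm_mult complex_mod_cnj power_mult_distrib)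

lemma one_minus_moebius_sq:
  assumes "norm a < 1" "norm b \<le> 1"
  shows "1 - (norm ((b - a) / (1 - cnj a * b)))\<^sup>2
    = disk_weight a * disk_weight b / (norm (1 - cnj a * b))\<^sup>2"
proof -
  have "0 < (norm (1 - cnj a * b))\<^sup>2" using one_minus_cnj_mult_nonzero[OF assms] by simp
  then show ?thesis
    using norm_one_minus_cnj_mult_diff[of a b]
    by (simp add: norm_divide power_divide disk_weight_def field_simps)
qed

text \<open>Here the restriction to farther points matters: \<open>norm (z m) >= norm (z j)\<close>
  gives \<open>1 - (norm (z m))^2 * (norm (z j))^2 <= 2 * disk_weight (z j)\<close>, so each summand
  is at most \<open>2 * (1 - (b m)^2)\<close> with \<open>b m\<close> the pseudohyperbolic distance.
  The index \<open>j\<close> itself contributes 2, the others together at most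
  \<open>- 4 * ln d\<close> by separation.\<close>

lemma Re_jones_exponent_self_le:
  assumes fin: "finite J" and z: "\<And>j. j \<in> J \<Longrightarrow> norm (z j) < 1" and inj: "inj_on z J" and j: "j \<in> J"
    and d: "0 < d" "d \<le> norm (blaschke (z ` (J - {j})) (z j))"
  shows "Re (jones_exponent J z j (z j)) \<le> 2 - 4 * ln d"
proof -
  define b where "b = (\<lambda>m. norm ((z j - z m) / (1 - cnj (z m) * z j)))"
  have b: "1 - (b m)\<^sup>2 = disk_weight (z m) * disk_weight (z j) / (norm (1 - cnj (z m) * z j))\<^sup>2" if "m \<in> J" for m
    unfolding b_def using z[OF that] z[OF j] by (intro one_minus_moebius_sq) auto
  have b0: "0 < disk_weight (z m)" if "m \<in> J" for m
    using z[OF that] by (rule disk_weight_pos)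
  have "Re (jones_exponent J z j (z j)) \<le> (\<Sum>m\<in>farther J z j. 2 * (1 - (b m)\<^sup>2))"
    unfolding Re_jones_exponent
  proof (rule sum_mono)
    fix m assume m: "m \<in> farther J z j"
    define t where "t = (norm (z j))\<^sup>2"
    have "t \<le> (norm (z m))\<^sup>2" using m by (auto simp: t_def intro: power_mono)
    then have "t * t \<le> (norm (z m))\<^sup>2 * t" by (intro mult_right_mono) (auto simp: t_def)
    moreover have "1 - t * t \<le> 2 * (1 - t)"
      using zero_le_power2[of "1 - t"] by (simp add: power2_eq_square algebra_simps)
    ultimately have "1 - (norm (z m))\<^sup>2 * (norm (z j))\<^sup>2 \<le> 2 * disk_weight (z j)"
      by (simp add: t_def disk_weight_def)
    then have "disk_weight (z m) * ((1 - (norm (z m))\<^sup>2 * (norm (z j))\<^sup>2) / (norm (1 - cnj (z m) * z j))\<^sup>2)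
        \<le> disk_weight (z m) * (2 * disk_weight (z j) / (norm (1 - cnj (z m) * z j))\<^sup>2)"
      using b0[of m] m by (intro mult_left_mono divide_right_mono) auto
    also have "\<dots> = 2 * (1 - (b m)\<^sup>2)" using b[of m] m by simp
    finally show "disk_weight (z m) * ((1 - (norm (z m))\<^sup>2 * (norm (z j))\<^sup>2) / (norm (1 - cnj (z m) * z j))\<^sup>2)
        \<le> 2 * (1 - (b m)\<^sup>2)" .
  qed
  also have "\<dots> \<le> (\<Sum>m\<in>J. 2 * (1 - (b m)\<^sup>2))"
    using fin b b0 j by (intro sum_mono2) (auto simp: less_imp_le)
  also have "\<dots> = 2 * (1 - (b j)\<^sup>2) + 2 * (\<Sum>m\<in>J - {j}. 1 - (b m)\<^sup>2)"
    using fin j by (simp add: sum.remove sum_distrib_left)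
  also have "b j = 0" by (simp add: b_def)
  also have "(\<Sum>m\<in>J - {j}. 1 - (b m)\<^sup>2) \<le> - 2 * ln d"
  proof (rule sum_one_minus_moebius_sq_le)
    have eq: "norm (blaschke (z ` (J - {j})) (z j)) = prod b (J - {j})"
      unfolding blaschke_def b_def prod_norm[symmetric]
      by (subst prod.reindex) (auto intro: inj_on_subset[OF inj])
    show "d \<le> prod b (J - {j})" using d(2) by (simp add: eq)
    then have "prod b (J - {j}) \<noteq> 0" using d(1) by simp
    then have "b m \<noteq> 0" if "m \<in> J - {j}" for m
      using that fin by (metis finite_Diff prod_zero)
    then show "0 < b m" if "m \<in> J - {j}" for m
      using that by (simp add: b_def)
  qed (use fin d in auto)
  finally show ?thesis by simp
qed

text \<open>Each modulus is at most \<open>1 / d\<close> from the Blaschke quotient, times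
  \<open>x j\<close> from the squared bump, times \<open>exp (2 - 4 * ln d)\<close> from the
  exponent at \<open>z j\<close>, times the exponential of minus the sum of the farther
  \<open>x m\<close>. The telescoping lemma bounds the sum of the remaining products by 1.\<close>

lemma sum_norm_jones_le:
  assumes fin: "finite J" and z: "\<And>j. j \<in> J \<Longrightarrow> norm (z j) < 1" and inj: "inj_on z J"
    and d: "0 < d" "\<And>j. j \<in> J \<Longrightarrow> d \<le> norm (blaschke (z ` (J - {j})) (z j))"
    and v: "norm v < 1"
  shows "(\<Sum>j\<in>J. norm (jones J z j v)) \<le> exp (2 - 4 * ln d) / d"
proof -
  define x where "x = (\<lambda>m. disk_weight (z m) * ((1 - (norm (z m))\<^sup>2 * (norm v)\<^sup>2) / (norm (1 - cnj (z m) * v))\<^sup>2))"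
  have lt: "(norm (z m))\<^sup>2 * (norm v)\<^sup>2 \<le> (norm (z m))\<^sup>2" for m
    using v by (intro mult_left_le) (auto simp: power_le_one)
  have x: "0 \<le> x j" if "j \<in> J" for j
  proof -
    have "(norm (z j))\<^sup>2 \<le> 1" using z[OF that] by (simp add: power_le_one)
    then have "0 \<le> 1 - (norm (z j))\<^sup>2 * (norm v)\<^sup>2" using lt[of j] by linarith
    then show ?thesis using disk_weight_pos[OF z[OF that]] by (simp add: x_def)
  qed
  have "(\<Sum>j\<in>J. norm (jones J z j v))
      \<le> (\<Sum>j\<in>J. exp (2 - 4 * ln d) / d * (x j * exp (- (\<Sum>m\<in>farther J z j. x m))))"
  proof (rule sum_mono)
    fix j assume j: "j \<in> J"
    have 1: "norm (blaschke (z ` (J - {j})) v / blaschke (z ` (J - {j})) (z j)) \<le> 1 / d"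
      unfolding norm_divide using d(1) d(2)[OF j] z v
      by (intro frac_le norm_blaschke_le_1) auto
    have "disk_weight (z j) * (disk_weight (z j) / (norm (1 - cnj (z j) * v))\<^sup>2) \<le> x j"
      unfolding x_def using disk_weight_pos[OF z[OF j]] lt[of j]
      by (intro mult_left_mono divide_right_mono) (auto simp: disk_weight_def)
    then have 2: "norm (bump 2 (z j) v) \<le> x j"
      by (simp add: bump_def norm_divide norm_power norm_mult power2_eq_square)
    have "Re (jones_exponent J z j (z j) - jones_exponent J z j v)
        \<le> (2 - 4 * ln d) - (\<Sum>m\<in>farther J z j. x m)"
      using Re_jones_exponent_self_le[OF fin z inj j d(1) d(2)[OF j]]
      by (simp add: Re_jones_exponent[of J z j v] x_def)
    then have 3: "norm (exp (jones_exponent J z j (z j) - jones_exponent J z j v))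
        \<le> exp ((2 - 4 * ln d) - (\<Sum>m\<in>farther J z j. x m))"
      by simp
    have "norm (jones J z j v) \<le> 1 / d * x j * exp ((2 - 4 * ln d) - (\<Sum>m\<in>farther J z j. x m))"
      unfolding jones_def norm_mult[of _ "exp _"] norm_mult[of "_ / _"]
      using 1 2 3 d(1) x[OF j] by (intro mult_mono) auto
    then show "norm (jones J z j v) \<le> exp (2 - 4 * ln d) / d * (x j * exp (- (\<Sum>m\<in>farther J z j. x m)))"
      by (simp add: exp_diff exp_minus exp_add field_simps)
  qed
  also have "\<dots> = exp (2 - 4 * ln d) / d * (\<Sum>j\<in>J. x j * exp (- (\<Sum>m\<in>farther J z j. x m)))"
    by (rule sum_distrib_left[symmetric])
  also have "\<dots> \<le> exp (2 - 4 * ln d) / d * (1 - exp (- (\<Sum>j\<in>J. x j)))"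
    using d(1) by (intro mult_left_mono sum_exp_telescope fin x) auto
  also have "\<dots> \<le> exp (2 - 4 * ln d) / d * 1"
    using d(1) by (intro mult_left_mono) auto
  finally show ?thesis by simp
qed

text \<open>Carleson's separation condition, expressed by finite subproducts with a common lower
  bound instead of infinite Blaschke products.\<close>

definition uniformly_separated :: "real \<Rightarrow> (nat \<Rightarrow> complex) \<Rightarrow> bool" where
  "uniformly_separated d z \<longleftrightarrow> inj z \<and> range z \<subseteq> unit_disk \<and> 0 < d \<and>
     (\<forall>J j. finite J \<longrightarrow> j \<in> J \<longrightarrow> d \<le> norm (blaschke (z ` (J - {j})) (z j)))"

lemma uniformly_separated_jones:
  assumes "uniformly_separated d z" "finite J"
  shows "\<And>j. j \<in> J \<Longrightarrow> jones J z j holomorphic_on unit_disk"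
    and "\<And>i j. i \<in> J \<Longrightarrow> j \<in> J \<Longrightarrow> jones J z j (z i) = (if i = j then 1 else 0)"
    and "\<And>v. norm v < 1 \<Longrightarrow> (\<Sum>j\<in>J. norm (jones J z j v)) \<le> exp (2 - 4 * ln d) / d"
proof -
  have z: "norm (z j) < 1" for j using assms(1) by (auto simp: uniformly_separated_def image_subset_iff)
  have d: "0 < d" "\<And>j. j \<in> J \<Longrightarrow> d \<le> norm (blaschke (z ` (J - {j})) (z j))"
    and inj: "inj_on z J"
    using assms by (auto simp: uniformly_separated_def intro: inj_on_subset)
  have ne: "blaschke (z ` (J - {j})) (z j) \<noteq> 0" if "j \<in> J" for j using d(1) d(2)[OF that] by auto
  show "jones J z j holomorphic_on unit_disk" if "j \<in> J" for j
    by (rule jones_holomorphic[OF z that ne[OF that]])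
  show "jones J z j (z i) = (if i = j then 1 else 0)" if "i \<in> J" "j \<in> J" for i j
    by (rule jones_interpolates[OF assms(2) z that ne[OF that(2)]])
  show "(\<Sum>j\<in>J. norm (jones J z j v)) \<le> exp (2 - 4 * ln d) / d" if "norm v < 1" for v
    by (rule sum_norm_jones_le[OF assms(2) z inj d that])
qed

text \<open>Passes from interpolation at the first \<open>N\<close> points to the whole sequence.
  The bound \<open>B\<close> is an \<open>ereal\<close> so that one lemma covers bounded
  interpolation and, with \<open>B = \<infinity>\<close>, interpolation in the Hardy space.\<close>

lemma interpolation_limit:
  assumes p: "0 < p" and z: "range z \<subseteq> unit_disk"
    and f: "\<And>N::nat. hardy_ball p K (f N)" and fc: "\<And>N n. n < N \<Longrightarrow> f N (z n) = c n"
    and B: "\<And>N v. norm v < 1 \<Longrightarrow> ereal (norm (f N v)) \<le> B"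
  obtains g where "hardy_ball p K g" "\<And>n. g (z n) = c n" "\<And>v. norm v < 1 \<Longrightarrow> ereal (norm (g v)) \<le> B"
proof -
  obtain g s where s: "strict_mono (s :: nat \<Rightarrow> nat)" and g: "hardy_ball p K g"
    and lim: "\<And>v. norm v < 1 \<Longrightarrow> (\<lambda>k. f (s k) v) \<longlonglongrightarrow> g v"
    by (rule hardy_ball_Montel[of p K f, OF p f]) auto
  have "g (z n) = c n" for n
  proof (rule LIMSEQ_unique)
    show "(\<lambda>k. f (s k) (z n)) \<longlonglongrightarrow> g (z n)" using z by (intro lim) (auto simp: image_subset_iff)
    have "\<forall>\<^sub>F k in sequentially. f (s k) (z n) = c n"
      using eventually_gt_at_top[of n]
    proof eventually_elim
      case (elim k)
      then show ?case using seq_suble[OF s, of k] by (intro fc) simp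
    qed
    then show "(\<lambda>k. f (s k) (z n)) \<longlonglongrightarrow> c n" by (rule tendsto_eventually)
  qed
  moreover have "ereal (norm (g v)) \<le> B" if "norm v < 1" for v
  proof (rule LIMSEQ_le_const2)
    show "(\<lambda>k. ereal (norm (f (s k) v))) \<longlonglongrightarrow> ereal (norm (g v))"
      by (intro tendsto_intros lim that)
  qed (use B[OF that] in auto)
  ultimately show ?thesis using that g by blast
qed

lemma uniformly_separated_imp_interpolating_bounded:
  assumes z: "uniformly_separated d z" and c: "\<And>n. norm (c n) \<le> B"
  obtains g where "g holomorphic_on unit_disk" "\<And>n. g (z n) = c n"
    "\<And>v. norm v < 1 \<Longrightarrow> norm (g v) \<le> exp (2 - 4 * ln d) / d * B"
proof -
  define M where "M = exp (2 - 4 * ln d) / d"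
  note jones = uniformly_separated_jones[OF z, folded M_def]
  have B: "0 \<le> B" using c[of 0] norm_ge_zero order_trans by blast
  define f where "f = (\<lambda>N v. \<Sum>j<N. c j * jones {..<N} z j v)"
  have le: "norm (f N v) \<le> M * B" if "norm v < 1" for N v
  proof -
    have "norm (f N v) \<le> (\<Sum>j<N. norm (jones {..<N} z j v) * B)"
      unfolding f_def
    proof (rule sum_norm_le)
      fix j show "norm (c j * jones {..<N} z j v) \<le> norm (jones {..<N} z j v) * B"
        unfolding norm_mult mult.commute[of "norm (c j)"] by (intro mult_left_mono c) simp
    qed
    also have "\<dots> = (\<Sum>j<N. norm (jones {..<N} z j v)) * B" by (simp add: sum_distrib_right)
    also have "\<dots> \<le> M * B" using jones(3)[of "{..<N}" v] that B by (intro mult_right_mono) auto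
    finally show ?thesis .
  qed
  have "f N holomorphic_on unit_disk" for N
    unfolding f_def by (intro holomorphic_intros jones(1)) auto
  \<comment> \<open>The exponent 1 is a vehicle for the normal family argument; the uniform bound
    itself is carried through \<open>interpolation_limit\<close> separately.\<close>
  then have hb: "hardy_ball 1 (M * B) (f N)" for N
    using hardy_ball_bounded[of 1 "f N" "M * B"] le hardy_ball_nonneg[of 1 "(M * B) powr 1" "f N"]
      order_trans[OF norm_ge_zero le[of 0]] by auto
  have "f N (z n) = c n" if "n < N" for n N
  proof -
    have "f N (z n) = (\<Sum>j<N. c j * (if n = j then 1 else 0))"
      unfolding f_def using that by (intro sum.cong) (auto simp: jones(2))
    also have "\<dots> = c n" using that by (simp add: if_distrib cong: if_cong)
    finally show ?thesis .
  qed
  from interpolation_limit[of 1 z "M * B" f c "ereal (M * B)", OF _ _ hb this] le z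
  obtain g where g: "hardy_ball 1 (M * B) g" "\<And>n. g (z n) = c n" "\<And>v. norm v < 1 \<Longrightarrow> norm (g v) \<le> M * B"
    by (auto simp: uniformly_separated_def)
  show ?thesis by (rule that[OF hardy_ballD(1)[OF g(1)] g(2,3)[unfolded M_def]])
qed

text \<open>The sum is at most \<open>M\<close> times the largest \<open>y j\<close>, and the
  \<open>p\<close>-th power of the largest is one of the summands on the right. This replaces
  Hoelder's inequality and covers \<open>p < 1\<close>.\<close>

lemma weighted_sum_powr_le:
  fixes u y :: "'i \<Rightarrow> real"
  assumes fin: "finite J" and u: "\<And>j. j \<in> J \<Longrightarrow> 0 \<le> u j" and y: "\<And>j. j \<in> J \<Longrightarrow> 0 \<le> y j"
    and M: "(\<Sum>j\<in>J. u j) \<le> M" and p: "0 < p"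
  shows "(\<Sum>j\<in>J. u j * y j) powr p \<le> M powr p * (\<Sum>j\<in>J. y j powr p)"
proof (cases "J = {}")
  case False
  define Y where "Y = Max (y ` J)"
  have Y: "y j \<le> Y" if "j \<in> J" for j using that fin by (auto simp: Y_def)
  have "Y \<in> y ` J" unfolding Y_def using fin False by (intro Max_in) auto
  then obtain k where k: "k \<in> J" "y k = Y" by auto
  have M0: "0 \<le> M" using sum_nonneg[of J u] u M by force
  have Y0: "0 \<le> Y" using y k by auto
  have "(\<Sum>j\<in>J. u j * y j) \<le> (\<Sum>j\<in>J. u j * Y)"
    using Y u by (intro sum_mono mult_left_mono) auto
  also have "\<dots> = (\<Sum>j\<in>J. u j) * Y" by (simp add: sum_distrib_right)
  also have "\<dots> \<le> M * Y" using M Y0 by (rule mult_right_mono)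
  finally have "(\<Sum>j\<in>J. u j * y j) powr p \<le> (M * Y) powr p"
    using u y p by (intro powr_mono2 sum_nonneg) auto
  also have "\<dots> = M powr p * Y powr p" using M0 Y0 by (simp add: powr_mult)
  also have "\<dots> \<le> M powr p * (\<Sum>j\<in>J. y j powr p)"
    unfolding k(2)[symmetric] using fin k(1) by (intro mult_left_mono member_le_sum) auto
  finally show ?thesis by simp
qed simp

text \<open>Multiplying the Jones function of index \<open>j\<close> by a bump at \<open>z j\<close>
  keeps its values at the points. The moduli of the Jones functions sum to at most \<open>M\<close>,
  so the \<open>p\<close>-th power of the interpolant is bounded by \<open>M powr p\<close> times
  the sum of \<open>|c j|^p |bump|^p\<close>, and the \<open>j\<close>-th bump has Hardy mass of
  order \<open>disk_weight (z j)\<close>.\<close>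

lemma uniformly_separated_imp_interpolating_hardy:
  assumes z: "uniformly_separated d z" and p: "0 < p"
    and c: "summable (\<lambda>n. norm (c n) powr p * disk_weight (z n))"
  obtains g where "g \<in> hardy_space p" "\<And>n. g (z n) = c n"
proof -
  define M where "M = exp (2 - 4 * ln d) / d"
  note jones = uniformly_separated_jones[OF z, folded M_def]
  have z1: "norm (z n) < 1" for n using z by (auto simp: uniformly_separated_def image_subset_iff)
  obtain k :: nat where "2 / p \<le> real k" using real_arch_simple by blast
  then have k: "2 \<le> real k * p" using p by (simp add: field_simps)
  define D where "D = 2 powr (real k * p - 2)"
  define K where "K = M powr p * (D * (\<Sum>n. norm (c n) powr p * disk_weight (z n)))"
  define f where "f = (\<lambda>N v. \<Sum>j<N. jones {..<N} z j v * (c j * bump k (z j) v))"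
  have hol: "f N holomorphic_on unit_disk" for N
    unfolding f_def by (intro holomorphic_intros jones(1) bump_holomorphic z1) auto
  have hb: "hardy_ball p K (f N)" for N
    unfolding hardy_ball_def
  proof (intro conjI hol ballI)
    fix r :: real assume r: "r \<in> {0<..<1}"
    have pt: "norm (f N v) powr p \<le> M powr p * (\<Sum>j<N. norm (c j) powr p * norm (bump k (z j) v) powr p)"
      if "norm v < 1" for v
    proof -
      have "norm (f N v) \<le> (\<Sum>j<N. norm (jones {..<N} z j v) * norm (c j * bump k (z j) v))"
        unfolding f_def by (intro sum_norm_le) (auto simp: norm_mult)
      then have "norm (f N v) powr p \<le> (\<Sum>j<N. norm (jones {..<N} z j v) * norm (c j * bump k (z j) v)) powr p"
        using p by (intro powr_mono2) auto
      also have "\<dots> \<le> M powr p * (\<Sum>j<N. norm (c j * bump k (z j) v) powr p)"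
        using jones(3)[of "{..<N}" v] that p by (intro weighted_sum_powr_le) auto
      finally show ?thesis by (simp add: norm_mult powr_mult)
    qed
    have int: "integrable arc_measure (\<lambda>v. norm (bump k (z j) (of_real r * v)) powr p)" for j
      by (rule integrable_circle_mean[OF bump_holomorphic[OF z1] r p])
    have "hardy_mean p r (f N) \<le> (LINT v|arc_measure.
       M powr p * (\<Sum>j<N. norm (c j) powr p * norm (bump k (z j) (of_real r * v)) powr p))"
      unfolding hardy_mean_def
    proof (rule integral_mono)
      show "integrable arc_measure (\<lambda>v. norm (f N (of_real r * v)) powr p)"
        by (rule integrable_circle_mean[OF hol r p])
    qed (use int pt r in \<open>auto simp: norm_mult\<close>)
    also have "\<dots> = M powr p * (\<Sum>j<N. norm (c j) powr p * hardy_mean p r (bump k (z j)))"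
      unfolding hardy_mean_def using int by simp
    also have "\<dots> \<le> M powr p * (\<Sum>j<N. norm (c j) powr p * (D * disk_weight (z j)))"
      using hardy_ballD(2)[OF hardy_ball_bump[OF p z1 k]] r
      by (intro mult_left_mono sum_mono) (auto simp: D_def)
    also have "\<dots> = M powr p * (D * (\<Sum>j<N. norm (c j) powr p * disk_weight (z j)))"
      by (simp add: sum_distrib_left mult_ac)
    also have "\<dots> \<le> K"
      unfolding K_def
      by (intro mult_left_mono sum_le_suminf c) (auto simp: D_def disk_weight_pos z1 less_imp_le)
    finally show "hardy_mean p r (f N) \<le> K" .
  qed
  have "f N (z n) = c n" if "n < N" for n N
  proof -
    have "f N (z n) = (\<Sum>j<N. (if n = j then 1 else 0) * (c j * bump k (z j) (z n)))"
      unfolding f_def using that by (intro sum.cong) (auto simp: jones(2))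
    also have "\<dots> = c n" using that by (simp add: if_distrib[of "\<lambda>x. x * _"] bump_self z1 cong: if_cong)
    finally show ?thesis .
  qed
  from interpolation_limit[of p z K f c \<infinity>, OF p _ hb this] z
  obtain g where "hardy_ball p K g" "\<And>n. g (z n) = c n" by (auto simp: uniformly_separated_def)
  then show ?thesis using that hardy_space_iff[OF p] by blast
qed


section \<open>Baire category and the spaces \<open>L\<^sup>q\<close>\<close>

text \<open>Baire's theorem in the form required for open mapping arguments: some \<open>A n\<close>
  is dense in a ball about a point \<open>x\<close>, and subtracting approximants of
  \<open>x + h\<close> and \<open>x\<close> moves this to a ball about 0. \<open>D\<close> stands
  for a power of a quasinorm, or of a semi-quasinorm such as the mass in \<open>L^q\<close> on Hardy
  functions. The rate \<theta> lets completeness be checked on sequences that converge as fast as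
  desired.\<close>

lemma quasi_metric_Baire:
  fixes D :: "('i \<Rightarrow> complex) \<Rightarrow> real" and \<theta> :: "nat \<Rightarrow> real"
  assumes V0: "v \<in> V" and diff: "\<And>x y. x \<in> V \<Longrightarrow> y \<in> V \<Longrightarrow> (\<lambda>i. x i - y i) \<in> V"
    and D: "\<And>x. x \<in> V \<Longrightarrow> 0 \<le> D x" and D0: "D (\<lambda>_. 0) = 0"
    and Dsym: "\<And>x y. x \<in> V \<Longrightarrow> y \<in> V \<Longrightarrow> D (\<lambda>i. x i - y i) = D (\<lambda>i. y i - x i)"
    and c: "1 \<le> c" and Dtri: "\<And>x y. x \<in> V \<Longrightarrow> y \<in> V \<Longrightarrow> D (\<lambda>i. x i + y i) \<le> c * (D x + D y)"
    and \<theta>: "\<And>k. 0 < \<theta> k"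
    and complete: "\<And>x. (\<And>k. x k \<in> V) \<Longrightarrow> (\<And>k m. k \<le> m \<Longrightarrow> D (\<lambda>i. x m i - x k i) \<le> \<theta> k) \<Longrightarrow>
        \<exists>l\<in>V. (\<lambda>k. D (\<lambda>i. l i - x k i)) \<longlonglongrightarrow> 0"
    and A: "\<And>n::nat. A n \<subseteq> V" and cover: "\<And>x. x \<in> V \<Longrightarrow> \<exists>n. x \<in> A n"
  obtains n \<delta> where "0 < \<delta>" "\<And>h \<epsilon>. h \<in> V \<Longrightarrow> D h < \<delta> \<Longrightarrow> 0 < \<epsilon> \<Longrightarrow>
     \<exists>a\<in>A n. \<exists>a'\<in>A n. D (\<lambda>i. (a i - a' i) - h i) < \<epsilon>"
proof -
  have zero: "(\<lambda>_. 0) \<in> V" using diff[OF V0 V0] by simp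
  have add: "(\<lambda>i. x i + y i) \<in> V" if "x \<in> V" "y \<in> V" for x y
    using diff[OF that(1) diff[OF zero that(2)]] by simp
  have Dtri': "D (\<lambda>i. x i - z i) \<le> c * (D (\<lambda>i. x i - y i) + D (\<lambda>i. y i - z i))"
    if "x \<in> V" "y \<in> V" "z \<in> V" for x y z
    using Dtri[OF diff[OF that(1,2)] diff[OF that(2,3)]] by simp
  have "\<exists>n. \<exists>x\<in>V. \<exists>\<delta>>0. \<forall>y\<in>V. D (\<lambda>i. y i - x i) < \<delta> \<longrightarrow> (\<forall>\<epsilon>>0. \<exists>a\<in>A n. D (\<lambda>i. a i - y i) < \<epsilon>)"
  proof (rule ccontr)
    assume neg: "\<not> ?thesis"
    have far: "\<exists>y\<in>V. D (\<lambda>i. y i - x i) < \<delta> \<and> (\<exists>\<epsilon>>0. \<forall>a\<in>A n. \<epsilon> \<le> D (\<lambda>i. a i - y i))"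
      if "x \<in> V" "0 < \<delta>" for x \<delta> n
      using neg that by (meson not_less)
    define P where "P = (\<lambda>(k::nat) (u :: ('i \<Rightarrow> complex) \<times> real). fst u \<in> V \<and> 0 < snd u \<and> snd u \<le> \<theta> k)"
    \<comment> \<open>Nested balls with centres \<open>fst\<close> and radii \<open>snd\<close>.
      Dividing radii by \<open>4 * c\<close> absorbs the quasi-triangle constant: all later centres
      stay within half a radius, so the limit is within \<open>c * e / 2\<close> of the centre
      \<open>x (Suc n)\<close> of radius \<open>e\<close>, whereas \<open>A n\<close> keeps distance
      \<open>c * e\<close> from it.\<close>
    define Q where "Q = (\<lambda>k (u :: ('i \<Rightarrow> complex) \<times> real) u'. D (\<lambda>i. fst u' i - fst u i) \<le> snd u / (4 * c)
        \<and> snd u' \<le> snd u / (4 * c) \<and> (\<forall>a\<in>A k. c * snd u' \<le> D (\<lambda>i. a i - fst u' i)))"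
    have "\<exists>f. \<forall>k. P k (f k) \<and> Q k (f k) (f (Suc k))"
    proof (rule dependent_nat_choice)
      show "\<exists>u. P 0 u" using V0 \<theta>[of 0] by (intro exI[of _ "(v, \<theta> 0)"]) (simp add: P_def)
      fix u k assume u: "P k u"
      then have pos: "0 < snd u / (4 * c)" using c by (simp add: P_def)
      obtain y e where y: "y \<in> V" "D (\<lambda>i. y i - fst u i) < snd u / (4 * c)" and e: "0 < e"
        "\<And>a. a \<in> A k \<Longrightarrow> e \<le> D (\<lambda>i. a i - y i)"
        using far[OF _ pos, of "fst u" k] u by (auto simp: P_def)
      define e' where "e' = min (e / c) (min (snd u / (4 * c)) (\<theta> (Suc k)))"
      have "e' \<le> e / c" by (simp add: e'_def)
      then have "c * e' \<le> e" using c by (simp add: field_simps)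
      moreover have "0 < e'" using e(1) c pos \<theta>[of "Suc k"] by (simp add: e'_def)
      ultimately show "\<exists>u'. P (Suc k) u' \<and> Q k u u'"
        using y e(2) by (intro exI[of _ "(y, e')"]) (auto simp: P_def Q_def e'_def intro: order_trans)
    qed
    then obtain f where fP: "\<And>k. P k (f k)" and fQ: "\<And>k. Q k (f k) (f (Suc k))" by blast
    define x where "x = (\<lambda>k. fst (f k))"
    define e where "e = (\<lambda>k. snd (f k))"
    have xV: "x k \<in> V" and epos: "0 < e k" and e\<theta>: "e k \<le> \<theta> k" for k
      using fP[of k] by (auto simp: P_def x_def e_def)
    have step: "D (\<lambda>i. x (Suc k) i - x k i) \<le> e k / (4 * c)" and es: "e (Suc k) \<le> e k / (4 * c)"
      and avoid: "\<And>a. a \<in> A k \<Longrightarrow> c * e (Suc k) \<le> D (\<lambda>i. a i - x (Suc k) i)" for k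
      using fQ[of k] by (auto simp: Q_def x_def e_def)
    have near: "D (\<lambda>i. x (k + d) i - x k i) \<le> e k / 2" for k d
    proof (induction d arbitrary: k)
      case 0
      then show ?case using epos[of k] by (simp add: D0)
    next
      case (Suc d)
      have "D (\<lambda>i. x (k + Suc d) i - x k i)
          \<le> c * (D (\<lambda>i. x (k + Suc d) i - x (Suc k) i) + D (\<lambda>i. x (Suc k) i - x k i))"
        by (rule Dtri'[OF xV xV xV])
      also have "\<dots> \<le> c * (e (Suc k) / 2 + e k / (4 * c))"
        using Suc.IH[of "Suc k"] step[of k] c by (intro mult_left_mono add_mono) auto
      also have "\<dots> \<le> c * (e k / (4 * c) / 2 + e k / (4 * c))"
        using es[of k] c by (intro mult_left_mono add_mono divide_right_mono) auto
      also have "\<dots> \<le> e k / 2" using c epos[of k] by (simp add: field_simps)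
      finally show ?case .
    qed
    have "D (\<lambda>i. x m i - x k i) \<le> \<theta> k" if "k \<le> m" for k m
      using near[of k "m - k"] that epos[of k] e\<theta>[of k] by simp
    from complete[of x, OF xV this] obtain l where l: "l \<in> V" "(\<lambda>k. D (\<lambda>i. l i - x k i)) \<longlonglongrightarrow> 0" by blast
    obtain n where n: "l \<in> A n" using cover[OF l(1)] by blast
    have "D (\<lambda>i. l i - x (Suc n) i) \<le> c * (0 + e (Suc n) / 2)"
    proof (rule LIMSEQ_le_const)
      show "(\<lambda>k. c * (D (\<lambda>i. l i - x k i) + e (Suc n) / 2)) \<longlonglongrightarrow> c * (0 + e (Suc n) / 2)"
        by (intro tendsto_intros l)
      have "D (\<lambda>i. l i - x (Suc n) i) \<le> c * (D (\<lambda>i. l i - x k i) + e (Suc n) / 2)" if "Suc n \<le> k" for k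
      proof -
        have "D (\<lambda>i. l i - x (Suc n) i) \<le> c * (D (\<lambda>i. l i - x k i) + D (\<lambda>i. x k i - x (Suc n) i))"
          by (rule Dtri'[OF l(1) xV xV])
        also have "\<dots> \<le> c * (D (\<lambda>i. l i - x k i) + e (Suc n) / 2)"
          using near[of "Suc n" "k - Suc n"] that c by (intro mult_left_mono add_mono) auto
        finally show ?thesis .
      qed
      then show "\<exists>N. \<forall>k\<ge>N. D (\<lambda>i. l i - x (Suc n) i) \<le> c * (D (\<lambda>i. l i - x k i) + e (Suc n) / 2)" by blast
    qed
    then have "c * e (Suc n) \<le> c * (e (Suc n) / 2)" using avoid[OF n] by simp
    then show False using c epos[of "Suc n"] by (simp add: field_simps)
  qed
  then obtain n x \<delta> where x: "x \<in> V" and \<delta>: "0 < \<delta>"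
    and dense: "\<And>y \<epsilon>. y \<in> V \<Longrightarrow> D (\<lambda>i. y i - x i) < \<delta> \<Longrightarrow> 0 < \<epsilon> \<Longrightarrow> \<exists>a\<in>A n. D (\<lambda>i. a i - y i) < \<epsilon>"
    by blast
  show ?thesis
  proof (rule that[OF \<delta>])
    fix h :: "'i \<Rightarrow> complex" and \<epsilon> :: real assume h: "h \<in> V" "D h < \<delta>" "0 < \<epsilon>"
    define \<eta> where "\<eta> = \<epsilon> / (2 * c)"
    have \<eta>: "0 < \<eta>" using h c by (simp add: \<eta>_def)
    obtain a where a: "a \<in> A n" "D (\<lambda>i. a i - (x i + h i)) < \<eta>"
      using dense[OF add[OF x h(1)] _ \<eta>] h(2) by auto
    obtain a' where a': "a' \<in> A n" "D (\<lambda>i. a' i - x i) < \<eta>"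
      using dense[OF x _ \<eta>] D0 \<delta> by auto
    have V: "a \<in> V" "a' \<in> V" using a a' A by blast+
    have "D (\<lambda>i. (a i - a' i) - h i) = D (\<lambda>i. (a i - (x i + h i)) + (x i - a' i))"
      by (simp add: algebra_simps)
    also have "\<dots> \<le> c * (D (\<lambda>i. a i - (x i + h i)) + D (\<lambda>i. x i - a' i))"
      by (intro Dtri diff V add x h)
    also have "\<dots> < c * (\<eta> + \<eta>)"
      using a(2) a'(2) Dsym[OF V(2) x] c by (intro mult_strict_left_mono) auto
    also have "\<dots> = \<epsilon>" using c by (simp add: \<eta>_def)
    finally show "\<exists>a\<in>A n. \<exists>a'\<in>A n. D (\<lambda>i. (a i - a' i) - h i) < \<epsilon>" using a(1) a'(1) by blast
  qed
qed

section \<open>Quasi-triangle inequality, Fatou's lemma and completeness in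
  \<open>L^q\<close>\<close>

definition Lq_mass :: "real \<Rightarrow> complex measure \<Rightarrow> (complex \<Rightarrow> complex) \<Rightarrow> real" where
  "Lq_mass q M f = (LINT z|M. norm (f z) powr q)"

lemma Lq_mass_nonneg: "0 \<le> Lq_mass q M f"
  by (simp add: Lq_mass_def)

lemma Lq_fun_iff:
  "f \<in> Lq_fun q M \<longleftrightarrow> f \<in> borel_measurable M \<and> (\<integral>\<^sup>+z. ennreal (norm (f z) powr q) \<partial>M) < \<infinity>"
  unfolding Lq_fun_def by (auto simp: integrable_iff_bounded)

lemma nn_integral_Lq_mass:
  assumes "f \<in> Lq_fun q M"
  shows "(\<integral>\<^sup>+z. ennreal (norm (f z) powr q) \<partial>M) = ennreal (Lq_mass q M f)"
  using assms unfolding Lq_mass_def by (intro nn_integral_eq_integral) (auto simp: Lq_fun_def)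

lemma Lq_fun_add:
  assumes q: "0 < q" and f: "f \<in> Lq_fun q M" and g: "g \<in> Lq_fun q M"
  shows "(\<lambda>z. f z + g z) \<in> Lq_fun q M"
    and "Lq_mass q M (\<lambda>z. f z + g z) \<le> 2 powr q * (Lq_mass q M f + Lq_mass q M g)"
proof -
  have [measurable]: "f \<in> borel_measurable M" "g \<in> borel_measurable M" using f g by (auto simp: Lq_fun_def)
  have fi: "integrable M (\<lambda>z. norm (f z) powr q)" and gi: "integrable M (\<lambda>z. norm (g z) powr q)"
    using f g by (auto simp: Lq_fun_def)
  have int: "integrable M (\<lambda>z. 2 powr q * (norm (f z) powr q + norm (g z) powr q))"
    using fi gi by simp
  have "integrable M (\<lambda>z. norm (f z + g z) powr q)"
    by (rule Bochner_Integration.integrable_bound[OF int]) (auto intro!: norm_add_powr_le q)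
  then show "(\<lambda>z. f z + g z) \<in> Lq_fun q M" by (simp add: Lq_fun_def)
  have "Lq_mass q M (\<lambda>z. f z + g z) \<le> (LINT z|M. 2 powr q * (norm (f z) powr q + norm (g z) powr q))"
    unfolding Lq_mass_def by (intro integral_mono int norm_add_powr_le q) fact
  also have "\<dots> = 2 powr q * (Lq_mass q M f + Lq_mass q M g)"
    unfolding Lq_mass_def using fi gi by simp
  finally show "Lq_mass q M (\<lambda>z. f z + g z) \<le> 2 powr q * (Lq_mass q M f + Lq_mass q M g)" .
qed

lemma Lq_fun_cmult:
  assumes f: "f \<in> Lq_fun q M"
  shows "(\<lambda>z. c * f z) \<in> Lq_fun q M"
    and "Lq_mass q M (\<lambda>z. c * f z) = norm c powr q * Lq_mass q M f"
  using f by (auto simp: Lq_fun_def Lq_mass_def norm_mult powr_mult)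

lemma Lq_fun_diff:
  assumes q: "0 < q" and f: "f \<in> Lq_fun q M" and g: "g \<in> Lq_fun q M"
  shows "(\<lambda>z. f z - g z) \<in> Lq_fun q M"
  using Lq_fun_add(1)[OF q f Lq_fun_cmult(1)[OF g, of "-1"]] by simp

lemma Lq_norm_tendsto_0:
  assumes q: "0 < q"
  shows "(\<lambda>k. Lq_mass q M (f k)) \<longlonglongrightarrow> 0 \<Longrightarrow> (\<lambda>k. Lq_norm q M (f k)) \<longlonglongrightarrow> 0"
proof -
  assume "(\<lambda>k. Lq_mass q M (f k)) \<longlonglongrightarrow> 0"
  then have "(\<lambda>k. Lq_mass q M (f k) powr (1 / q)) \<longlonglongrightarrow> 0 powr (1 / q)"
    using q by (intro tendsto_powr' tendsto_const) (auto simp: Lq_mass_nonneg)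
  then show "(\<lambda>k. Lq_norm q M (f k)) \<longlonglongrightarrow> 0" by (simp add: Lq_norm_def Lq_mass_def)
qed

lemma Lq_mass_liminf:
  assumes q: "0 < q" and f: "\<And>k. f k \<in> Lq_fun q M"
    and lim: "AE z in M. (\<lambda>k::nat. f k z) \<longlonglongrightarrow> g z" and L: "\<forall>\<^sub>F k in sequentially. Lq_mass q M (f k) \<le> L"
  shows "(\<integral>\<^sup>+z. ennreal (norm (g z) powr q) \<partial>M) \<le> ennreal L"
proof -
  have [measurable]: "f k \<in> borel_measurable M" for k using f by (auto simp: Lq_fun_def)
  have "(\<integral>\<^sup>+z. ennreal (norm (g z) powr q) \<partial>M) = (\<integral>\<^sup>+z. liminf (\<lambda>k. ennreal (norm (f k z) powr q)) \<partial>M)"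
  proof (rule nn_integral_cong_AE)
    show "AE z in M. ennreal (norm (g z) powr q) = liminf (\<lambda>k. ennreal (norm (f k z) powr q))"
      using lim
    proof eventually_elim
      case (elim z)
      have "(\<lambda>k. ennreal (norm (f k z) powr q)) \<longlonglongrightarrow> ennreal (norm (g z) powr q)"
        using q by (intro tendsto_ennrealI tendsto_powr' tendsto_intros elim) auto
      then show ?case by (rule lim_imp_Liminf[OF trivial_limit_sequentially, symmetric])
    qed
  qed
  also have "\<dots> \<le> liminf (\<lambda>k. \<integral>\<^sup>+z. ennreal (norm (f k z) powr q) \<partial>M)"
    by (rule nn_integral_liminf) measurable
  also have "\<dots> \<le> ennreal L"
  proof (rule Liminf_le)
    show "\<forall>\<^sub>F k in sequentially. (\<integral>\<^sup>+z. ennreal (norm (f k z) powr q) \<partial>M) \<le> ennreal L"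
      using L by eventually_elim (simp add: nn_integral_Lq_mass[OF f] ennreal_leI)
  qed simp
  finally show ?thesis .
qed

lemma half_power_squeeze:
  fixes f :: "nat \<Rightarrow> real"
  assumes "\<And>k. 0 \<le> f k" "\<And>k. f k \<le> (1 / 2) ^ k"
  shows "f \<longlonglongrightarrow> 0"
proof (rule tendsto_sandwich[OF _ _ tendsto_const])
  show "(\<lambda>k. (1 / 2) ^ k :: real) \<longlonglongrightarrow> 0" by (rule LIMSEQ_power_zero) simp
qed (use assms in simp_all)

text \<open>The rate makes the increments summable almost everywhere without Minkowski's inequality:
  multiplied by \<open>2 powr (k * q)\<close>, their \<open>q\<close>-th powers have integrals at
  most \<open>(1 / 2) ^ k\<close>, so they have a finite sum \<open>G\<close> at almost every point,
  and there the increments are at most \<open>G powr (1 / q) * (1 / 2) ^ k\<close>. Fatou's lemma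
  then gives convergence in \<open>L^q\<close>.\<close>

lemma Lq_complete:
  fixes f :: "nat \<Rightarrow> complex \<Rightarrow> complex"
  assumes q: "0 < q" and f: "\<And>k. f k \<in> Lq_fun q M"
    and cauchy: "\<And>k m. k \<le> m \<Longrightarrow> Lq_mass q M (\<lambda>z. f m z - f k z) \<le> (1 / 2) ^ k * 2 powr (- (real k * q))"
  obtains F where "F \<in> Lq_fun q M" "(\<lambda>k. Lq_mass q M (\<lambda>z. F z - f k z)) \<longlonglongrightarrow> 0"
proof -
  have [measurable]: "f k \<in> borel_measurable M" for k using f by (auto simp: Lq_fun_def)
  define u where "u = (\<lambda>k z. 2 powr (real k * q) * norm (f (Suc k) z - f k z) powr q)"
  have [measurable]: "u k \<in> borel_measurable M" for k unfolding u_def by measurable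
  have u0: "0 \<le> u k z" for k z by (simp add: u_def)
  have iu: "(\<integral>\<^sup>+z. ennreal (u k z) \<partial>M) \<le> ennreal ((1 / 2) ^ k)" for k
  proof -
    have "(\<integral>\<^sup>+z. ennreal (u k z) \<partial>M) = ennreal (2 powr (real k * q)) * (\<integral>\<^sup>+z. ennreal (norm (f (Suc k) z - f k z) powr q) \<partial>M)"
      unfolding u_def by (simp add: ennreal_mult nn_integral_cmult)
    also have "\<dots> = ennreal (2 powr (real k * q) * Lq_mass q M (\<lambda>z. f (Suc k) z - f k z))"
      by (subst nn_integral_Lq_mass[OF Lq_fun_diff[OF q f f]]) (simp add: ennreal_mult Lq_mass_nonneg)
    also have "\<dots> \<le> ennreal (2 powr (real k * q) * ((1 / 2) ^ k * 2 powr (- (real k * q))))"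
      using cauchy[of k "Suc k"] by (intro ennreal_leI mult_left_mono) auto
    also have "2 powr (real k * q) * ((1 / 2) ^ k * 2 powr (- (real k * q))) = (1 / 2) ^ k"
      by (simp add: powr_minus field_simps)
    finally show ?thesis .
  qed
  have "(\<integral>\<^sup>+z. (\<Sum>k. ennreal (u k z)) \<partial>M) = (\<Sum>k. \<integral>\<^sup>+z. ennreal (u k z) \<partial>M)"
    by (rule nn_integral_suminf) measurable
  also have "\<dots> \<le> (\<Sum>k. ennreal ((1 / 2) ^ k))" by (intro suminf_le iu) auto
  also have "\<dots> = ennreal (\<Sum>k. (1 / 2) ^ k)" by (intro suminf_ennreal2) (auto intro: summable_geometric)
  also have "\<dots> < \<infinity>" by simp
  finally have "AE z in M. (\<Sum>k. ennreal (u k z)) \<noteq> \<infinity>"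
    by (intro nn_integral_PInf_AE) auto
  then have conv: "AE z in M. convergent (\<lambda>k. f k z)"
  proof eventually_elim
    case (elim z)
    have su: "summable (\<lambda>k. u k z)"
      using elim u0 by (intro summable_suminf_not_top) auto
    define G where "G = (\<Sum>k. u k z)"
    have le: "norm (f (Suc k) z - f k z) \<le> G powr (1 / q) * (1 / 2) ^ k" for k
    proof -
      have "u k z \<le> G" unfolding G_def
        using sum_le_suminf[OF su, of "{k}"] u0 by simp
      then have "u k z powr (1 / q) \<le> G powr (1 / q)" using q u0 by (intro powr_mono2) auto
      moreover have "u k z powr (1 / q) = 2 ^ k * norm (f (Suc k) z - f k z)"
        using q by (simp add: u_def powr_mult powr_powr powr_realpow)
      ultimately show ?thesis by (simp add: field_simps)
    qed
    have "summable (\<lambda>k. f (Suc k) z - f k z)"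
      by (rule summable_comparison_test'[OF summable_mult[OF summable_geometric]]) (use le in auto)
    then have "convergent (\<lambda>n. \<Sum>k<n. f (Suc k) z - f k z)"
      by (simp add: summable_iff_convergent)
    then have "convergent (\<lambda>n. f n z - f 0 z)"
      unfolding sum_lessThan_telescope[of "\<lambda>k. f k z"] .
    then show ?case by (simp add: convergent_diff_const_right_iff)
  qed
  define F where "F = (\<lambda>z. lim (\<lambda>k. f k z))"
  have [measurable]: "F \<in> borel_measurable M" unfolding F_def by measurable
  have lim: "AE z in M. (\<lambda>k. f k z) \<longlonglongrightarrow> F z"
    using conv by eventually_elim (simp add: F_def convergent_LIMSEQ_iff)
  have bound: "(\<integral>\<^sup>+z. ennreal (norm (F z - f k z) powr q) \<partial>M) \<le> ennreal ((1 / 2) ^ k * 2 powr (- (real k * q)))" for k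
  proof (rule Lq_mass_liminf[OF q Lq_fun_diff[OF q f f]])
    show "AE z in M. (\<lambda>m. f m z - f k z) \<longlonglongrightarrow> F z - f k z"
      using lim by eventually_elim (intro tendsto_intros)
    show "\<forall>\<^sub>F m in sequentially. Lq_mass q M (\<lambda>z. f m z - f k z) \<le> (1 / 2) ^ k * 2 powr (- (real k * q))"
      using eventually_ge_at_top[of k] by eventually_elim (rule cauchy)
  qed
  have Fd: "(\<lambda>z. F z - f k z) \<in> Lq_fun q M" for k
    unfolding Lq_fun_iff using bound[of k] by (auto intro: le_less_trans)
  have F: "F \<in> Lq_fun q M" using Lq_fun_add(1)[OF q Fd[of 0] f[of 0]] by simp
  have "(\<lambda>k. Lq_mass q M (\<lambda>z. F z - f k z)) \<longlonglongrightarrow> 0"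
  proof (rule half_power_squeeze)
    fix k
    have "ennreal (Lq_mass q M (\<lambda>z. F z - f k z)) \<le> ennreal ((1 / 2) ^ k * 2 powr (- (real k * q)))"
      using bound[of k] unfolding nn_integral_Lq_mass[OF Fd] .
    then have "Lq_mass q M (\<lambda>z. F z - f k z) \<le> (1 / 2) ^ k * 2 powr (- (real k * q))"
      by (simp add: ennreal_le_iff)
    also have "\<dots> \<le> (1 / 2) ^ k * 2 powr 0" using q by (intro mult_left_mono powr_mono) auto
    finally show "Lq_mass q M (\<lambda>z. F z - f k z) \<le> (1 / 2) ^ k" by simp
  qed (rule Lq_mass_nonneg)
  with F show ?thesis by (rule that)
qed


section \<open>Boundedness and openness of the embedding\<close>

lemma hardy_space_closed:
  assumes p: "0 < p" and f: "f \<in> hardy_space p" and g: "g \<in> hardy_space p"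
  shows "(\<lambda>z. f z + g z) \<in> hardy_space p" "(\<lambda>z. f z - g z) \<in> hardy_space p" "(\<lambda>z. c * f z) \<in> hardy_space p"
proof -
  obtain K L where "hardy_ball p K f" "hardy_ball p L g"
    using f g hardy_space_iff[OF p] by blast
  then show "(\<lambda>z. f z + g z) \<in> hardy_space p" "(\<lambda>z. f z - g z) \<in> hardy_space p" "(\<lambda>z. c * f z) \<in> hardy_space p"
    unfolding hardy_space_iff[OF p]
    by (auto intro: hardy_ball_add[OF p] hardy_ball_diff[OF p] hardy_ball_cmult[OF p])
qed

lemma carleson_measureD:
  assumes "carleson_measure p q M"
  shows "sets M = sets disk_borel" "space M = unit_disk" "\<And>f. f \<in> hardy_space p \<Longrightarrow> f \<in> Lq_fun q M"
proof -
  show sets: "sets M = sets disk_borel" and "\<And>f. f \<in> hardy_space p \<Longrightarrow> f \<in> Lq_fun q M"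
    using assms by (auto simp: carleson_measure_def borel_measure_on_disk_def)
  show "space M = unit_disk"
    using sets_eq_imp_space_eq[OF sets] by (simp add: space_restrict_space)
qed

lemma Lq_mass_diff_cong_AE:
  assumes q: "0 < q" and f: "f \<in> Lq_fun q M" and g: "g \<in> Lq_fun q M" and h: "h \<in> Lq_fun q M"
    and eq: "AE z in M. f z = g z"
  shows "Lq_mass q M (\<lambda>z. f z - h z) = Lq_mass q M (\<lambda>z. g z - h z)"
  unfolding Lq_mass_def
proof (rule integral_cong_AE)
  show "AE z in M. norm (f z - h z) powr q = norm (g z - h z) powr q"
    using eq by eventually_elim simp
qed (use Lq_fun_diff[OF q f h] Lq_fun_diff[OF q g h] in \<open>auto simp: Lq_fun_def\<close>)

lemma power_in_hardy_space:
  assumes p: "0 < p"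
  shows "(\<lambda>z. z ^ k) \<in> hardy_space p"
  unfolding hardy_space_iff[OF p]
  by (rule exI[of _ "1 powr p"], rule hardy_ball_bounded[OF p])
     (auto intro!: holomorphic_intros simp: norm_power power_le_one)

lemma zero_in_hardy_space: "0 < p \<Longrightarrow> (\<lambda>_. 0) \<in> hardy_space p"
  using hardy_space_closed(2)[OF _ power_in_hardy_space[of p 0] power_in_hardy_space[of p 0]] by simp

lemma Lq_mass_minus_commute: "Lq_mass q M (\<lambda>z. f z - g z) = Lq_mass q M (\<lambda>z. g z - f z)"
  by (simp add: Lq_mass_def norm_minus_commute)

lemma Lq_class_eq_iff:
  assumes "f \<in> Lq_fun q M" "g \<in> Lq_fun q M"
  shows "Lq_class q M f = Lq_class q M g \<longleftrightarrow> (AE z in M. f z = g z)"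
proof
  assume eq: "Lq_class q M f = Lq_class q M g"
  have "g \<in> Lq_class q M g" using assms by (simp add: Lq_class_def Lq_rel_def)
  then show "AE z in M. f z = g z" unfolding eq[symmetric] by (simp add: Lq_class_def Lq_rel_def)
next
  assume ae: "AE z in M. f z = g z"
  have "(AE z in M. f z = h z) \<longleftrightarrow> (AE z in M. g z = h z)" for h
  proof
    assume "AE z in M. f z = h z" with ae show "AE z in M. g z = h z" by eventually_elim simp
  next
    assume "AE z in M. g z = h z" with ae show "AE z in M. f z = h z" by eventually_elim simp
  qed
  then show "Lq_class q M f = Lq_class q M g"
    using assms by (auto simp: Lq_class_def Lq_rel_def)
qed

text \<open>Fatou's lemma bounds the mass of \<open>g - h\<close> by every positive number.\<close>

lemma Lq_limit_unique_AE:
  assumes q: "0 < q" and f: "\<And>k. f k \<in> Lq_fun q M" and g: "g \<in> Lq_fun q M" and h: "h \<in> Lq_fun q M"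
    and lim: "\<And>z. z \<in> space M \<Longrightarrow> (\<lambda>k::nat. f k z) \<longlonglongrightarrow> g z"
    and Lq: "(\<lambda>k. Lq_mass q M (\<lambda>z. f k z - h z)) \<longlonglongrightarrow> 0"
  shows "AE z in M. g z = h z"
proof -
  have [measurable]: "g \<in> borel_measurable M" "h \<in> borel_measurable M" using g h by (auto simp: Lq_fun_def)
  have small: "(\<integral>\<^sup>+z. ennreal (norm (g z - h z) powr q) \<partial>M) \<le> ennreal e" if e: "0 < e" for e
  proof (rule Lq_mass_liminf[OF q Lq_fun_diff[OF q f h]])
    show "AE z in M. (\<lambda>k. f k z - h z) \<longlonglongrightarrow> g z - h z"
      by (intro AE_I2 tendsto_intros lim)
    show "\<forall>\<^sub>F k in sequentially. Lq_mass q M (\<lambda>z. f k z - h z) \<le> e"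
      using order_tendstoD(2)[OF Lq e] by eventually_elim simp
  qed
  have "(\<integral>\<^sup>+z. ennreal (norm (g z - h z) powr q) \<partial>M) \<le> 0"
  proof (rule ennreal_le_epsilon)
    fix e :: real assume "0 < e"
    then show "(\<integral>\<^sup>+z. ennreal (norm (g z - h z) powr q) \<partial>M) \<le> 0 + ennreal e"
      using small by simp
  qed
  then have "(\<integral>\<^sup>+z. ennreal (norm (g z - h z) powr q) \<partial>M) = 0" by simp
  then have "AE z in M. ennreal (norm (g z - h z) powr q) = 0"
    by (subst (asm) nn_integral_0_iff_AE) auto
  then show ?thesis by eventually_elim (simp add: ennreal_eq_0_iff)
qed

lemma closed_range_limit:
  assumes p: "0 < p" and q: "0 < q" and carl: "carleson_measure p q M"
    and closed: "closedin (Lq_topology q M) (carleson_embedding q M ` hardy_space p)"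
    and f: "\<And>k. f k \<in> hardy_space p" and F: "F \<in> Lq_fun q M"
    and lim: "(\<lambda>k::nat. Lq_mass q M (\<lambda>z. F z - f k z)) \<longlonglongrightarrow> 0"
  obtains g where "g \<in> hardy_space p" "AE z in M. F z = g z"
proof -
  let ?R = "carleson_embedding q M ` hardy_space p"
  have "Lq_class q M F \<in> ?R"
  proof (rule ccontr)
    assume notin: "Lq_class q M F \<notin> ?R"
    have "Lq_class q M F \<in> Lq_space q M"
      using F by (auto simp: Lq_space_def Lq_class_def intro: quotientI)
    with notin have inU: "Lq_class q M F \<in> Lq_space q M - ?R" by blast
    have opn: "Lq_open q M (Lq_space q M - ?R)"
      using closed by (simp add: closedin_def topspace_Lq_topology openin_Lq_topology)
    obtain \<epsilon> where \<epsilon>: "0 < \<epsilon>" "\<And>g. g \<in> Lq_fun q M \<Longrightarrow> Lq_norm q M (\<lambda>z. g z - F z) < \<epsilon> \<Longrightarrow>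
        Lq_class q M g \<in> Lq_space q M - ?R"
      using opn[unfolded Lq_open_def, THEN conjunct2, rule_format, OF F inU] by blast
    have "(\<lambda>k. Lq_norm q M (\<lambda>z. f k z - F z)) \<longlonglongrightarrow> 0"
      using lim by (intro Lq_norm_tendsto_0[OF q]) (simp add: Lq_mass_minus_commute[of q M "f _"])
    then have "\<forall>\<^sub>F k in sequentially. Lq_norm q M (\<lambda>z. f k z - F z) < \<epsilon>"
      using \<epsilon>(1) by (rule order_tendstoD)
    then obtain k where "Lq_norm q M (\<lambda>z. f k z - F z) < \<epsilon>"
      using eventually_happens by force
    then have "Lq_class q M (f k) \<notin> ?R"
      using \<epsilon>(2)[OF carleson_measureD(3)[OF carl f]] by blast
    then show False using f[of k] by (simp add: carleson_embedding_def)
  qed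
  then obtain g where g: "g \<in> hardy_space p" "Lq_class q M F = Lq_class q M g"
    by (auto simp: carleson_embedding_def)
  then show ?thesis
    using Lq_class_eq_iff[OF F carleson_measureD(3)[OF carl g(1)]] that by blast
qed

lemma scale_to_half:
  assumes p: "0 < p" and \<delta>: "0 < \<delta>" and K: "0 < K"
  obtains t :: real where "0 < t" "t powr p * K = \<delta> / 2" "\<And>s. (1 / t) powr s = (2 / \<delta>) powr (s / p) * K powr (s / p)"
proof
  define t where "t = (\<delta> / (2 * K)) powr (1 / p)"
  show "0 < t" using \<delta> K by (simp add: t_def)
  show "t powr p * K = \<delta> / 2" using p \<delta> K by (simp add: t_def powr_powr)
  have "1 / t = (2 * K / \<delta>) powr (1 / p)"
    using \<delta> K by (simp add: t_def powr_divide)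
  then show "(1 / t) powr s = (2 / \<delta>) powr (s / p) * K powr (s / p)" for s
    using \<delta> K by (simp add: powr_powr powr_divide powr_mult)
qed

text \<open>Closed range makes the Hardy space complete for the mass of \<open>L^q\<close>, so the
  Baire lemma applies to the sets \<open>A n\<close> of functions having a representative of Hardy
  mass at most \<open>n\<close>. A function \<open>h\<close> of small mass is approximated by
  differences, all in the single Hardy ball of size \<open>L\<close>; a normal family limit lies in
  that ball and equals \<open>h\<close> almost everywhere. No successive approximation series is
  formed, and scaling treats general \<open>h\<close>.\<close>

lemma closed_range_open_mapping:
  assumes p: "0 < p" and q: "0 < q" and carl: "carleson_measure p q M"
    and closed: "closedin (Lq_topology q M) (carleson_embedding q M ` hardy_space p)"
  obtains C where "0 \<le> C" "\<And>h. h \<in> hardy_space p \<Longrightarrow>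
    \<exists>G. hardy_ball p (C * Lq_mass q M h powr (p / q)) G \<and> (AE z in M. G z = h z)"
proof -
  note Lq = carleson_measureD(3)[OF carl]
  define A where "A = (\<lambda>n::nat. {x \<in> hardy_space p. \<exists>g. hardy_ball p (real n) g \<and> (AE z in M. g z = x z)})"
  obtain n \<delta> where \<delta>: "0 < \<delta>" and n: "\<And>h \<epsilon>. h \<in> hardy_space p \<Longrightarrow> Lq_mass q M h < \<delta> \<Longrightarrow> 0 < \<epsilon> \<Longrightarrow>
     \<exists>a\<in>A n. \<exists>a'\<in>A n. Lq_mass q M (\<lambda>i. (a i - a' i) - h i) < \<epsilon>"
  proof (rule quasi_metric_Baire[where V="hardy_space p" and D="Lq_mass q M" and c="2 powr q" and A=A
        and v="\<lambda>_. 0" and \<theta>="\<lambda>k. (1 / 2) ^ k * 2 powr (- (real k * q))"])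
    show "(\<lambda>_. 0) \<in> hardy_space p" by (rule zero_in_hardy_space[OF p])
    show "Lq_mass q M (\<lambda>_. 0) = 0" by (simp add: Lq_mass_def)
    show "1 \<le> 2 powr q" using q by (simp add: ge_one_powr_ge_zero)
    show "Lq_mass q M (\<lambda>i. x i + y i) \<le> 2 powr q * (Lq_mass q M x + Lq_mass q M y)"
      if "x \<in> hardy_space p" "y \<in> hardy_space p" for x y
      using Lq_fun_add(2)[OF q Lq Lq] that by blast
    show "\<exists>l\<in>hardy_space p. (\<lambda>k. Lq_mass q M (\<lambda>i. l i - x k i)) \<longlonglongrightarrow> 0"
      if x: "\<And>k. x k \<in> hardy_space p"
        and c: "\<And>k m. k \<le> m \<Longrightarrow> Lq_mass q M (\<lambda>i. x m i - x k i) \<le> (1 / 2) ^ k * 2 powr (- (real k * q))" for x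
    proof -
      obtain F where F: "F \<in> Lq_fun q M" "(\<lambda>k. Lq_mass q M (\<lambda>z. F z - x k z)) \<longlonglongrightarrow> 0"
        using Lq_complete[OF q Lq[OF x] c] by blast
      obtain g where g: "g \<in> hardy_space p" "AE z in M. F z = g z"
        using closed_range_limit[OF p q carl closed x F] by blast
      have "Lq_mass q M (\<lambda>z. F z - x k z) = Lq_mass q M (\<lambda>z. g z - x k z)" for k
        by (rule Lq_mass_diff_cong_AE[OF q F(1) Lq[OF g(1)] Lq[OF x] g(2)])
      then show ?thesis using g(1) F(2) by (intro bexI[of _ g]) auto
    qed
    show "Lq_mass q M (\<lambda>i. x i - y i) = Lq_mass q M (\<lambda>i. y i - x i)" for x y
      by (rule Lq_mass_minus_commute)
    show "A n \<subseteq> hardy_space p" for n by (auto simp: A_def)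
    show "\<exists>n. x \<in> A n" if x: "x \<in> hardy_space p" for x
    proof -
      obtain K where K: "hardy_ball p K x" using x hardy_space_iff[OF p] by blast
      obtain n where "K \<le> real n" using real_arch_simple by blast
      then have "hardy_ball p (real n) x" using hardy_ball_mono[OF K] by blast
      then show ?thesis using x by (intro exI[of _ n]) (auto simp: A_def)
    qed
  qed (auto simp: Lq_mass_nonneg hardy_space_closed[OF p])
  define L where "L = 2 powr p * (real n + real n)"
  have small: "\<exists>G. hardy_ball p L G \<and> (AE z in M. G z = h z)"
    if h: "h \<in> hardy_space p" "Lq_mass q M h < \<delta>" for h
  proof -
    have "\<exists>G. hardy_ball p L G \<and> Lq_mass q M (\<lambda>z. G z - h z) < (1 / 2) ^ k" for k :: nat
    proof -
      obtain a a' where a: "a \<in> A n" "a' \<in> A n" "Lq_mass q M (\<lambda>i. (a i - a' i) - h i) < (1 / 2) ^ k"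
        using n[OF h, of "(1 / 2) ^ k"] by auto
      obtain g g' where g: "hardy_ball p n g" "AE z in M. g z = a z" and g': "hardy_ball p n g'" "AE z in M. g' z = a' z"
        and aH: "a \<in> hardy_space p" "a' \<in> hardy_space p"
        using a by (auto simp: A_def)
      have gH: "g \<in> hardy_space p" "g' \<in> hardy_space p" using g g' hardy_space_iff[OF p] by blast+
      have "Lq_mass q M (\<lambda>z. (g z - g' z) - h z) = Lq_mass q M (\<lambda>z. (a z - a' z) - h z)"
      proof (rule Lq_mass_diff_cong_AE[OF q _ _ Lq[OF h(1)]])
        show "AE z in M. g z - g' z = a z - a' z" using g(2) g'(2) by eventually_elim simp
      qed (use Lq hardy_space_closed(2)[OF p] gH aH in auto)
      then show ?thesis
        using hardy_ball_diff[OF p g(1) g'(1)] a(3) unfolding L_def by (intro exI[of _ "\<lambda>z. g z - g' z"]) auto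
    qed
    then obtain G where G: "\<And>k. hardy_ball p L (G k)" "\<And>k. Lq_mass q M (\<lambda>z. G k z - h z) < (1 / 2) ^ k" by metis
    have GL: "G k \<in> Lq_fun q M" for k using G(1) hardy_space_iff[OF p] Lq by blast
    obtain g s where s: "strict_mono (s :: nat \<Rightarrow> nat)" and g: "hardy_ball p L g"
      and lim: "\<And>z. norm z < 1 \<Longrightarrow> (\<lambda>k. G (s k) z) \<longlonglongrightarrow> g z"
      by (rule hardy_ball_Montel[of p L G, OF p G(1)]) auto
    have "AE z in M. g z = h z"
    proof (rule Lq_limit_unique_AE[OF q, of "\<lambda>k. G (s k)"])
      show "g \<in> Lq_fun q M" using g hardy_space_iff[OF p] Lq by blast
      have "(\<lambda>k. Lq_mass q M (\<lambda>z. G k z - h z)) \<longlonglongrightarrow> 0"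
        by (rule half_power_squeeze[OF Lq_mass_nonneg less_imp_le[OF G(2)]])
      from LIMSEQ_subseq_LIMSEQ[OF this s]
      show "(\<lambda>k. Lq_mass q M (\<lambda>z. G (s k) z - h z)) \<longlonglongrightarrow> 0" by (simp add: o_def)
    qed (use lim GL Lq h(1) carleson_measureD(2)[OF carl] in auto)
    then show ?thesis using g by blast
  qed
  define C where "C = (2 / \<delta>) powr (p / q) * L"
  have "\<exists>G. hardy_ball p (C * Lq_mass q M h powr (p / q)) G \<and> (AE z in M. G z = h z)" if h: "h \<in> hardy_space p" for h
  \<comment> \<open>A function of mass 0 cannot be scaled to mass \<open>\<delta> / 2\<close>; it
    vanishes almost everywhere and the zero function represents it.\<close>
  proof (cases "Lq_mass q M h = 0")
    case True
    have "integrable M (\<lambda>z. norm (h z) powr q)" using Lq[OF h] by (simp add: Lq_fun_def)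
    then have "AE z in M. norm (h z) powr q = 0"
      using True integral_nonneg_eq_0_iff_AE[of M "\<lambda>z. norm (h z) powr q"] by (simp add: Lq_mass_def)
    then have "AE z in M. 0 = h z" by eventually_elim auto
    moreover have "hardy_ball p 0 (\<lambda>_. 0)"
      using hardy_ball_bounded[OF p, of "\<lambda>_. 0" 0] p by simp
    ultimately show ?thesis using True q by (intro exI[of _ "\<lambda>_. 0"]) auto
  next
    case False
    then have pos: "0 < Lq_mass q M h" using Lq_mass_nonneg[of q M h] by linarith
    obtain t where t: "0 < t" "t powr q * Lq_mass q M h = \<delta> / 2"
      "\<And>s. (1 / t) powr s = (2 / \<delta>) powr (s / q) * Lq_mass q M h powr (s / q)"
      using scale_to_half[OF q \<delta> pos] by blast
    have "Lq_mass q M (\<lambda>z. of_real t * h z) < \<delta>"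
      using Lq_fun_cmult(2)[OF Lq[OF h], of "of_real t"] t(1,2) \<delta> by simp
    with small[OF hardy_space_closed(3)[OF p h h]] obtain G where G: "hardy_ball p L G"
      "AE z in M. G z = of_real t * h z" by blast
    have "hardy_ball p (norm (complex_of_real (1 / t)) powr p * L) (\<lambda>z. of_real (1 / t) * G z)"
      by (rule hardy_ball_cmult[OF p G(1)])
    then have "hardy_ball p (C * Lq_mass q M h powr (p / q)) (\<lambda>z. of_real (1 / t) * G z)"
      unfolding norm_of_real using t(1) by (simp add: t(3)[simplified] C_def mult_ac)
    moreover have "AE z in M. of_real (1 / t) * G z = h z"
      using G(2) by eventually_elim (use t(1) in simp)
    ultimately show ?thesis by (intro exI[of _ "\<lambda>z. of_real (1 / t) * G z"] conjI)
  qed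
  moreover have "0 \<le> C" by (simp add: C_def L_def)
  ultimately show ?thesis using that by blast
qed

text \<open>A supremum in the reals, hence meaningful only where the means are bounded, that is, on
  \<open>hardy_space p\<close>.\<close>

definition hardy_mass :: "real \<Rightarrow> (complex \<Rightarrow> complex) \<Rightarrow> real" where
  "hardy_mass p f = (SUP r\<in>{0<..<1}. hardy_mean p r f)"

lemma hardy_mass_le: "hardy_ball p K f \<Longrightarrow> hardy_mass p f \<le> K"
  unfolding hardy_mass_def by (rule cSUP_least) (auto dest: hardy_ballD(2))

lemma hardy_ball_hardy_mass:
  assumes p: "0 < p" and f: "f \<in> hardy_space p"
  shows "hardy_ball p (hardy_mass p f) f"
proof -
  obtain K where K: "hardy_ball p K f" using f hardy_space_iff[OF p] by blast
  then have "bdd_above ((\<lambda>r. hardy_mean p r f) ` {0<..<1})"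
    by (intro bdd_aboveI[of _ K]) (auto dest: hardy_ballD(2))
  then show ?thesis
    using hardy_ballD(1)[OF K] by (auto simp: hardy_ball_def hardy_mass_def intro: cSUP_upper)
qed

lemma hardy_mass_nonneg: "0 < p \<Longrightarrow> f \<in> hardy_space p \<Longrightarrow> 0 \<le> hardy_mass p f"
  using hardy_ball_hardy_mass hardy_ball_nonneg by blast

lemma hardy_space_complete:
  assumes p: "0 < p" and x: "\<And>k::nat. x k \<in> hardy_space p"
    and cauchy: "\<And>k m. k \<le> m \<Longrightarrow> hardy_mass p (\<lambda>i. x m i - x k i) \<le> (1 / 2) ^ k"
  obtains l where "l \<in> hardy_space p" "(\<lambda>k. hardy_mass p (\<lambda>i. l i - x k i)) \<longlonglongrightarrow> 0"
proof -
  have d: "hardy_ball p ((1 / 2) ^ k) (\<lambda>i. x m i - x k i)" if "k \<le> m" for k m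
    by (rule hardy_ball_mono[OF hardy_ball_hardy_mass[OF p hardy_space_closed(2)[OF p x x]] cauchy[OF that]])
  define K where "K = 2 powr p * (1 + hardy_mass p (x 0))"
  have hK: "hardy_ball p K (x m)" for m
    using hardy_ball_add[OF p d[of 0 m] hardy_ball_hardy_mass[OF p x[of 0]]] by (simp add: K_def)
  obtain l s where s: "strict_mono (s :: nat \<Rightarrow> nat)" and l: "hardy_ball p K l"
    and lim: "\<And>z. norm z < 1 \<Longrightarrow> (\<lambda>k. x (s k) z) \<longlonglongrightarrow> l z"
    by (rule hardy_ball_Montel[of p K x, OF p hK]) auto
  have le: "hardy_ball p ((1 / 2) ^ k) (\<lambda>i. l i - x k i)" for k
  proof -
    \<comment> \<open>The shift by \<open>k\<close> guarantees that the index
      \<open>s (m + k)\<close> is at least \<open>k\<close>, as the Cauchy bound demands.\<close>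
    have hk: "hardy_ball p ((1 / 2) ^ k) (\<lambda>i. x (s (m + k)) i - x k i)" for m
      using seq_suble[OF s, of "m + k"] by (intro d) simp
    obtain g t where t: "strict_mono (t :: nat \<Rightarrow> nat)" and g: "hardy_ball p ((1 / 2) ^ k) g"
      and glim: "\<And>z. norm z < 1 \<Longrightarrow> (\<lambda>m. x (s (t m + k)) z - x k z) \<longlonglongrightarrow> g z"
      by (rule hardy_ball_Montel[of p "(1 / 2) ^ k" "\<lambda>m i. x (s (m + k)) i - x k i", OF p hk]) auto
    have "g z = l z - x k z" if z: "norm z < 1" for z
    proof (rule LIMSEQ_unique[OF glim[OF z]])
      have "(\<lambda>m. x (s (m + k)) z - x k z) \<longlonglongrightarrow> l z - x k z"
        by (intro tendsto_intros LIMSEQ_ignore_initial_segment[OF lim[OF z]])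
      from LIMSEQ_subseq_LIMSEQ[OF this t]
      show "(\<lambda>m. x (s (t m + k)) z - x k z) \<longlonglongrightarrow> l z - x k z" by (simp add: o_def)
    qed
    then show ?thesis by (rule hardy_ball_cong[OF g p])
  qed
  have lH: "l \<in> hardy_space p" using l hardy_space_iff[OF p] by blast
  have "(\<lambda>k. hardy_mass p (\<lambda>i. l i - x k i)) \<longlonglongrightarrow> 0"
    by (rule half_power_squeeze[OF hardy_mass_nonneg[OF p hardy_space_closed(2)[OF p lH x]] hardy_mass_le[OF le]])
  with lH show ?thesis by (rule that)
qed

text \<open>Plays the part of the closed graph theorem. The Baire lemma is now applied in the Hardy
  quasi-metric, to the sets of functions with bounded mass in \<open>L^q\<close>. Approximants in
  the Hardy space converge pointwise by point evaluation, so Fatou's lemma transfers their bound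
  \<open>L\<close> to the limit.\<close>

lemma carleson_embedding_bounded:
  assumes p: "0 < p" and q: "0 < q" and carl: "carleson_measure p q M"
  obtains C where "0 \<le> C" "\<And>K f. hardy_ball p K f \<Longrightarrow> Lq_mass q M f \<le> C * K powr (q / p)"
proof -
  note Lq = carleson_measureD(3)[OF carl]
  define A where "A = (\<lambda>n::nat. {x \<in> hardy_space p. Lq_mass q M x \<le> real n})"
  obtain n \<delta> where \<delta>: "0 < \<delta>" and n: "\<And>h \<epsilon>. h \<in> hardy_space p \<Longrightarrow> hardy_mass p h < \<delta> \<Longrightarrow> 0 < \<epsilon> \<Longrightarrow>
     \<exists>a\<in>A n. \<exists>a'\<in>A n. hardy_mass p (\<lambda>i. (a i - a' i) - h i) < \<epsilon>"
  proof (rule quasi_metric_Baire[where V="hardy_space p" and D="hardy_mass p" and c="2 powr p" and A=A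
        and v="\<lambda>_. 0" and \<theta>="\<lambda>k. (1 / 2) ^ k"])
    show "(\<lambda>_. 0) \<in> hardy_space p" by (rule zero_in_hardy_space[OF p])
    show "hardy_mass p (\<lambda>_. 0) = 0" by (simp add: hardy_mass_def hardy_mean_def)
    show "1 \<le> 2 powr p" using p by (simp add: ge_one_powr_ge_zero)
    show "hardy_mass p (\<lambda>i. x i - y i) = hardy_mass p (\<lambda>i. y i - x i)" for x y
      by (simp add: hardy_mass_def hardy_mean_def norm_minus_commute)
    show "hardy_mass p (\<lambda>i. x i + y i) \<le> 2 powr p * (hardy_mass p x + hardy_mass p y)"
      if "x \<in> hardy_space p" "y \<in> hardy_space p" for x y
      by (intro hardy_mass_le hardy_ball_add p hardy_ball_hardy_mass that)
    show "\<exists>l\<in>hardy_space p. (\<lambda>k. hardy_mass p (\<lambda>i. l i - x k i)) \<longlonglongrightarrow> 0"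
      if "\<And>k. x k \<in> hardy_space p"
        and "\<And>k m. k \<le> m \<Longrightarrow> hardy_mass p (\<lambda>i. x m i - x k i) \<le> (1 / 2) ^ k" for x
      by (rule hardy_space_complete[OF p, of x]) (use that in auto)
    show "A n \<subseteq> hardy_space p" for n by (auto simp: A_def)
    show "\<exists>n. x \<in> A n" if "x \<in> hardy_space p" for x
      using that real_arch_simple[of "Lq_mass q M x"] by (auto simp: A_def)
  qed (auto simp: hardy_mass_nonneg[OF p] hardy_space_closed[OF p])
  define L where "L = 2 powr q * (real n + real n)"
  have small: "Lq_mass q M h \<le> L" if h: "h \<in> hardy_space p" "hardy_mass p h < \<delta>" for h
  proof -
    have "\<exists>G. G \<in> hardy_space p \<and> Lq_mass q M G \<le> L \<and> hardy_mass p (\<lambda>z. G z - h z) < (1 / 2) ^ k" for k :: nat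
    proof -
      obtain a a' where a: "a \<in> A n" "a' \<in> A n" "hardy_mass p (\<lambda>i. (a i - a' i) - h i) < (1 / 2) ^ k"
        using n[OF h, of "(1 / 2) ^ k"] by auto
      then have aH: "a \<in> hardy_space p" "a' \<in> hardy_space p" and aL: "Lq_mass q M a \<le> n" "Lq_mass q M a' \<le> n"
        by (auto simp: A_def)
      have "Lq_mass q M (\<lambda>z. a z - a' z) \<le> 2 powr q * (Lq_mass q M a + Lq_mass q M a')"
        using Lq_fun_add(2)[OF q Lq[OF aH(1)] Lq_fun_cmult(1)[OF Lq[OF aH(2)], of "-1"]]
          Lq_fun_cmult(2)[OF Lq[OF aH(2)], of "-1"] by simp
      also have "\<dots> \<le> L" unfolding L_def using aL by (intro mult_left_mono add_mono) auto
      finally show ?thesis using a(3) hardy_space_closed(2)[OF p aH] by blast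
    qed
    then obtain G where G: "\<And>k. G k \<in> hardy_space p" "\<And>k. Lq_mass q M (G k) \<le> L"
      "\<And>k. hardy_mass p (\<lambda>z. G k z - h z) < (1 / 2) ^ k" by metis
    have lim: "(\<lambda>k. G k z) \<longlonglongrightarrow> h z" if z: "norm z < 1" for z
    proof -
      define w where "w = disk_weight z"
      have w: "0 < w" using z by (simp add: w_def disk_weight_pos)
      have le: "norm (G k z - h z) powr p \<le> (1 / 2) ^ k / w" for k
      proof -
        have "w * norm (G k z - h z) powr p \<le> hardy_mass p (\<lambda>z. G k z - h z)"
          unfolding w_def by (rule point_bound_hardy_ball[OF p z hardy_ball_hardy_mass[OF p hardy_space_closed(2)[OF p G(1) h(1)]]])
        also have "\<dots> \<le> (1 / 2) ^ k" using G(3)[of k] by simp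
        finally show ?thesis using w by (simp add: field_simps)
      qed
      have "(\<lambda>k. norm (G k z - h z) powr p) \<longlonglongrightarrow> 0"
      proof (rule tendsto_sandwich[OF _ _ tendsto_const])
        show "\<forall>\<^sub>F k in sequentially. norm (G k z - h z) powr p \<le> (1 / 2) ^ k / w"
          by (intro always_eventually allI le)
        show "(\<lambda>k. (1 / 2) ^ k / w) \<longlonglongrightarrow> 0"
          by (rule tendsto_divide_zero) (rule LIMSEQ_power_zero, simp)
      qed simp
      then have "(\<lambda>k. (norm (G k z - h z) powr p) powr (1 / p)) \<longlonglongrightarrow> 0 powr (1 / p)"
        using p by (intro tendsto_powr' tendsto_const) auto
      then have "(\<lambda>k. G k z - h z) \<longlonglongrightarrow> 0" using p by (simp add: powr_powr tendsto_norm_zero_iff)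
      then show ?thesis by (rule LIM_zero_cancel)
    qed
    have "(\<integral>\<^sup>+z. ennreal (norm (h z) powr q) \<partial>M) \<le> ennreal L"
      by (rule Lq_mass_liminf[OF q, of G])
         (use G Lq lim carleson_measureD(2)[OF carl] in \<open>auto intro!: AE_I2\<close>)
    then have "ennreal (Lq_mass q M h) \<le> ennreal L" by (simp add: nn_integral_Lq_mass[OF Lq[OF h(1)]])
    then show ?thesis by (simp add: ennreal_le_iff L_def)
  qed
  define C where "C = (2 / \<delta>) powr (q / p) * L"
  have "Lq_mass q M f \<le> C * K powr (q / p)" if f: "hardy_ball p K f" for f K
  proof (cases "K = 0")
    case True
    have "f z = 0" if z: "norm z < 1" for z
    proof -
      have "disk_weight z * norm (f z) powr p \<le> 0"
        using point_bound_hardy_ball[OF p z f] True by simp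
      then have "norm (f z) powr p \<le> 0" using disk_weight_pos[OF z] by (simp add: mult_le_0_iff)
      then have "norm (f z) powr p = 0" by (intro antisym) auto
      then show ?thesis by simp
    qed
    then have "Lq_mass q M f = (LINT z|M. 0)"
      unfolding Lq_mass_def using carleson_measureD(2)[OF carl] by (intro Bochner_Integration.integral_cong) auto
    then show ?thesis using True by simp
  next
    case False
    then have pos: "0 < K" using hardy_ball_nonneg[OF f] by linarith
    have fH: "f \<in> hardy_space p" using f hardy_space_iff[OF p] by blast
    obtain t where t: "0 < t" "t powr p * K = \<delta> / 2" "\<And>s. (1 / t) powr s = (2 / \<delta>) powr (s / p) * K powr (s / p)"
      using scale_to_half[OF p \<delta> pos] by blast
    have "hardy_ball p (\<delta> / 2) (\<lambda>z. of_real t * f z)"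
      using hardy_ball_cmult[OF p f, of "of_real t"] t(1,2) by simp
    then have "hardy_mass p (\<lambda>z. of_real t * f z) < \<delta>" using hardy_mass_le \<delta> by fastforce
    from small[OF hardy_space_closed(3)[OF p fH fH] this]
    have "t powr q * Lq_mass q M f \<le> L"
      using Lq_fun_cmult(2)[OF Lq[OF fH], of "of_real t"] t(1) by simp
    then have "(1 / t) powr q * (t powr q * Lq_mass q M f) \<le> (1 / t) powr q * L"
      by (rule mult_left_mono) simp
    moreover have "(1 / t) powr q * (t powr q * Lq_mass q M f) = Lq_mass q M f"
      using t(1) by (simp add: powr_divide)
    ultimately have "Lq_mass q M f \<le> (1 / t) powr q * L" by simp
    also have "\<dots> = C * K powr (q / p)" unfolding t(3) C_def by (simp add: mult_ac)
    finally show ?thesis .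
  qed
  moreover have "0 \<le> C" by (simp add: C_def L_def)
  ultimately show ?thesis using that by blast
qed


section \<open>Sums of point masses and interpolating sequences\<close>

text \<open>The measure is the image under \<open>z\<close> of the measure on the naturals with
  density \<open>a\<close>, so the change of variables formula reduces integrals to series.\<close>

lemma nn_integral_point_mass_sum:
  assumes pm: "is_point_mass_sum \<mu> a z" and z: "range z \<subseteq> unit_disk" and u: "u \<in> borel_measurable \<mu>"
  shows "(\<integral>\<^sup>+x. u x \<partial>\<mu>) = (\<Sum>n. ennreal (a n) * u (z n))"
proof -
  define \<nu> where "\<nu> = density (count_space UNIV) (\<lambda>n. ennreal (a n))"
  have zm: "z \<in> measurable \<nu> disk_borel"
    using z by (auto simp: \<nu>_def measurable_def space_restrict_space)
  have sets: "sets \<mu> = sets disk_borel" using pm by (simp add: is_point_mass_sum_def)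
  have eq: "\<mu> = distr \<nu> disk_borel z"
  proof (rule measure_eqI)
    fix A assume "A \<in> sets \<mu>"
    then have A: "A \<in> sets disk_borel" by (simp add: sets)
    have "emeasure \<mu> A = (\<Sum>n. ennreal (a n) * indicator A (z n))"
      using pm A by (simp add: is_point_mass_sum_def)
    also have "\<dots> = (\<Sum>n. ennreal (a n) * indicator (z -` A) n)"
      by (simp add: indicator_def)
    also have "\<dots> = emeasure \<nu> (z -` A)"
      by (simp add: \<nu>_def emeasure_density nn_integral_count_space_nat)
    also have "\<dots> = emeasure (distr \<nu> disk_borel z) A"
      using zm A by (simp add: emeasure_distr) (simp add: \<nu>_def)
    finally show "emeasure \<mu> A = emeasure (distr \<nu> disk_borel z) A" .
  qed (simp add: sets)
  have u': "u \<in> borel_measurable disk_borel"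
    using u by (subst (asm) measurable_cong_sets[OF sets refl])
  have "(\<integral>\<^sup>+x. u x \<partial>\<mu>) = (\<integral>\<^sup>+n. u (z n) \<partial>\<nu>)"
    by (subst eq) (rule nn_integral_distr[OF zm], use u' in simp)
  also have "\<dots> = (\<Sum>n. ennreal (a n) * u (z n))"
    by (simp add: \<nu>_def nn_integral_density nn_integral_count_space_nat)
  finally show ?thesis .
qed

lemma Lq_mass_point_mass_sum:
  assumes pm: "is_point_mass_sum \<mu> a z" and z: "range z \<subseteq> unit_disk" and a: "\<And>n. 0 < a n"
    and f: "f \<in> Lq_fun q \<mu>"
  shows "(\<lambda>n. a n * norm (f (z n)) powr q) sums Lq_mass q \<mu> f"
proof -
  have [measurable]: "f \<in> borel_measurable \<mu>" using f by (simp add: Lq_fun_def)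
  have eq: "(\<Sum>n. ennreal (a n * norm (f (z n)) powr q)) = ennreal (Lq_mass q \<mu> f)"
    using nn_integral_point_mass_sum[OF pm z, of "\<lambda>z. ennreal (norm (f z) powr q)"]
    by (simp add: nn_integral_Lq_mass[OF f] ennreal_mult a less_imp_le)
  have "summable (\<lambda>n. a n * norm (f (z n)) powr q)"
    by (rule summable_suminf_not_top) (use a in \<open>auto simp: eq less_imp_le\<close>)
  then show ?thesis
    using eq a by (subst (asm) suminf_ennreal2) (auto simp: less_imp_le suminf_nonneg Lq_mass_nonneg summable_sums_iff)
qed

lemma AE_point_mass_sum:
  assumes pm: "is_point_mass_sum \<mu> a z" and z: "range z \<subseteq> unit_disk" and a: "\<And>n. 0 < a n"
    and f: "f \<in> borel_measurable \<mu>" "g \<in> borel_measurable \<mu>"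
  shows "(AE x in \<mu>. f x = (g x :: complex)) \<longleftrightarrow> (\<forall>n. f (z n) = g (z n))"
proof -
  define u where "u = (\<lambda>x. if f x = g x then 0 else 1 :: ennreal)"
  have u: "u \<in> borel_measurable \<mu>" unfolding u_def using f by measurable
  have "(AE x in \<mu>. f x = g x) \<longleftrightarrow> (AE x in \<mu>. u x = 0)" by (simp add: u_def)
  also have "\<dots> \<longleftrightarrow> (\<integral>\<^sup>+x. u x \<partial>\<mu>) = 0" by (rule nn_integral_0_iff_AE[OF u, symmetric])
  also have "\<dots> \<longleftrightarrow> (\<forall>n. ennreal (a n) * u (z n) = 0)"
    unfolding nn_integral_point_mass_sum[OF pm z u] by (subst suminf_eq_zero_iff) auto
  also have "\<dots> \<longleftrightarrow> (\<forall>n. f (z n) = g (z n))"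
    using a by (auto simp: u_def ennreal_eq_0_iff not_le[symmetric])
  finally show ?thesis .
qed

lemma comparable_iff:
  assumes z: "\<And>n. norm (z n) < 1"
  shows "comparable_to_boundary_distance a z \<longleftrightarrow>
    (\<exists>c>0. \<exists>C. \<forall>n. c * (1 - norm (z n)) \<le> a n \<and> a n \<le> C * (1 - norm (z n)))"
proof
  assume cmp: "comparable_to_boundary_distance a z"
  then have inf: "0 < (INF n. ereal (a n / (1 - norm (z n))))" and sup: "(SUP n. ereal (a n / (1 - norm (z n)))) < \<infinity>"
    by (auto simp: comparable_to_boundary_distance_def)
  obtain c where c: "0 < ereal c" "ereal c < (INF n. ereal (a n / (1 - norm (z n))))"
    using ereal_dense2[OF inf] by auto
  obtain C where C: "(SUP n. ereal (a n / (1 - norm (z n)))) < ereal C"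
    using ereal_dense2[OF sup] by auto
  have "c * (1 - norm (z n)) \<le> a n \<and> a n \<le> C * (1 - norm (z n))" for n
  proof -
    have "ereal c < ereal (a n / (1 - norm (z n)))"
      using c(2) by (rule less_le_trans) (rule INF_lower, simp)
    moreover have "ereal (a n / (1 - norm (z n))) < ereal C"
      using C by (rule le_less_trans[rotated]) (rule SUP_upper, simp)
    ultimately show ?thesis using z[of n] by (simp add: field_simps)
  qed
  then show "\<exists>c>0. \<exists>C. \<forall>n. c * (1 - norm (z n)) \<le> a n \<and> a n \<le> C * (1 - norm (z n))"
    using c(1) by auto
next
  assume "\<exists>c>0. \<exists>C. \<forall>n. c * (1 - norm (z n)) \<le> a n \<and> a n \<le> C * (1 - norm (z n))"
  then obtain c C where c: "0 < c" and b: "\<And>n. c * (1 - norm (z n)) \<le> a n" "\<And>n. a n \<le> C * (1 - norm (z n))" by blast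
  have "ereal c \<le> (INF n. ereal (a n / (1 - norm (z n))))"
    by (rule INF_greatest) (use b(1) z in \<open>simp add: field_simps\<close>)
  moreover have "(SUP n. ereal (a n / (1 - norm (z n)))) \<le> ereal C"
    by (rule SUP_least) (use b(2) z in \<open>simp add: field_simps\<close>)
  ultimately show "comparable_to_boundary_distance a z"
    unfolding comparable_to_boundary_distance_def
    using c less_le_trans[of 0 "ereal c"] le_less_trans[of _ "ereal C" \<infinity>] by auto
qed

lemma disk_weight_bounds:
  assumes "norm a < 1"
  shows "1 - norm a \<le> disk_weight a" "disk_weight a \<le> 2 * (1 - norm a)"
proof -
  have "disk_weight a = (1 - norm a) * (1 + norm a)"
    by (simp add: disk_weight_def power2_eq_square algebra_simps)
  moreover have "(1 - norm a) * 1 \<le> (1 - norm a) * (1 + norm a)" "(1 - norm a) * (1 + norm a) \<le> (1 - norm a) * 2"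
    using assms by (intro mult_left_mono; simp)+
  ultimately show "1 - norm a \<le> disk_weight a" "disk_weight a \<le> 2 * (1 - norm a)" by simp_all
qed

section \<open>Interpolating sequences are uniformly separated\<close>

lemma sup_norm_bounds:
  fixes c :: "nat \<Rightarrow> complex"
  assumes "bounded (range c)"
  shows "norm (c n) \<le> (SUP n. norm (c n))"
proof (rule cSUP_upper)
  obtain B where "\<And>n. norm (c n) \<le> B" using assms by (auto simp: bounded_iff)
  then show "bdd_above (range (\<lambda>n. norm (c n)))" by (intro bdd_aboveI[of _ B]) auto
qed simp

abbreviation bounded_interpolant ::
    "(nat \<Rightarrow> complex) \<Rightarrow> real \<Rightarrow> (nat \<Rightarrow> complex) \<Rightarrow> (complex \<Rightarrow> complex) \<Rightarrow> bool" where
  "bounded_interpolant z B c f \<equiv> f holomorphic_on unit_disk \<and>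
     (\<forall>v. norm v < 1 \<longrightarrow> norm (f v) \<le> B) \<and> (\<forall>n. f (z n) = c n)"

text \<open>The open mapping theorem for the restriction map onto bounded sequences, obtained from
  the Baire lemma with the supremum norm and specialised to unit vectors. Normal families again turn
  approximate interpolation with a uniform bound into exact interpolation.\<close>

lemma interpolating_sequence_bounded_basis:
  assumes z: "interpolating_sequence z"
  obtains M where "\<And>m. \<exists>f. bounded_interpolant z M (\<lambda>n. if n = m then 1 else 0) f"
proof -
  define V where "V = {c :: nat \<Rightarrow> complex. bounded (range c)}"
  define D where "D = (\<lambda>c :: nat \<Rightarrow> complex. SUP n. norm (c n))"
  define A where "A = (\<lambda>N::nat. {c \<in> V. \<exists>f. bounded_interpolant z (real N) c f})"
  have Dup: "norm (c n) \<le> D c" if "c \<in> V" for c n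
    using sup_norm_bounds[of c] that by (simp add: V_def D_def)
  have Dle: "D c \<le> B" if "\<And>n. norm (c n) \<le> B" for c B
    unfolding D_def by (rule cSUP_least) (use that in auto)
  have VI: "c \<in> V" if "\<And>n. norm (c n) \<le> B" for c B
    using that by (auto simp: V_def bounded_iff)
  have zd: "norm (z n) < 1" for n using z by (auto simp: interpolating_sequence_def image_subset_iff)
  obtain N d where d: "0 < d" and N: "\<And>h \<epsilon>. h \<in> V \<Longrightarrow> D h < d \<Longrightarrow> 0 < \<epsilon> \<Longrightarrow>
     \<exists>a\<in>A N. \<exists>a'\<in>A N. D (\<lambda>i. (a i - a' i) - h i) < \<epsilon>"
  proof (rule quasi_metric_Baire[where V=V and D=D and c=1 and A=A and v="\<lambda>_. 0" and \<theta>="\<lambda>k. (1 / 2) ^ k"])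
    show "(\<lambda>_. 0) \<in> V" by (rule VI[of _ 0]) simp
    show "(\<lambda>i. x i - y i) \<in> V" if "x \<in> V" "y \<in> V" for x y
      by (rule VI[of _ "D x + D y"]) (use Dup[OF that(1)] Dup[OF that(2)] in \<open>meson norm_triangle_ineq4 add_mono order_trans\<close>)
    show "0 \<le> D x" if "x \<in> V" for x using Dup[OF that, of 0] norm_ge_zero order_trans by blast
    show "D (\<lambda>i. x i - y i) = D (\<lambda>i. y i - x i)" for x y by (simp add: D_def norm_minus_commute)
    show "D (\<lambda>i. x i + y i) \<le> 1 * (D x + D y)" if "x \<in> V" "y \<in> V" for x y
      by (rule Dle) (use Dup[OF that(1)] Dup[OF that(2)] in \<open>simp, meson norm_triangle_ineq add_mono order_trans\<close>)
    show "\<exists>l\<in>V. (\<lambda>k. D (\<lambda>i. l i - x k i)) \<longlonglongrightarrow> 0"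
      if x: "\<And>k. x k \<in> V" and c: "\<And>k m. k \<le> m \<Longrightarrow> D (\<lambda>i. x m i - x k i) \<le> (1 / 2) ^ k" for x :: "nat \<Rightarrow> nat \<Rightarrow> complex"
    proof -
      have dV: "(\<lambda>i. x m i - x k i) \<in> V" for m k
        by (rule VI[of _ "D (x m) + D (x k)"]) (use Dup[OF x] in \<open>meson norm_triangle_ineq4 add_mono order_trans\<close>)
      have pt: "norm (x m n - x k n) \<le> (1 / 2) ^ k" if "k \<le> m" for k m n
        using Dup[OF dV, of m n k] c[OF that] by linarith
      have "convergent (\<lambda>m. x m n)" for n
      proof (rule Cauchy_convergent, rule metric_CauchyI)
        fix e :: real assume e: "0 < e"
        obtain M where M: "(1 / 2 :: real) ^ M < e / 2" using real_arch_pow_inv[of "e / 2" "1 / 2"] e by auto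
        have "dist (x m n) (x m' n) < e" if "M \<le> m" "M \<le> m'" for m m'
        proof -
          have "dist (x m n) (x m' n) \<le> dist (x m n) (x M n) + dist (x m' n) (x M n)" by (rule dist_triangle2)
          also have "\<dots> < e" using pt[OF that(1), of n] pt[OF that(2), of n] M by (simp add: dist_norm)
          finally show ?thesis .
        qed
        then show "\<exists>M. \<forall>m\<ge>M. \<forall>n'\<ge>M. dist (x m n) (x n' n) < e" by blast
      qed
      then obtain l where l: "\<And>n. (\<lambda>m. x m n) \<longlonglongrightarrow> l n" unfolding convergent_def by metis
      have le: "norm (l n - x k n) \<le> (1 / 2) ^ k" for n k
      proof (rule LIMSEQ_le_const2)
        show "(\<lambda>m. norm (x m n - x k n)) \<longlonglongrightarrow> norm (l n - x k n)" by (intro tendsto_intros l)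
        show "\<exists>N. \<forall>m\<ge>N. norm (x m n - x k n) \<le> (1 / 2) ^ k" using pt by blast
      qed
      have "norm (l n) \<le> 1 + D (x 0)" for n
        using le[of n 0] Dup[OF x, of 0 n] norm_triangle_sub[of "l n" "x 0 n"] by simp
      then have "l \<in> V" by (rule VI)
      moreover have "(\<lambda>k. D (\<lambda>i. l i - x k i)) \<longlonglongrightarrow> 0"
      proof (rule half_power_squeeze)
        show "D (\<lambda>i. l i - x k i) \<le> (1 / 2) ^ k" for k by (rule Dle[OF le])
        have "(\<lambda>i. l i - x k i) \<in> V" for k by (rule VI[OF le])
        then show "0 \<le> D (\<lambda>i. l i - x k i)" for k
          using Dup norm_ge_zero order_trans by blast
      qed
      ultimately show ?thesis by blast
    qed
    show "A n \<subseteq> V" for n by (auto simp: A_def)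
    show "\<exists>n. x \<in> A n" if x: "x \<in> V" for x
    proof -
      have "x \<in> {(\<lambda>n. f (z n)) | f. f \<in> hardy_infinity}"
        using z x by (simp add: interpolating_sequence_def V_def)
      then obtain f where f: "f \<in> hardy_infinity" "x = (\<lambda>n. f (z n))" by blast
      then obtain B where "\<forall>v\<in>unit_disk. norm (f v) \<le> B"
        by (auto simp: hardy_infinity_def bounded_iff)
      then have B: "norm (f v) \<le> B" if "norm v < 1" for v using that by simp
      obtain n where "B \<le> real n" using real_arch_simple by blast
      then have "norm (f v) \<le> real n" if "norm v < 1" for v using B[OF that] by linarith
      then show ?thesis using f x by (intro exI[of _ n]) (auto simp: A_def hardy_infinity_def)
    qed
  qed (auto simp: D_def)
  \<comment> \<open>\<open>2 / d\<close> undoes the scaling of the unit vector to norm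
    \<open>d / 2\<close>, and \<open>2 * real N\<close> bounds a difference of two functions bounded
    by \<open>N\<close>.\<close>
  define M where "M = 2 / d * (2 * real N)"
  have "\<exists>f. bounded_interpolant z M (\<lambda>n. if n = m then 1 else 0) f" for m
  proof -
    define h where "h = (\<lambda>n. if n = m then complex_of_real (d / 2) else 0)"
    have hle: "norm (h n) \<le> d / 2" for n using d by (simp add: h_def)
    have hV: "h \<in> V" "D h < d" using VI[of h, OF hle] Dle[of h, OF hle] d by auto
    have "\<exists>g. g holomorphic_on unit_disk \<and> (\<forall>v. norm v < 1 \<longrightarrow> norm (g v) \<le> 2 * real N)
        \<and> (\<forall>n. norm (g (z n) - h n) \<le> (1 / 2) ^ k)" for k :: nat
    proof -
      obtain a a' where a: "a \<in> A N" "a' \<in> A N" "D (\<lambda>i. (a i - a' i) - h i) < (1 / 2) ^ k"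
        using N[OF hV, of "(1 / 2) ^ k"] by auto
      obtain f f' where f: "f holomorphic_on unit_disk" "\<And>v. norm v < 1 \<Longrightarrow> norm (f v) \<le> real N" "\<And>n. f (z n) = a n"
        and f': "f' holomorphic_on unit_disk" "\<And>v. norm v < 1 \<Longrightarrow> norm (f' v) \<le> real N" "\<And>n. f' (z n) = a' n"
        and aV: "a \<in> V" "a' \<in> V"
        using a(1,2) by (auto simp: A_def)
      have ff: "norm (f v - f' v) \<le> 2 * real N" if "norm v < 1" for v
        using f(2)[OF that] f'(2)[OF that] norm_triangle_ineq4[of "f v" "f' v"] by linarith
      \<comment> \<open>This crude bound puts the error in \<open>V\<close>, where \<open>D\<close>
        dominates every coordinate.\<close>
      have "norm ((a n - a' n) - h n) \<le> 2 * real N + d / 2" for n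
        using ff[OF zd[of n]] hle[of n] norm_triangle_ineq4[of "a n - a' n" "h n"] by (simp add: f(3) f'(3))
      from Dup[OF VI[of "\<lambda>n. (a n - a' n) - h n", OF this]]
      have "norm ((a n - a' n) - h n) \<le> (1 / 2) ^ k" for n using a(3) by (meson less_imp_le order_trans)
      then show ?thesis
        using ff by (intro exI[of _ "\<lambda>v. f v - f' v"]) (auto intro!: holomorphic_intros f f' simp: f(3) f'(3))
    qed
    then obtain g where g: "\<And>k. g k holomorphic_on unit_disk" "\<And>k v. norm v < 1 \<Longrightarrow> norm (g k v) \<le> 2 * real N"
      "\<And>k n. norm (g k (z n) - h n) \<le> (1 / 2) ^ k" by metis
    have hb: "hardy_ball 1 ((2 * real N) powr 1) (g k)" for k
      by (rule hardy_ball_bounded) (use g in auto)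
    obtain G s where s: "strict_mono (s :: nat \<Rightarrow> nat)" and G: "hardy_ball 1 ((2 * real N) powr 1) G"
      and lim: "\<And>v. norm v < 1 \<Longrightarrow> (\<lambda>k. g (s k) v) \<longlonglongrightarrow> G v"
      by (rule hardy_ball_Montel[of 1 _ g, OF _ hb]) auto
    have Gle: "norm (G v) \<le> 2 * real N" if "norm v < 1" for v
      by (rule LIMSEQ_le_const2[OF tendsto_norm[OF lim[OF that]]]) (use g(2) that in blast)
    have Gz: "G (z n) = h n" for n
    proof (rule LIMSEQ_unique)
      show "(\<lambda>k. g (s k) (z n)) \<longlonglongrightarrow> G (z n)" by (rule lim[OF zd])
      have "(\<lambda>k. g k (z n) - h n) \<longlonglongrightarrow> 0"
        by (rule tendsto_norm_zero_cancel, rule half_power_squeeze[OF norm_ge_zero g(3)])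
      then have "(\<lambda>k. g k (z n)) \<longlonglongrightarrow> h n" by (rule LIM_zero_cancel)
      from LIMSEQ_subseq_LIMSEQ[OF this s] show "(\<lambda>k. g (s k) (z n)) \<longlonglongrightarrow> h n" by (simp add: o_def)
    qed
    show ?thesis
    proof (intro exI[of _ "\<lambda>v. of_real (2 / d) * G v"] conjI allI impI)
      show "(\<lambda>v. of_real (2 / d) * G v) holomorphic_on unit_disk"
        by (intro holomorphic_intros hardy_ballD(1)[OF G])
      show "norm (of_real (2 / d) * G v) \<le> M" if "norm v < 1" for v
        using Gle[OF that] d unfolding norm_mult norm_of_real M_def by (intro mult_mono) auto
      show "of_real (2 / d) * G (z n) = (if n = m then 1 else 0)" for n
        using d by (simp add: Gz h_def)
    qed
  qed
  then show ?thesis by (rule that)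
qed

text \<open>A function bounded by \<open>M\<close> with the values of a unit vector becomes,
  multiplied by the squared bump at \<open>z j\<close>, a member of \<open>H^1\<close> of mass at
  most \<open>M * disk_weight (z j)\<close> with the same values. Division by the Blaschke product
  then gives the separation constant \<open>1 / M\<close>.\<close>

lemma interpolating_imp_uniformly_separated:
  assumes z: "interpolating_sequence z"
  obtains d where "uniformly_separated d z"
proof -
  have inj: "inj z" and zr: "range z \<subseteq> unit_disk" using z by (auto simp: interpolating_sequence_def)
  then have zd: "norm (z n) < 1" for n by (auto simp: image_subset_iff)
  obtain M where M: "\<And>m. \<exists>f. bounded_interpolant z M (\<lambda>n. if n = m then 1 else 0) f"
    using interpolating_sequence_bounded_basis[OF z] by blast
  have M1: "1 \<le> M"
  proof -
    obtain f :: "complex \<Rightarrow> complex" where "\<forall>v. norm v < 1 \<longrightarrow> norm (f v) \<le> M" "f (z 0) = 1" using M[of 0] by auto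
    then have "norm (f (z 0)) \<le> M" using zd by blast
    then show ?thesis using \<open>f (z 0) = 1\<close> by simp
  qed
  have "1 / M \<le> norm (blaschke (z ` (J - {j})) (z j))" if J: "finite J" "j \<in> J" for J j
  proof -
    obtain f where f: "f holomorphic_on unit_disk" "\<And>v. norm v < 1 \<Longrightarrow> norm (f v) \<le> M"
      "\<And>n. f (z n) = (if n = j then 1 else 0)" using M[of j] by blast
    have "hardy_ball 1 (M powr 1 * (2 powr (real 2 * 1 - 2) * disk_weight (z j))) (\<lambda>v. f v * bump 2 (z j) v)"
    proof (rule hardy_ball_dominated[OF _ hardy_ball_bump[OF _ zd]])
      show "(\<lambda>v. f v * bump 2 (z j) v) holomorphic_on unit_disk"
        by (intro holomorphic_intros f bump_holomorphic zd)
      show "norm (f v * bump 2 (z j) v) \<le> M * norm (bump 2 (z j) v)" if "norm v < 1" for v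
        using f(2)[OF that] by (simp add: norm_mult mult_right_mono)
    qed (use M1 in auto)
    then have hb: "hardy_ball 1 (M * disk_weight (z j)) (\<lambda>v. f v * bump 2 (z j) v)" using M1 by simp
    have "1 \<le> M powr (1 / 1) * norm (blaschke (z ` (J - {j})) (z j))"
      by (rule blaschke_lower_bound[OF _ hb zd]) (use J zd f(3) in \<open>auto simp: bump_self\<close>)
    then show ?thesis using M1 by (simp add: field_simps)
  qed
  then have "uniformly_separated (1 / M) z"
    using M1 inj zr by (auto simp: uniformly_separated_def)
  then show ?thesis by (rule that)
qed

lemma interpolating_imp_closed_range:
  assumes p: "0 < p" and carl: "carleson_measure p p \<mu>" and z: "interpolating_sequence z" and a: "\<And>n. 0 < a n"
    and cmp: "comparable_to_boundary_distance a z" and pm: "is_point_mass_sum \<mu> a z"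
  shows "closedin (Lq_topology p \<mu>) (carleson_embedding p \<mu> ` hardy_space p)"
proof -
  have zr: "range z \<subseteq> unit_disk" using z by (auto simp: interpolating_sequence_def)
  then have zd: "norm (z n) < 1" for n by (auto simp: image_subset_iff)
  obtain c where c: "0 < c" "\<And>n. c * (1 - norm (z n)) \<le> a n"
    using cmp comparable_iff[of z a, OF zd] by auto
  have w: "disk_weight (z n) \<le> 2 / c * a n" for n
    using mult_left_mono[OF disk_weight_bounds(2)[OF zd[of n]], of c] c(2)[of n] c(1)
    by (simp add: field_simps)
  obtain d where d: "uniformly_separated d z" by (rule interpolating_imp_uniformly_separated[OF z])
  note Lq = carleson_measureD(3)[OF carl]
  have "\<exists>g\<in>hardy_space p. AE x in \<mu>. F x = g x" if F: "F \<in> Lq_fun p \<mu>" for F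
  proof -
    have "summable (\<lambda>n. norm (F (z n)) powr p * disk_weight (z n))"
    proof (rule summable_comparison_test'[OF summable_mult[OF sums_summable[OF Lq_mass_point_mass_sum[OF pm zr a F]]]])
      show "norm (norm (F (z n)) powr p * disk_weight (z n)) \<le> 2 / c * (a n * norm (F (z n)) powr p)" for n
        using mult_left_mono[OF w[of n], of "norm (F (z n)) powr p"] disk_weight_pos[OF zd[of n]]
        by (simp add: mult_ac)
    qed
    from uniformly_separated_imp_interpolating_hardy[OF d p this]
    obtain g where g: "g \<in> hardy_space p" "\<And>n. g (z n) = F (z n)" by blast
    have "AE x in \<mu>. F x = g x"
      by (subst AE_point_mass_sum[OF pm zr a]) (use g F Lq[OF g(1)] in \<open>auto simp: Lq_fun_def\<close>)
    with g(1) show ?thesis by blast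
  qed
  then have "Lq_class p \<mu> F \<in> carleson_embedding p \<mu> ` hardy_space p" if "F \<in> Lq_fun p \<mu>" for F
    using that Lq_class_eq_iff[OF that Lq] by (auto simp: carleson_embedding_def image_iff) 
  moreover have "carleson_embedding p \<mu> f \<in> Lq_space p \<mu>" if "f \<in> hardy_space p" for f
    using Lq[OF that] by (auto simp: carleson_embedding_def Lq_space_def Lq_class_def intro: quotientI)
  ultimately have "carleson_embedding p \<mu> ` hardy_space p = topspace (Lq_topology p \<mu>)"
    unfolding topspace_Lq_topology by (auto simp: Lq_space_def Lq_class_def quotient_def)
  then show ?thesis by simp
qed


section \<open>Measures with closed range\<close>

lemma hardy_mean_power: "0 \<le> r \<Longrightarrow> hardy_mean p r (\<lambda>z. z ^ k) = (r ^ k) powr p"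
proof -
  assume r: "0 \<le> r"
  have "hardy_mean p r (\<lambda>z. z ^ k) = (LINT \<zeta>|arc_measure. (r ^ k) powr p)"
    unfolding hardy_mean_def
    by (intro Bochner_Integration.integral_cong refl) (use r in \<open>simp add: norm_power norm_mult\<close>)
  then show ?thesis by (simp add: arc.prob_space[simplified])
qed

lemma Lq_mass_power_tendsto_0:
  assumes p: "0 < p" and q: "0 < q" and carl: "carleson_measure p q \<mu>"
  shows "(\<lambda>k. Lq_mass q \<mu> (\<lambda>z. z ^ k)) \<longlonglongrightarrow> 0"
proof -
  have meas: "(\<lambda>z. norm (z ^ k) powr q) \<in> borel_measurable \<mu>" and int: "integrable \<mu> (\<lambda>z. norm (z ^ k) powr q)" for k
    using carleson_measureD(3)[OF carl power_in_hardy_space[OF p, of k]] by (auto simp: Lq_fun_def)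
  have "(\<lambda>k. LINT z|\<mu>. norm (z ^ k) powr q) \<longlonglongrightarrow> (LINT z|\<mu>. 0)"
  proof (rule integral_dominated_convergence[where w="\<lambda>_. 1"])
    show "integrable \<mu> (\<lambda>_. 1 :: real)" using int[of 0] by simp
    show "AE z in \<mu>. (\<lambda>k. norm (z ^ k) powr q) \<longlonglongrightarrow> 0"
    proof (rule AE_I2)
      fix z assume "z \<in> space \<mu>"
      then have "norm z < 1" using carleson_measureD(2)[OF carl] by simp
      then have "(\<lambda>k. norm (z ^ k)) \<longlonglongrightarrow> 0" by (simp add: norm_power LIMSEQ_power_zero)
      then have "(\<lambda>k. norm (z ^ k) powr q) \<longlonglongrightarrow> 0 powr q"
        using q by (intro tendsto_powr' tendsto_const) auto
      then show "(\<lambda>k. norm (z ^ k) powr q) \<longlonglongrightarrow> 0" using q by simp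
    qed
    show "AE z in \<mu>. norm (norm (z ^ k) powr q) \<le> 1" for k
    proof (rule AE_I2)
      fix z assume "z \<in> space \<mu>"
      then have "norm (z ^ k) \<le> 1"
        using carleson_measureD(2)[OF carl] by (simp add: norm_power power_le_one)
      then have "norm (z ^ k) powr q \<le> 1 powr q" using q by (intro powr_mono2) auto
      then show "norm (norm (z ^ k) powr q) \<le> 1" by simp
    qed
  qed (use meas in auto)
  then show ?thesis by (simp add: Lq_mass_def)
qed

text \<open>An injective embedding with closed range would be bounded below, but the monomials have
  norm one in the Hardy space and tend to zero in \<open>L\<^sup>q(\<mu>)\<close>.\<close>

lemma closed_range_imp_not_injective:
  assumes p: "0 < p" and q: "0 < q" and carl: "carleson_measure p q \<mu>"
    and closed: "closedin (Lq_topology q \<mu>) (carleson_embedding q \<mu> ` hardy_space p)"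
  obtains f z where "f \<in> hardy_space p" "AE z in \<mu>. f z = 0" "norm z < 1" "f z \<noteq> 0"
proof (rule ccontr)
  assume "\<not> thesis"
  with that have inj: "f z = 0" if "f \<in> hardy_space p" "AE z in \<mu>. f z = 0" "norm z < 1" for f z
    using that by blast
  obtain C where C: "\<And>h. h \<in> hardy_space p \<Longrightarrow>
    \<exists>G. hardy_ball p (C * Lq_mass q \<mu> h powr (p / q)) G \<and> (AE z in \<mu>. G z = h z)"
    using closed_range_open_mapping[OF p q carl closed] by metis
  have "1 \<le> C * Lq_mass q \<mu> (\<lambda>z. z ^ k) powr (p / q)" for k
  proof -
    obtain G where G: "hardy_ball p (C * Lq_mass q \<mu> (\<lambda>z. z ^ k) powr (p / q)) G" "AE z in \<mu>. G z = z ^ k"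
      using C[OF power_in_hardy_space[OF p]] by blast
    have GH: "G \<in> hardy_space p" using G(1) hardy_space_iff[OF p] by blast
    have "G z = z ^ k" if z: "norm z < 1" for z
    proof -
      have "AE z in \<mu>. G z - z ^ k = 0" using G(2) by eventually_elim simp
      from inj[OF hardy_space_closed(2)[OF p GH power_in_hardy_space[OF p]] this z] show ?thesis by simp
    qed
    then have hb: "hardy_ball p (C * Lq_mass q \<mu> (\<lambda>z. z ^ k) powr (p / q)) (\<lambda>z. z ^ k)"
      by (rule hardy_ball_cong[OF G(1) p])
    \<comment> \<open>The mean of the monomial at radius \<open>r\<close> is
      \<open>(r ^ k) powr p\<close>, which tends to 1 as \<open>r\<close> does.\<close>
    show ?thesis
    proof (rule tendsto_le[OF _ tendsto_const])
      have "((\<lambda>r::real. (r ^ k) powr p) \<longlongrightarrow> (1 ^ k) powr p) (at_left 1)"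
        by (intro tendsto_intros) auto
      then show "((\<lambda>r::real. (r ^ k) powr p) \<longlongrightarrow> 1) (at_left 1)" by simp
      show "\<forall>\<^sub>F r in at_left 1. (r ^ k) powr p \<le> C * Lq_mass q \<mu> (\<lambda>z. z ^ k) powr (p / q)"
      proof (rule eventually_at_leftI[of 0])
        fix r :: real assume "r \<in> {0<..<1}"
        then show "(r ^ k) powr p \<le> C * Lq_mass q \<mu> (\<lambda>z. z ^ k) powr (p / q)"
          using hardy_ballD(2)[OF hb, of r] hardy_mean_power[of r p k] by simp
      qed simp
    qed simp
  qed
  moreover have "(\<lambda>k. C * Lq_mass q \<mu> (\<lambda>z. z ^ k) powr (p / q)) \<longlonglongrightarrow> C * 0 powr (p / q)"
    by (intro tendsto_intros tendsto_powr' Lq_mass_power_tendsto_0[OF p q carl])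
       (use p q in \<open>auto simp: Lq_mass_nonneg\<close>)
  ultimately have "1 \<le> C * 0 powr (p / q)"
    by (intro LIMSEQ_le_const) auto
  then show False using p q by simp
qed

text \<open>The zero set \<open>Z\<close> is countable and carries the measure, and the points of
  \<open>Z\<close> without mass form a null set. So the set \<open>T\<close> of atoms carries the
  measure; it is infinite because no finite set does, and enumerating it gives the sequence.\<close>

lemma measure_carried_by_zeros:
  assumes sets: "sets \<mu> = sets disk_borel" and fin: "finite_measure \<mu>" and inf: "infinitely_supported \<mu>"
    and f: "f holomorphic_on unit_disk" "AE z in \<mu>. f z = 0" "norm z0 < 1" "f z0 \<noteq> 0"
  obtains z a where "inj z" "range z \<subseteq> unit_disk" "\<And>n::nat. 0 < a n" "is_point_mass_sum \<mu> a z"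
    "\<And>n. f (z n) = 0"
proof -
  interpret finite_measure \<mu> by fact
  have space: "space \<mu> = unit_disk"
    using sets_eq_imp_space_eq[OF sets] by (simp add: space_restrict_space)
  have meas: "A \<in> sets \<mu>" if "A \<in> sets borel" "A \<subseteq> unit_disk" for A
    using that by (auto simp: sets sets_restrict_space_iff)
  define Z where "Z = {z \<in> unit_disk. f z = 0}"
  define T where "T = {z \<in> unit_disk. 0 < measure \<mu> {z}}"
  have cZ: "countable Z"
  proof (cases "f constant_on unit_disk")
    case True
    then have "Z = {}" using f(3,4) by (auto simp: Z_def constant_on_def)
    then show ?thesis by simp
  next
    case False
    have "countable (\<Union>n::nat. {z \<in> cball 0 (1 - 1 / real (Suc n)). f z = 0})"
    proof (rule countable_UN, simp, rule countable_finite)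
      show "finite {z \<in> cball 0 (1 - 1 / real (Suc n)). f z = 0}" for n
      proof (rule holomorphic_compact_finite_zeros[OF f(1) _ _ _ _ False])
        show "cball 0 (1 - 1 / real (Suc n)) \<subseteq> unit_disk"
          using cball_subset_ball_iff[of 0 "1 - 1 / real (Suc n)" "0::complex" 1] by simp
      qed auto
    qed
    moreover have "Z \<subseteq> (\<Union>n::nat. {z \<in> cball 0 (1 - 1 / real (Suc n)). f z = 0})"
    proof
      fix z assume z: "z \<in> Z"
      then obtain n where "1 / real (Suc n) < 1 - norm z"
        using nat_approx_posE[of "1 - norm z"] by (auto simp: Z_def)
      then show "z \<in> (\<Union>n::nat. {z \<in> cball 0 (1 - 1 / real (Suc n)). f z = 0})"
        using z by (intro UN_I[of n]) (auto simp: Z_def)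
    qed
    ultimately show ?thesis by (rule countable_subset[rotated])
  qed
  obtain N where N: "N \<in> null_sets \<mu>" "{z \<in> space \<mu>. f z \<noteq> 0} \<subseteq> N"
    using f(2) by (auto simp: eventually_ae_filter)
  have TZ: "T \<subseteq> Z"
  proof
    fix z assume z: "z \<in> T"
    show "z \<in> Z"
    proof (rule ccontr)
      assume "z \<notin> Z"
      then have "{z} \<subseteq> N" using z N(2) by (auto simp: T_def Z_def space)
      moreover have "{z} \<in> sets \<mu>" by (rule meas) (use z in \<open>auto simp: T_def\<close>)
      ultimately have "{z} \<in> null_sets \<mu>" using null_sets_subset[OF N(1)] by blast
      then have "measure \<mu> {z} = 0" by (simp add: measure_def null_setsD1)
      then show False using z by (simp add: T_def)
    qed
  qed
  have cT: "countable T" using TZ cZ by (rule countable_subset)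
  have sing: "{z} \<in> sets \<mu>" if "z \<in> unit_disk" for z by (rule meas) (use that in auto)
  have Tm: "T \<in> sets \<mu>"
    by (rule sets.countable[OF _ cT]) (auto intro: sing simp: T_def)
  have null: "emeasure \<mu> (space \<mu> - T) = 0"
  proof -
    have "(\<Union>z\<in>Z - T. {z}) \<in> null_sets \<mu>"
    proof (rule null_sets_UN')
      show "countable (Z - T)" using cZ by simp
      fix z assume z: "z \<in> Z - T"
      then have "\<not> 0 < measure \<mu> {z}" by (auto simp: Z_def T_def)
      then have "measure \<mu> {z} = 0" using measure_nonneg[of \<mu> "{z}"] by linarith
      then show "{z} \<in> null_sets \<mu>" using z sing by (auto simp: Z_def emeasure_eq_measure)
    qed
    then have ZTN: "(Z - T) \<union> N \<in> null_sets \<mu>" using N(1) by auto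
    moreover have "space \<mu> - T \<subseteq> (Z - T) \<union> N" using N(2) by (auto simp: Z_def space)
    moreover have "space \<mu> - T \<in> sets \<mu>" using Tm by auto
    ultimately have "space \<mu> - T \<in> null_sets \<mu>" using null_sets_subset[OF ZTN] by blast
    then show ?thesis by (rule null_setsD1)
  qed
  have infT: "infinite T"
  proof
    assume "finite T"
    then show False
      using inf Tm null by (auto simp: infinitely_supported_def concentrated_on_def T_def)
  qed
  define z where "z = from_nat_into T"
  define a where "a = (\<lambda>n. measure \<mu> {z n})"
  have bij: "bij_betw z UNIV T" unfolding z_def by (rule bij_betw_from_nat_into[OF cT infT])
  then have inj: "inj z" and rz: "range z = T" by (auto simp: bij_betw_def)
  have zT: "z n \<in> T" for n using rz by auto
  have "is_point_mass_sum \<mu> a z"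
    unfolding is_point_mass_sum_def
  proof (intro conjI ballI sets)
    fix A assume "A \<in> sets disk_borel"
    then have A: "A \<in> sets \<mu>" by (simp add: sets)
    have "emeasure \<mu> A = emeasure \<mu> (A \<inter> T)"
    proof (rule emeasure_eq_AE)
      have "AE x in \<mu>. x \<notin> space \<mu> - T"
        using null Tm by (intro AE_not_in) auto
      then show "AE x in \<mu>. x \<in> A \<longleftrightarrow> x \<in> A \<inter> T"
        using AE_space by eventually_elim auto
    qed (use A Tm in auto)
    also have "A \<inter> T = (\<Union>n. A \<inter> {z n})" using rz by auto
    also have "emeasure \<mu> \<dots> = (\<Sum>n. emeasure \<mu> (A \<inter> {z n}))"
    proof (rule suminf_emeasure[symmetric])
      show "range (\<lambda>n. A \<inter> {z n}) \<subseteq> sets \<mu>" using A sing zT by (auto simp: T_def)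
      show "disjoint_family (\<lambda>n. A \<inter> {z n})" using inj by (auto simp: disjoint_family_on_def inj_on_def)
    qed
    also have "\<dots> = (\<Sum>n. ennreal (a n) * emeasure (return disk_borel (z n)) A)"
    proof (rule suminf_cong)
      fix n
      show "emeasure \<mu> (A \<inter> {z n}) = ennreal (a n) * emeasure (return disk_borel (z n)) A"
        using A by (cases "z n \<in> A") (auto simp: sets a_def emeasure_eq_measure)
    qed
    finally show "emeasure \<mu> A = (\<Sum>n. ennreal (a n) * emeasure (return disk_borel (z n)) A)" .
  qed
  moreover have "range z \<subseteq> unit_disk" using rz by (auto simp: T_def)
  moreover have "0 < a n" for n using zT[of n] by (simp add: T_def a_def)
  moreover have "f (z n) = 0" for n using zT[of n] TZ by (auto simp: Z_def)
  ultimately show ?thesis using inj that by blast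
qed

text \<open>For \<open>norm z > \<rho>\<close> the distance to \<open>a\<close> is at least
  \<open>d\<close>, so dividing costs a factor \<open>D\<close>; for smaller radii \<open>h\<close>
  is bounded by compactness.\<close>

lemma hardy_space_divide_power:
  assumes p: "0 < p" and a: "norm a < 1" and h: "h holomorphic_on unit_disk"
    and f: "f \<in> hardy_space p" and fh: "\<And>z. norm z < 1 \<Longrightarrow> f z = (z - a) ^ k * h z"
  shows "h \<in> hardy_space p"
proof -
  obtain K where K: "hardy_ball p K f" using f hardy_space_iff[OF p] by blast
  define \<rho> where "\<rho> = (1 + norm a) / 2"
  define d where "d = (1 - norm a) / 2"
  have d: "0 < d" and \<rho>: "\<rho> < 1" using a by (auto simp: d_def \<rho>_def)
  have "bounded (h ` cball 0 \<rho>)"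
    by (intro compact_imp_bounded compact_continuous_image compact_cball
        continuous_on_subset[OF holomorphic_on_imp_continuous_on[OF h]]) (use \<rho> in auto)
  then obtain B0 where B0: "\<forall>z\<in>cball 0 \<rho>. norm (h z) \<le> B0" by (auto simp: bounded_iff)
  define B where "B = max 0 B0"
  have B: "0 \<le> B" "\<And>z. norm z \<le> \<rho> \<Longrightarrow> norm (h z) \<le> B" using B0 by (auto simp: B_def le_max_iff_disj)
  define D where "D = (1 / d) ^ k"
  have "hardy_mean p r h \<le> max (B powr p) (D powr p * K)" if r: "r \<in> {0<..<1}" for r
  proof (cases "r \<le> \<rho>")
    case True
    have "hardy_mean p r h \<le> B powr p * hardy_mean p r (\<lambda>_. 1)"
      by (rule hardy_mean_dominated[OF p _ h]) (use r B True in auto)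
    then show ?thesis by (simp add: hardy_mean_one)
  next
    case False
    have "hardy_mean p r h \<le> D powr p * hardy_mean p r f"
    proof (rule hardy_mean_dominated[OF p hardy_ballD(1)[OF K] h])
      fix z :: complex assume z: "norm z = r"
      have "d \<le> norm (z - a)"
        using norm_triangle_ineq2[of z a] z False by (simp add: d_def \<rho>_def)
      then have "d ^ k \<le> norm (z - a) ^ k" using d by (intro power_mono) auto
      then have "d ^ k * norm (h z) \<le> norm (f z)"
        using fh[of z] z r by (auto simp: norm_mult norm_power intro: mult_right_mono)
      then show "norm (h z) \<le> D * norm (f z)"
        using d by (simp add: D_def power_one_over field_simps)
    qed (use r d in \<open>auto simp: D_def\<close>)
    also have "\<dots> \<le> D powr p * K" using hardy_ballD(2)[OF K] r by (intro mult_left_mono) auto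
    finally show ?thesis by simp
  qed
  then have "hardy_ball p (max (B powr p) (D powr p * K)) h" using h by (simp add: hardy_ball_def)
  then show ?thesis using hardy_space_iff[OF p] by blast
qed

section \<open>Sparse sequences\<close>

lemma sum_half_power_dist_le: "(\<Sum>j<N. (1 / 2 :: real) ^ (if i \<le> j then j - i else i - j)) \<le> 4"
proof -
  have geo: "(\<Sum>j\<in>J. (1 / 2 :: real) ^ g j) \<le> 2" if "finite J" "inj_on g J" for J :: "nat set" and g
  proof -
    have "(\<Sum>j\<in>J. (1 / 2 :: real) ^ g j) = (\<Sum>m\<in>g ` J. (1 / 2) ^ m)"
      using that by (simp add: sum.reindex)
    also have "\<dots> \<le> (\<Sum>m. (1 / 2) ^ m)"
      by (rule sum_le_suminf) (use that in \<open>auto intro: summable_geometric\<close>)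
    also have "\<dots> = 2" by (simp add: suminf_geometric)
    finally show ?thesis .
  qed
  have "(\<Sum>j<N. (1 / 2 :: real) ^ (if i \<le> j then j - i else i - j))
      = (\<Sum>j\<in>{..<N} \<inter> {j. i \<le> j}. (1 / 2) ^ (j - i)) + (\<Sum>j\<in>{..<N} \<inter> - {j. i \<le> j}. (1 / 2) ^ (i - j))"
    by (simp add: if_distrib[of "\<lambda>n. (1 / 2 :: real) ^ n"] sum.If_cases)
  also have "\<dots> \<le> 2 + 2"
    by (intro add_mono geo) (auto simp: inj_on_def)
  finally show ?thesis by simp
qed

text \<open>The denominator is at least half of the larger of the two weights, and the weights
  shrink by a factor 4 per step, so the entry \<open>(i, j)\<close> is at most
  \<open>2 * (1 / 2) ^ |i - j|\<close>. Two geometric series give a bound independent of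
  \<open>N\<close>.\<close>

lemma szego_row_sparse:
  assumes z: "\<And>n::nat. norm (z n) < 1" and sparse: "\<And>n. disk_weight (z (Suc n)) \<le> disk_weight (z n) / 4"
  shows "szego_row {..<N} z i \<le> 8"
proof -
  define w where "w = (\<lambda>n. disk_weight (z n))"
  have w: "0 < w n" for n using z by (simp add: w_def disk_weight_pos)
  have dec: "w (n + d) \<le> w n * ((1 / 2) ^ d)\<^sup>2" for n d
  proof (induction d)
    case (Suc d)
    have "w (n + Suc d) \<le> w (n + d) / 4" using sparse[of "n + d"] by (simp add: w_def)
    also have "\<dots> \<le> w n * ((1 / 2) ^ d)\<^sup>2 / 4" using Suc.IH by simp
    finally show ?case by (simp add: power2_eq_square)
  qed simp
  have entry: "sqrt (w (min i j) * w (max i j)) / norm (1 - cnj (z i) * z j) \<le> 2 * (1 / 2) ^ (max i j - min i j)" for i j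
  proof -
    define m where "m = min i j"
    define M where "M = max i j"
    have mM: "w M \<le> w m * ((1 / 2) ^ (M - m))\<^sup>2" using dec[of m "M - m"] by (simp add: m_def M_def)
    have "w m \<le> 2 * (1 - norm (z m))" unfolding w_def by (rule disk_weight_bounds(2)[OF z])
    also have "1 - norm (z m) \<le> 1 - norm (z i) * norm (z j)"
      using mult_right_le_one_le[of "norm (z i)" "norm (z j)"] mult_left_le_one_le[of "norm (z j)" "norm (z i)"] z[of i] z[of j]
      by (auto simp: m_def min_def less_imp_le)
    also have "\<dots> \<le> norm (1 - cnj (z i) * z j)"
      using norm_triangle_ineq2[of 1 "cnj (z i) * z j"] by (simp add: norm_mult)
    finally have den: "w m / 2 \<le> norm (1 - cnj (z i) * z j)" by simp
    have "sqrt (w m * w M) \<le> sqrt ((w m * (1 / 2) ^ (M - m))\<^sup>2)"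
      using mult_left_mono[OF mM, of "w m"] w[of m] by (intro real_sqrt_le_mono) (simp add: power2_eq_square mult_ac)
    also have "\<dots> = w m * (1 / 2) ^ (M - m)" using w[of m] by simp
    finally have "sqrt (w m * w M) / norm (1 - cnj (z i) * z j) \<le> (w m * (1 / 2) ^ (M - m)) / (w m / 2)"
      using den w[of m] by (intro frac_le) auto
    also have "\<dots> = 2 * (1 / 2) ^ (M - m)" using w[of m] by simp
    finally show ?thesis by (simp add: m_def M_def)
  qed
  have "szego_row {..<N} z i \<le> (\<Sum>j<N. 2 * (1 / 2) ^ (if i \<le> j then j - i else i - j))"
    unfolding szego_row_def
  proof (rule sum_mono)
    fix j
    show "sqrt (disk_weight (z i) * disk_weight (z j)) / norm (1 - cnj (z i) * z j)
        \<le> 2 * (1 / 2) ^ (if i \<le> j then j - i else i - j)"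
      using entry[of i j] by (cases "i \<le> j") (auto simp: w_def min_def max_def mult.commute)
  qed
  also have "\<dots> = 2 * (\<Sum>j<N. (1 / 2) ^ (if i \<le> j then j - i else i - j))" by (simp add: sum_distrib_left)
  also have "\<dots> \<le> 2 * 4" by (intro mult_left_mono sum_half_power_dist_le) simp
  finally show ?thesis by simp
qed

lemma sparse_subsequence:
  fixes w :: "nat \<Rightarrow> real"
  assumes w: "\<And>n. 0 < w n" "w \<longlonglongrightarrow> 0"
  obtains \<sigma> :: "nat \<Rightarrow> nat" where "inj \<sigma>" "\<And>k. w (\<sigma> (Suc k)) \<le> w (\<sigma> k) / 4"
proof -
  have "\<exists>\<sigma>. \<forall>k::nat. True \<and> w (\<sigma> (Suc k)) \<le> w (\<sigma> k) / 4"
  proof (rule dependent_nat_choice)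
    fix n :: nat and k :: nat
    have "\<forall>\<^sub>F m in sequentially. w m < w n / 4"
      using w(1)[of n] by (intro order_tendstoD(2)[OF w(2)]) simp
    then obtain m where "w m < w n / 4" using eventually_happens by force
    then show "\<exists>m. True \<and> w m \<le> w n / 4" by (intro exI[of _ m]) simp
  qed simp
  then obtain \<sigma> :: "nat \<Rightarrow> nat" where \<sigma>: "\<And>k. w (\<sigma> (Suc k)) \<le> w (\<sigma> k) / 4" by blast
  have "w (\<sigma> (Suc k)) < w (\<sigma> k)" for k using \<sigma>[of k] w(1)[of "\<sigma> k"] by linarith
  then have dec: "w (\<sigma> n) < w (\<sigma> m)" if "m < n" for m n
    using that by (induction n) (auto simp: less_Suc_eq intro: less_trans)
  have "inj \<sigma>" by (rule injI) (metis dec less_irrefl linorder_neqE_nat)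
  then show ?thesis using \<sigma> that by blast
qed

lemma closed_range_imp_interpolating:
  assumes p: "0 < p" and q: "0 < q" and carl: "carleson_measure p q \<mu>" and inf: "infinitely_supported \<mu>"
    and closed: "closedin (Lq_topology q \<mu>) (carleson_embedding q \<mu> ` hardy_space p)"
  obtains a z where "p = q" "interpolating_sequence z" "\<And>n::nat. 0 < a n"
    "comparable_to_boundary_distance a z" "is_point_mass_sum \<mu> a z"
proof -
  note Lq = carleson_measureD(3)[OF carl]
  have one: "(\<lambda>_. 1) \<in> hardy_space p"
    using power_in_hardy_space[OF p, of 0] by simp
  have "integrable \<mu> (\<lambda>_. 1 :: real)" using Lq[OF one] by (simp add: Lq_fun_def)
  then have fin: "finite_measure \<mu>"
    by (intro finite_measureI) (simp add: integrable_iff_bounded less_top)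
  obtain f0 z0 where f0: "f0 \<in> hardy_space p" "AE z in \<mu>. f0 z = 0" "norm z0 < 1" "f0 z0 \<noteq> 0"
    by (rule closed_range_imp_not_injective[OF p q carl closed])
  have hol0: "f0 holomorphic_on unit_disk" using f0(1) by (simp add: hardy_space_def)
  obtain z a where inj: "inj z" and zr: "range z \<subseteq> unit_disk" and a: "\<And>n::nat. 0 < a n"
    and pm: "is_point_mass_sum \<mu> a z" and f0z: "\<And>n. f0 (z n) = 0"
    by (rule measure_carried_by_zeros[OF carleson_measureD(1)[OF carl] fin inf hol0 f0(2-4)]) auto
  have zd: "norm (z n) < 1" for n using zr by (auto simp: image_subset_iff)
  define w where "w = (\<lambda>n. disk_weight (z n))"
  have w: "0 < w n" for n using zd by (simp add: w_def disk_weight_pos)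
  note sums = Lq_mass_point_mass_sum[OF pm zr a]
  have AE: "(AE x in \<mu>. f x = g x) \<longleftrightarrow> (\<forall>n. f (z n) = g (z n))"
    if "f \<in> hardy_space p" "g \<in> hardy_space p" for f g
    by (rule AE_point_mass_sum[OF pm zr a]) (use Lq that in \<open>auto simp: Lq_fun_def\<close>)
  obtain C1 where C1: "0 \<le> C1" "\<And>h. h \<in> hardy_space p \<Longrightarrow>
    \<exists>G. hardy_ball p (C1 * Lq_mass q \<mu> h powr (p / q)) G \<and> (AE z in \<mu>. G z = h z)"
    using closed_range_open_mapping[OF p q carl closed] by metis
  have lift: "\<exists>G. hardy_ball p (C1 * Lq_mass q \<mu> h powr (p / q)) G \<and> (\<forall>n. G (z n) = h (z n))"
    if h: "h \<in> hardy_space p" for h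
    using C1(2)[OF h] AE[OF _ h] hardy_space_iff[OF p] by blast
  obtain C2 where C2: "0 \<le> C2" "\<And>K f. hardy_ball p K f \<Longrightarrow> Lq_mass q \<mu> f \<le> C2 * K powr (q / p)"
    using carleson_embedding_bounded[OF p q carl] by metis
  have basis: "\<exists>g. hardy_ball p (C1 * a n powr (p / q)) g \<and> (\<forall>m. g (z m) = (if m = n then 1 else 0))" for n
  proof -
    \<comment> \<open>Dividing \<open>f0\<close> by its full power of \<open>x - z n\<close> makes
      the value at \<open>z n\<close> nonzero and keeps the zeros at the other points. After
      normalisation the mass in \<open>L^q\<close> is exactly \<open>a n\<close>, so the lift has
      Hardy mass at most \<open>C1 * a n powr (p / q)\<close>.\<close>
    obtain k g where g: "g holomorphic_on unit_disk" "g (z n) \<noteq> 0" "\<And>x. x \<in> unit_disk \<Longrightarrow> f0 x = (x - z n) ^ k * g x"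
    proof (rule holomorphic_factor_order[OF hol0, of "z n"])
      show "\<exists>x\<in>unit_disk. f0 x \<noteq> 0" using f0(3,4) by auto
    qed (use zd in auto)
    have gH: "g \<in> hardy_space p"
      by (rule hardy_space_divide_power[OF p zd[of n] g(1) f0(1)]) (use g(3) in auto)
    define h where "h = (\<lambda>x. 1 / g (z n) * g x)"
    have hH: "h \<in> hardy_space p" unfolding h_def by (rule hardy_space_closed(3)[OF p gH gH])
    have hz: "h (z m) = (if m = n then 1 else 0)" for m
    proof (cases "m = n")
      case False
      then have "z m - z n \<noteq> 0" using inj by (auto simp: inj_on_def)
      then have "g (z m) = 0" using g(3)[of "z m"] f0z[of m] zd[of m] by simp
      then show ?thesis using False by (simp add: h_def)
    qed (use g(2) in \<open>simp add: h_def\<close>)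
    have "(\<lambda>m. a m * norm (h (z m)) powr q) sums a n"
      using sums_single[of n "\<lambda>m. a m"] by (simp add: hz if_distrib[of "\<lambda>x. _ * norm x powr q"] cong: if_cong)
    then have "Lq_mass q \<mu> h = a n" using sums_unique2 sums[OF Lq[OF hH]] by blast
    then show ?thesis using lift[OF hH] by (simp add: hz)
  qed
  have wa: "w n \<le> C1 * a n powr (p / q)" for n
  proof -
    obtain g where g: "hardy_ball p (C1 * a n powr (p / q)) g" "g (z n) = 1" using basis[of n] by auto
    show ?thesis using point_bound_hardy_ball[OF p zd[of n] g(1)] g(2) by (simp add: w_def)
  qed
  obtain k :: nat where "2 / p \<le> real k" using real_arch_simple by blast
  then have k: "2 \<le> real k * p" using p by (simp add: field_simps)
  define C3 where "C3 = C2 * (2 powr (real k * p - 2)) powr (q / p)"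
  have C3: "0 \<le> C3" using C2 by (simp add: C3_def)
  \<comment> \<open>The opposite estimate: the bump at \<open>z n\<close> equals 1 there, so its
    mass in \<open>L^q\<close> is at least \<open>a n\<close>, while boundedness of the embedding
    limits it by its Hardy mass.\<close>
  have aw: "a n \<le> C3 * w n powr (q / p)" for n
  proof -
    note hb = hardy_ball_bump[OF p zd[of n] k]
    have bH: "bump k (z n) \<in> hardy_space p" using hb hardy_space_iff[OF p] by blast
    have s: "(\<lambda>m. a m * norm (bump k (z n) (z m)) powr q) sums Lq_mass q \<mu> (bump k (z n))"
      by (rule sums[OF Lq[OF bH]])
    have "a n * norm (bump k (z n) (z n)) powr q \<le> Lq_mass q \<mu> (bump k (z n))"
      using sum_le_suminf[OF sums_summable[OF s], of "{n}"] a sums_unique[OF s] by (auto simp: less_imp_le)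
    then have "a n \<le> Lq_mass q \<mu> (bump k (z n))" by (simp add: bump_self zd)
    also have "\<dots> \<le> C2 * (2 powr (real k * p - 2) * disk_weight (z n)) powr (q / p)" by (rule C2(2)[OF hb])
    also have "\<dots> = C3 * w n powr (q / p)" using w[of n] by (simp add: C3_def w_def powr_mult mult_ac)
    finally show ?thesis .
  qed
  have C1pos: "0 < C1"
    using wa[of 0] w[of 0] C1(1) by (cases "C1 = 0") auto
  define C4 where "C4 = C1 * C3 powr (p / q)"
  have C3pos: "0 < C3" using aw[of 0] a[of 0] C3 by (cases "C3 = 0") auto
  have C4: "0 < C4" using C1pos C3pos by (simp add: C4_def)
  have aw': "C1 * a n powr (p / q) \<le> C4 * w n" for n
  proof -
    have "a n powr (p / q) \<le> (C3 * w n powr (q / p)) powr (p / q)"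
      using aw[of n] a[of n] p q by (intro powr_mono2) auto
    also have "\<dots> = C3 powr (p / q) * w n"
      using p q w[of n] C3 by (simp add: powr_mult powr_powr)
    finally show ?thesis using C1(1) by (simp add: C4_def mult_left_mono mult.assoc)
  qed
  have "uniformly_separated (1 / C4 powr (1 / p)) z"
    unfolding uniformly_separated_def
  proof (intro conjI inj zr allI impI)
    show "0 < 1 / C4 powr (1 / p)" using C4 by simp
    fix J j assume J: "finite J" "j \<in> (J :: nat set)"
    obtain g where g: "hardy_ball p (C1 * a j powr (p / q)) g" "\<And>m. g (z m) = (if m = j then 1 else 0)"
      using basis[of j] by blast
    have hb: "hardy_ball p (C4 * disk_weight (z j)) g"
      using hardy_ball_mono[OF g(1) aw'[of j]] by (simp add: w_def)
    have "1 \<le> C4 powr (1 / p) * norm (blaschke (z ` (J - {j})) (z j))"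
      by (rule blaschke_lower_bound[OF p hb zd]) (use J zd g(2) in \<open>auto split: if_splits\<close>)
    then show "1 / C4 powr (1 / p) \<le> norm (blaschke (z ` (J - {j})) (z j))"
      using C4 by (simp add: divide_le_eq mult.commute)
  qed
  then obtain \<delta> where \<delta>: "uniformly_separated \<delta> z" by blast
  have "\<not> q < p"
  proof
    assume qp: "q < p"
    \<comment> \<open>The weights are chosen so that \<open>|c n|^p * w n\<close> is
      \<open>(n + 1)\<close> to the power \<open>- p / q\<close>, summable for \<open>q < p\<close>,
      while \<open>|c n|^q * w n powr (q / p)\<close> is \<open>1 / (n + 1)\<close>. By
      \<open>wa\<close> the latter is at most a constant times \<open>a n * |c n|^q\<close>, so the
      interpolant would have infinite mass.\<close>
    define c where "c = (\<lambda>n. complex_of_real (real (Suc n) powr (- 1 / q) * w n powr (- 1 / p)))"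
    have c: "norm (c n) powr s = real (Suc n) powr (- (s / q)) * w n powr (- (s / p))" for n s
      by (simp add: c_def norm_mult powr_mult powr_powr)
    have "norm (c n) powr p * disk_weight (z n) = real (Suc n) powr (- (p / q))" for n
      using w[of n] p by (simp add: c powr_minus w_def)
    moreover have "summable (\<lambda>n. real (Suc n) powr (- (p / q)))"
      using qp q by (subst summable_Suc_iff[where f="\<lambda>n. real n powr (- (p / q))"]) (simp add: summable_real_powr_iff field_simps)
    ultimately have "summable (\<lambda>n. norm (c n) powr p * disk_weight (z n))" by simp
    from uniformly_separated_imp_interpolating_hardy[OF \<delta> p this]
    obtain g where g: "g \<in> hardy_space p" "\<And>n. g (z n) = c n" by blast
    have "summable (\<lambda>n. a n * norm (c n) powr q)"
      using sums_summable[OF sums[OF Lq[OF g(1)]]] by (simp add: g(2))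
    then have "summable (\<lambda>n. C1 powr (q / p) * (a n * norm (c n) powr q))" by (rule summable_mult)
    then have "summable (\<lambda>n. 1 / real (Suc n))"
    proof (rule summable_comparison_test')
      fix n
      have "w n powr (q / p) \<le> (C1 * a n powr (p / q)) powr (q / p)"
        using wa[of n] w[of n] p q by (intro powr_mono2) auto
      also have "\<dots> = C1 powr (q / p) * a n" using C1(1) a[of n] p q by (simp add: powr_mult powr_powr)
      finally have "w n powr (q / p) * norm (c n) powr q \<le> C1 powr (q / p) * a n * norm (c n) powr q"
        by (rule mult_right_mono) simp
      moreover have "w n powr (q / p) * norm (c n) powr q = 1 / real (Suc n)"
        using w[of n] q by (simp add: c powr_minus divide_inverse del: of_nat_Suc)
      ultimately show "norm (1 / real (Suc n)) \<le> C1 powr (q / p) * (a n * norm (c n) powr q)"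
        by (simp add: mult.assoc)
    qed
    then have "summable (\<lambda>n. 1 / real n)" by (subst (asm) summable_Suc_iff[where f="\<lambda>n. 1 / real n"])
    then show False using not_summable_harmonic[where 'a=real] by (simp add: inverse_eq_divide)
  qed
  moreover have "\<not> p < q"
  proof
    assume pq: "p < q"
    \<comment> \<open>The constant 1 lies in \<open>L^q\<close>; then \<open>wa\<close> forces the
      points towards the circle, which makes sparse subsequences available.\<close>
    have "summable a" using sums_summable[OF sums[OF Lq[OF one]]] by simp
    then have "a \<longlonglongrightarrow> 0" by (rule summable_LIMSEQ_zero)
    then have "(\<lambda>n. C1 * a n powr (p / q)) \<longlonglongrightarrow> C1 * 0 powr (p / q)"
      using p q a by (intro tendsto_intros tendsto_powr') (auto simp: less_imp_le)
    then have lim: "(\<lambda>n. C1 * a n powr (p / q)) \<longlonglongrightarrow> 0" using p q by simp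
    have "w \<longlonglongrightarrow> 0"
      by (rule tendsto_sandwich[OF _ _ tendsto_const lim]) (use w wa in \<open>auto simp: less_imp_le\<close>)
    then obtain \<sigma> :: "nat \<Rightarrow> nat" where \<sigma>: "inj \<sigma>" "\<And>k. w (\<sigma> (Suc k)) \<le> w (\<sigma> k) / 4"
      using sparse_subsequence[of w] w by metis
    \<comment> \<open>8 is the row bound for sparse sequences, \<open>C1\<close> the lifting
      constant, and \<open>C3\<close> bounds the mass contributed by each point.\<close>
    define E where "E = 8 * C1 * C3 powr (p / q)"
    have E0: "0 \<le> E" using C1(1) by (simp add: E_def)
    have bound: "real N \<le> E * real N powr (p / q)" for N
    proof -
      define S where "S = \<sigma> ` {..<N}"
      have S: "finite S" "card S = N" using \<sigma>(1) by (auto simp: S_def card_image inj_on_subset)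
      \<comment> \<open>Each point of \<open>S\<close> contributes exactly 1 to the sampling sum of
        any lift but at most \<open>C3\<close> to the mass in \<open>L^q\<close>.\<close>
      define c where "c = (\<lambda>n. if n \<in> S then complex_of_real (w n powr (- 1 / p)) else 0)"
      have "summable (\<lambda>n. norm (c n) powr p * disk_weight (z n))"
        by (rule summable_finite[OF S(1)]) (simp add: c_def)
      from uniformly_separated_imp_interpolating_hardy[OF \<delta> p this]
      obtain h where h: "h \<in> hardy_space p" "\<And>n. h (z n) = c n" by blast
      have "Lq_mass q \<mu> h = (\<Sum>n\<in>S. a n * norm (c n) powr q)"
        using sums_unique2[OF sums[OF Lq[OF h(1)]]] sums_finite[OF S(1), of "\<lambda>n. a n * norm (h (z n)) powr q"]
        by (simp add: h(2) c_def)
      also have "\<dots> \<le> (\<Sum>n\<in>S. C3)"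
      proof (rule sum_mono)
        fix n assume "n \<in> S"
        then have "norm (c n) powr q = w n powr (- (q / p))"
          by (simp add: c_def powr_powr)
        then have "a n * norm (c n) powr q \<le> C3 * w n powr (q / p) * w n powr (- (q / p))"
          using aw[of n] by (simp add: mult_right_mono)
        also have "\<dots> = C3" using w[of n] by (simp add: powr_minus)
        finally show "a n * norm (c n) powr q \<le> C3" .
      qed
      finally have mass: "Lq_mass q \<mu> h \<le> C3 * real N" using S(2) by (simp add: mult.commute)
      obtain G where G: "hardy_ball p (C1 * Lq_mass q \<mu> h powr (p / q)) G" "\<And>n. G (z n) = h (z n)"
        using lift[OF h(1)] by blast
      have "(\<Sum>i<N. disk_weight (z (\<sigma> i)) * norm (G (z (\<sigma> i))) powr p) \<le> 8 * (C1 * Lq_mass q \<mu> h powr (p / q))"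
        using szego_row_sparse[of "z \<circ> \<sigma>"] zd \<sigma>(2)
        by (intro sampling_bound_hardy_ball[OF p _ _ _ _ G(1)]) (auto simp: o_def w_def)
      moreover have "disk_weight (z (\<sigma> i)) * norm (G (z (\<sigma> i))) powr p = 1" if "i < N" for i
      proof -
        have "norm (G (z (\<sigma> i))) powr p = w (\<sigma> i) powr (- 1)"
          using that p by (simp add: G(2) h(2) c_def S_def powr_powr)
        then show ?thesis using w[of "\<sigma> i"] by (simp add: powr_minus w_def)
      qed
      ultimately have "real N \<le> 8 * (C1 * Lq_mass q \<mu> h powr (p / q))" by simp
      also have "\<dots> \<le> 8 * (C1 * (C3 * real N) powr (p / q))"
        using mass p q C1(1) by (intro mult_left_mono powr_mono2) (auto simp: Lq_mass_nonneg)
      also have "\<dots> = E * real N powr (p / q)" using C3 by (simp add: E_def powr_mult)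
      finally show ?thesis .
    qed
    define e where "e = 1 - p / q"
    have e: "0 < e" using pq q by (simp add: e_def field_simps)
    \<comment> \<open>Such an \<open>N\<close> has \<open>real N powr e >= E + 1\<close>, which
      contradicts \<open>bound\<close>, since \<open>1 - e = p / q\<close>.\<close>
    obtain N :: nat where N: "(E + 1) powr (1 / e) \<le> real N" "1 \<le> N"
      using real_arch_simple[of "max 1 ((E + 1) powr (1 / e))"] by auto
    have "E + 1 = ((E + 1) powr (1 / e)) powr e" using e E0 by (simp add: powr_powr)
    also have "\<dots> \<le> real N powr e" using N(1) e by (intro powr_mono2) auto
    finally have "(E + 1) * real N powr (p / q) \<le> real N powr e * real N powr (p / q)"
      by (rule mult_right_mono) simp
    also have "\<dots> = real N" using N(2) by (simp add: e_def flip: powr_add)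
    also have "\<dots> \<le> E * real N powr (p / q)" by (rule bound)
    finally have "real N powr (p / q) \<le> 0" by (simp add: algebra_simps)
    then show False using N(2) by simp
  qed
  ultimately have eq: "p = q" by simp
  have "interpolating_sequence z"
    unfolding interpolating_sequence_def
  proof (intro conjI inj zr equalityI subsetI)
    fix c :: "nat \<Rightarrow> complex" assume "c \<in> {(\<lambda>n. f (z n)) | f. f \<in> hardy_infinity}"
    then obtain f where f: "f \<in> hardy_infinity" "c = (\<lambda>n. f (z n))" by blast
    have "range c \<subseteq> f ` unit_disk" using zr f(2) by auto
    then show "c \<in> {c. bounded (range c)}"
      using f(1) bounded_subset by (auto simp: hardy_infinity_def)
  next
    fix c :: "nat \<Rightarrow> complex" assume "c \<in> {c. bounded (range c)}"
    then obtain B where B: "\<And>n. norm (c n) \<le> B" by (auto simp: bounded_iff)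
    obtain f where f: "f holomorphic_on unit_disk" "\<And>n. f (z n) = c n"
      "\<And>\<zeta>. norm \<zeta> < 1 \<Longrightarrow> norm (f \<zeta>) \<le> exp (2 - 4 * ln \<delta>) / \<delta> * B"
      by (rule uniformly_separated_imp_interpolating_bounded[of \<delta> z c B, OF \<delta> B]) auto
    have "bounded (f ` unit_disk)"
      unfolding bounded_iff by (rule exI[of _ "exp (2 - 4 * ln \<delta>) / \<delta> * B"]) (use f(3) in auto)
    then have "f \<in> hardy_infinity" "c = (\<lambda>n. f (z n))"
      using f by (auto simp: hardy_infinity_def)
    then show "c \<in> {(\<lambda>n. f (z n)) | f. f \<in> hardy_infinity}" by blast
  qed
  moreover have "comparable_to_boundary_distance a z"
  proof -
    have "1 / C1 * (1 - norm (z n)) \<le> a n" for n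
    proof -
      have "1 - norm (z n) \<le> C1 * a n"
        using wa[of n] disk_weight_bounds(1)[OF zd[of n]] a[of n] q by (simp add: eq w_def)
      then show ?thesis using C1pos by (simp add: field_simps)
    qed
    moreover have "a n \<le> (C3 * 2) * (1 - norm (z n))" for n
    proof -
      have "a n \<le> C3 * w n" using aw[of n] w[of n] q by (simp add: eq)
      also have "\<dots> \<le> C3 * (2 * (1 - norm (z n)))"
        unfolding w_def using C3 by (intro mult_left_mono disk_weight_bounds(2) zd)
      finally show ?thesis by (simp add: algebra_simps)
    qed
    ultimately show ?thesis
      unfolding comparable_iff[of z a, OF zd] using C1pos by (intro exI[of _ "1 / C1"]) auto
  qed
  ultimately show ?thesis using eq a pm that by blast
qed

theorem theorem1p1:
  fixes p q :: real and \<mu> :: "complex measure"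
  assumes "0 < p" and "0 < q"
    and "carleson_measure p q \<mu>"
    and "infinitely_supported \<mu>"
  shows "closedin (Lq_topology q \<mu>) (carleson_embedding q \<mu> ` hardy_space p) \<longleftrightarrow>
    p = q \<and>
    (\<exists>(a :: nat \<Rightarrow> real) (z :: nat \<Rightarrow> complex).
       interpolating_sequence z \<and> (\<forall>n. 0 < a n) \<and>
       comparable_to_boundary_distance a z \<and> is_point_mass_sum \<mu> a z)"
proof (standard, goal_cases)
  case 1
  then obtain a z where "p = q" "interpolating_sequence z" "\<And>n::nat. 0 < a n"
    "comparable_to_boundary_distance a z" "is_point_mass_sum \<mu> a z"
    using closed_range_imp_interpolating[OF assms] by blast
  then show ?case by blast
next
  case 2
  then show ?case using interpolating_imp_closed_range assms by blast
qed

end
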